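(* Let $P$ be a full-dimensional simple lattice polytope in $M_{\mathbb R}\simeq\mathbb R^n$ with facets $F_1,\dots,F_r$ and inner normal fan $\Sigma$ with rays $\Sigma(1)=\{\rho_1,\dots,\rho_r\}$ ($\rho_i$ corresponding to the facet $F_i$). For a subset $K\subseteq\{1,\dots,r\}$ let $P^K=P\setminus\bigcup_{i\in K}F_i$, and let $$T_y^K\Big(\frac{\partial}{\partial h}\Big):=(1+y)^{n-r}\cdot\sum_{g\in G_\Sigma}\prod_{i\in K}\frac{(1+y)\cdot a_{\rho_i}(g)\cdot\frac{\partial}{\partial h_i}\cdot e^{-\frac{\partial}{\partial h_i}}}{1-a_{\rho_i}(g)\cdot e^{-\frac{\partial}{\partial h_i}}}\cdot\prod_{i\notin K}\frac{\frac{\partial}{\partial h_i}\big(1+y\cdot a_{\rho_i}(g)e^{-\frac{\partial}{\partial h_i}}\big)}{1-a_{\rho_i}(g)\cdot e^{-\frac{\partial}{\partial h_i}}}.$$ Let $f$ be a polynomial function on $M_{\mathbb R}$. Then: $$T_y^K\Big(\frac{\partial}{\partial h}\Big)\Big(\int_{P(h)}f(m)\,dm\Big)\Big|_{h=0}=\sum_{E\preceq P^K}(1+y)^{\dim(E)}\cdot\sum_{m\in\mathrm{Relint}(E)\cap M}f(m).$$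
   Context: $M\simeq\mathbb Z^n$ is a lattice with dual $N$ and pairing $\langle\cdot,\cdot\rangle$; $\mathbb T=N\otimes\mathbb C^*$; $u\in N$ is viewed as a one-parameter subgroup $u:\mathbb C^*\to\mathbb T$. Simple means each vertex of $P$ lies on exactly $n$ facets. $P=\{m\in M_{\mathbb R}\mid\langle m,u_{\rho_i}\rangle+c_i\ge0,\ i=1,\dots,r\}$ with $u_{\rho_i}\in N$ the ray generators and $c_i\in\mathbb Z$. For a small real vector $h=(h_1,\dots,h_r)$, $P(h)=\{m\mid\langle m,u_{\rho_i}\rangle+c_i+h_i\ge0\ \forall i\}$. Lebesgue measure is normalized so that the unit cube of $M$ has volume $1$. The sum over $E\preceq P^K$ runs over the faces $E$ of $P$ (including $P$) whose relative interior is contained in $P^K$, i.e. those not contained in any $F_i$, $i\in K$. $G=\ker\big((\mathbb C^* )^{\Sigma(1)}\to\mathbb T,\ (t_\rho)\mapsto\prod_\rho u_\rho(t_\rho)\big)$, $a_\rho$ is the projection to the $\rho$-th factor, $G_\tau=\{g\in G\mid a_\rho(g)=1\ \forall\rho\notin\tau(1)\}$ for $\tau\in\Sigma$, and $G_\Sigma=\bigcup_{\tau\in\Sigma}G_\tau$ (a finite set). The operator is read as a power series in the $\frac{\partial}{\partial h_i}$; $\int_{P(h)}f(m)\,dm$ is polynomial in $h$ near $0$, so only finitely many terms contribute. $y$ is a formal parameter. *)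

theory Defs
  imports "HOL-Analysis.Analysis" "HOL-Computational_Algebra.Computational_Algebra"
begin

text \<open>
  The lattices \<open>M\<close> and \<open>N\<close> are both \<open>int ^ 'n\<close>, in dual bases, so that the pairing of
  \<open>m \<in> M\<^sub>\<real>\<close> with \<open>u \<in> N\<close> is \<open>m \<bullet> lat u\<close>, the unit cube of \<open>M\<close> has \<^const>\<open>lborel\<close>-measure 1,
  and \<open>N \<otimes> \<complex>\<^sup>*\<close> is the group of vectors in \<open>complex ^ 'n\<close> with nonzero entries under the
  componentwise product.
\<close>

definition lat :: "int ^ 'n \<Rightarrow> real ^ 'n" where
  "lat u = (\<chi> j. of_int (u $ j))"

definition one_param :: "int ^ 'n \<Rightarrow> complex \<Rightarrow> complex ^ 'n" where
  "one_param u t = (\<chi> j. t powi (u $ j))"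


subsection \<open>Polytopes and normal fans\<close>

definition lattice_polytope :: "(real ^ 'n) set \<Rightarrow> bool" where
  "lattice_polytope P \<longleftrightarrow> (\<exists>V. finite V \<and> V \<subseteq> range lat \<and> P = convex hull V)"

definition simple_polytope :: "(real ^ 'n) set \<Rightarrow> bool" where
  "simple_polytope P \<longleftrightarrow>
     (\<forall>v. v extreme_point_of P \<longrightarrow> card {F. F facet_of P \<and> v \<in> F} = CARD('n))"

text \<open>The inner normal cone of the face \<open>Q\<close>: the functionals attaining their minimum over \<open>P\<close> on \<open>Q\<close>.\<close>

definition inner_normal_cone :: "(real ^ 'n) set \<Rightarrow> (real ^ 'n) set \<Rightarrow> (real ^ 'n) set" where
  "inner_normal_cone P Q = {w. \<forall>q\<in>Q. \<forall>p\<in>P. q \<bullet> w \<le> p \<bullet> w}"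

definition inner_normal_fan :: "(real ^ 'n) set \<Rightarrow> (real ^ 'n) set set" where
  "inner_normal_fan P = {inner_normal_cone P Q |Q. Q face_of P \<and> Q \<noteq> {}}"

definition cone_rays :: "(real ^ 'n) set \<Rightarrow> (real ^ 'n) set set" where
  "cone_rays \<tau> = {\<rho>. \<rho> face_of \<tau> \<and> aff_dim \<rho> = 1}"

definition is_ray_generator :: "(real ^ 'n) set \<Rightarrow> int ^ 'n \<Rightarrow> bool" where
  "is_ray_generator \<rho> u \<longleftrightarrow> \<rho> \<inter> range lat = range (\<lambda>k::nat. real k *\<^sub>R lat u)"

text \<open>The polytope \<open>P(h)\<close>, with facet normals \<open>u\<^sub>1, \<dots>, u\<^sub>r\<close>.\<close>

definition shifted_polytope ::
    "nat \<Rightarrow> (nat \<Rightarrow> int ^ 'n) \<Rightarrow> (nat \<Rightarrow> int) \<Rightarrow> (nat \<Rightarrow> real) \<Rightarrow> (real ^ 'n) set" where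
  "shifted_polytope r u c h = {m. \<forall>i\<in>{1..r}. m \<bullet> lat (u i) + of_int (c i) + h i \<ge> 0}"


subsection \<open>The groups \<open>G\<close>, \<open>G\<^sub>\<tau>\<close> and the set \<open>G\<^sub>\<Sigma>\<close>\<close>

text \<open>
  The ray \<open>\<rho>\<^sub>i\<close> is represented by its index \<open>i \<in> {1..r}\<close>, so \<open>a\<^sub>\<rho>\<^sub>i(g)\<close> is \<open>g i\<close>; elements of
  \<open>(\<complex>\<^sup>*)\<^sup>r\<close> are extensional functions, so that equality is equality on \<open>{1..r}\<close>.
\<close>

definition Ggrp :: "nat \<Rightarrow> (nat \<Rightarrow> int ^ 'n) \<Rightarrow> (nat \<Rightarrow> complex) set" where
  "Ggrp r u = {t \<in> {1..r} \<rightarrow>\<^sub>E (UNIV - {0}). (\<Prod>i\<in>{1..r}. one_param (u i) (t i)) = 1}"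

definition Gcone ::
    "nat \<Rightarrow> (nat \<Rightarrow> int ^ 'n) \<Rightarrow> (nat \<Rightarrow> (real ^ 'n) set) \<Rightarrow> (real ^ 'n) set \<Rightarrow> (nat \<Rightarrow> complex) set" where
  "Gcone r u \<rho> \<tau> = {g \<in> Ggrp r u. \<forall>i\<in>{1..r}. \<rho> i \<notin> cone_rays \<tau> \<longrightarrow> g i = 1}"

definition Gfan ::
    "nat \<Rightarrow> (nat \<Rightarrow> int ^ 'n) \<Rightarrow> (nat \<Rightarrow> (real ^ 'n) set) \<Rightarrow> (real ^ 'n) set set \<Rightarrow> (nat \<Rightarrow> complex) set" where
  "Gfan r u \<rho> \<Sigma> = (\<Union>\<tau>\<in>\<Sigma>. Gcone r u \<rho> \<tau>)"


subsection \<open>The operator \<open>T\<^sub>y\<^sup>K(\<partial>/\<partial>h)\<close>\<close>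

text \<open>
  The formal parameter \<open>y\<close> is the indeterminate of the field \<open>\<complex>(y)\<close>, in which the
  possibly negative power \<open>(1 + y)\<^sup>n\<^sup>-\<^sup>r\<close> makes sense.
\<close>

type_synonym ratfun = "complex poly fract"

definition scal :: "complex \<Rightarrow> ratfun" where
  "scal z = to_fract [:z:]"

definition yvar :: ratfun where
  "yvar = to_fract [:0, 1:]"

text \<open>
  Factors of the operator for \<open>i \<in> K\<close> and \<open>i \<notin> K\<close>, as power series in \<open>fps_X = \<partial>/\<partial>h\<^sub>i\<close>, with
  \<open>a = a\<^sub>\<rho>\<^sub>i(g)\<close>. If \<open>a = 1\<close>, the denominator has subdegree 1 and is not invertible, but the
  numerator is divisible by it; the division of power series cancels the common factor.
\<close>

definition factor_in :: "complex \<Rightarrow> ratfun fps" where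
  "factor_in a =
     (fps_const (1 + yvar) * fps_const (scal a) * fps_X * fps_exp (- 1))
       / (1 - fps_const (scal a) * fps_exp (- 1))"

definition factor_out :: "complex \<Rightarrow> ratfun fps" where
  "factor_out a =
     (fps_X * (1 + fps_const yvar * fps_const (scal a) * fps_exp (- 1)))
       / (1 - fps_const (scal a) * fps_exp (- 1))"

text \<open>
  A power series in \<open>\<partial>/\<partial>h\<^sub>1, \<dots>, \<partial>/\<partial>h\<^sub>r\<close> is given by its family of coefficients, indexed by
  exponents \<open>\<alpha> \<in> {1..r} \<rightarrow>\<^sub>E UNIV\<close>. As different factors of the product involve different variables,
  its coefficient at \<open>\<alpha>\<close> is the product of the coefficients of the factors at \<open>\<alpha> i\<close>.
\<close>

definition T_op ::
    "nat \<Rightarrow> nat \<Rightarrow> nat set \<Rightarrow> (nat \<Rightarrow> complex) set \<Rightarrow> (nat \<Rightarrow> nat) \<Rightarrow> ratfun" where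
  "T_op n r K G\<^sub>\<Sigma> \<alpha> =
     (1 + yvar) powi (int n - int r) *
       (\<Sum>g\<in>G\<^sub>\<Sigma>. (\<Prod>i\<in>K. fps_nth (factor_in (g i)) (\<alpha> i)) *
                (\<Prod>i\<in>{1..r} - K. fps_nth (factor_out (g i)) (\<alpha> i)))"

definition partial_deriv ::
    "nat \<Rightarrow> ((nat \<Rightarrow> real) \<Rightarrow> complex) \<Rightarrow> ((nat \<Rightarrow> real) \<Rightarrow> complex)" where
  "partial_deriv i I h = vector_derivative (\<lambda>t. I (h(i := t))) (at (h i))"

text \<open>The derivative in \<open>h\<^sub>r\<close> (\<open>\<alpha> r\<close> times) is taken first, that in \<open>h\<^sub>1\<close> last.\<close>

definition mixed_partial ::
    "nat \<Rightarrow> (nat \<Rightarrow> nat) \<Rightarrow> ((nat \<Rightarrow> real) \<Rightarrow> complex) \<Rightarrow> ((nat \<Rightarrow> real) \<Rightarrow> complex)" where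
  "mixed_partial r \<alpha> I = foldr (\<lambda>i. partial_deriv i ^^ \<alpha> i) [1..<Suc r] I"

text \<open>
  The value at \<open>h = 0\<close> of an operator with coefficients \<open>T\<close> applied to \<open>I\<close>. Only the terms with a
  nonzero derivative of \<open>I\<close> are summed; there are finitely many if \<open>I\<close> is polynomial near 0.
\<close>

definition apply_at_zero ::
    "nat \<Rightarrow> ((nat \<Rightarrow> nat) \<Rightarrow> ratfun) \<Rightarrow> ((nat \<Rightarrow> real) \<Rightarrow> complex) \<Rightarrow> ratfun" where
  "apply_at_zero r T I =
     (\<Sum>\<alpha> | \<alpha> \<in> {1..r} \<rightarrow>\<^sub>E UNIV \<and> mixed_partial r \<alpha> I (\<lambda>_. 0) \<noteq> 0.
        T \<alpha> * scal (mixed_partial r \<alpha> I (\<lambda>_. 0)))"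

end

theory Submission
  imports Defs "HOL-Complex_Analysis.Complex_Analysis"
begin

text \<open>
  Fix a vector \<open>\<xi>\<close> that is not orthogonal to any edge of \<open>P\<close>. The indicator function of \<open>P\<close>, or more
  generally a product over the facets of weights that only depend on the sign of the facet
  functional, is an alternating sum over the vertices of analogous functions of the tangent cones,
  with those edges flipped along which \<open>\<xi>\<close> increases (Lawrence, Varchenko). Therefore
  integrals and lattice sums of \<open>exp \<langle>\<xi>, m\<rangle>\<close> over \<open>P\<close> become absolutely convergent integrals and sums over
  simplicial cones, which are products of integrals and of geometric series; the sublattice
  condition in the latter is expressed by the characters in \<open>G\<^sub>\<tau>\<close>, whose number is the reciprocal
  of the Jacobian in the former. Replacing \<open>\<xi>\<close> by \<open>t \<xi>\<close> and comparing coefficients of powers of \<open>t\<close>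
  shows that the integral of \<open>\<langle>\<xi>, m\<rangle>\<^sup>k\<close> over \<open>P(h)\<close> is a polynomial in \<open>h\<close>, namely a sum over the
  vertices of powers of affine functions, and that the operator turns it into the lattice sum vertex
  by vertex. The powers of linear forms with generic \<open>\<xi>\<close> span all polynomials.
\<close>


section \<open>Polarised decompositions\<close>

text \<open>Lattice sums see boundary points, so the decomposition has to hold pointwise, with
  arbitrary weights on the facets, and not only up to null sets or up to cones containing lines.
  Flipping makes all vertex terms converge for the same real \<xi>, and the flipped and unflipped
  series have the same closed form. Put q = 1 + y, with weight q inside a facet inequality and
  weight 1 or 0 on a facet outside or inside K. A lattice point in the relative interior of a
  d-dimensional face that meets no facet of K there has total weight q^(r - n + d), so division by
  q^(r - n) leaves (1 + y)^d. The prefactor (1 + y)^(n - r) of the operator has the same origin: a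
  vertex term depends on the n variables of its own facets only, and the other r - n factors enter
  with their constant coefficient, which is 1 + y if a = 1 and 0 otherwise. This also cuts the sum
  over \<open>G\<^sub>\<Sigma>\<close> down to the group of the vertex. Division by q excludes y =
  -1; the identity in rational functions is therefore reduced to one between polynomials in y,
  checked at all other y.\<close>

lemma open_avoid_hyperplanes:
  fixes D :: "'a::euclidean_space set"
  assumes "finite D" "0 \<notin> D" "open S" "S \<noteq> {}"
  obtains x where "x \<in> S" "\<And>d. d \<in> D \<Longrightarrow> x \<bullet> d \<noteq> 0"
proof -
  have "\<exists>x\<in>S. \<forall>d\<in>D. x \<bullet> d \<noteq> 0"
    using assms
  proof (induction arbitrary: S)
    case empty
    then show ?case by auto
  next
    case (insert d D)
    let ?S = "S \<inter> {x. d \<bullet> x \<noteq> 0}"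
    have "open {x. d \<bullet> x \<noteq> 0}"
      by (intro open_Collect_neq continuous_intros)
    then have "open ?S" using insert.prems by blast
    moreover have "?S \<noteq> {}"
    proof
      assume "?S = {}"
      then have "S \<subseteq> {x. d \<bullet> x = 0}" by auto
      then have "S \<subseteq> interior {x. d \<bullet> x = 0}" by (intro interior_maximal insert.prems)
      moreover have "interior {x. d \<bullet> x = 0} = {}"
        using insert.prems by (intro interior_hyperplane) auto
      ultimately show False using insert.prems by auto
    qed
    ultimately obtain x where "x \<in> ?S" "\<forall>d\<in>D. x \<bullet> d \<noteq> 0"
      using insert by (metis insertCI)
    then show ?case by (auto simp: inner_commute)
  qed
  then show ?thesis using that by blast
qed

definition step_weight :: "complex \<Rightarrow> complex \<Rightarrow> real \<Rightarrow> complex" where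
  "step_weight q w s = (if s > 0 then q else if s = 0 then w else 0)"

text \<open>
  A vertex is given by the set \<open>V\<close> of the facets through it, and \<open>\<alpha> V i\<close> is the direction of the edge
  along which it leaves the facet \<open>i\<close>. Everything but the vertices themselves is independent of \<open>c\<close>,
  so that the polytopes \<open>P(h)\<close> for small \<open>h\<close> share \<open>VV\<close> and \<open>\<alpha>\<close>.
\<close>

locale vertex_system =
  fixes I :: "nat set" and u :: "nat \<Rightarrow> 'a::euclidean_space" and VV :: "nat set set"
    and \<alpha> :: "nat set \<Rightarrow> nat \<Rightarrow> 'a" and c :: "nat \<Rightarrow> real"
  assumes finite_I: "finite I"
    and VV_ne: "VV \<noteq> {}"
    and VV_sub: "V \<in> VV \<Longrightarrow> V \<subseteq> I"
    and VV_card: "V \<in> VV \<Longrightarrow> card V = DIM('a)"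
    and dual: "V \<in> VV \<Longrightarrow> i \<in> V \<Longrightarrow> j \<in> V \<Longrightarrow> \<alpha> V i \<bullet> u j = (if i = j then 1 else 0)"
    and expand: "V \<in> VV \<Longrightarrow> (\<Sum>i\<in>V. (x \<bullet> u i) *\<^sub>R \<alpha> V i) = x"
    and nbr: "V \<in> VV \<Longrightarrow> i \<in> V \<Longrightarrow> \<exists>!V'. V' \<in> VV \<and> V' \<noteq> V \<and> V - {i} \<subseteq> V'"
    and pos: "V \<in> VV \<Longrightarrow> i \<in> I - V \<Longrightarrow> - (\<Sum>j\<in>V. c j *\<^sub>R \<alpha> V j) \<bullet> u i + c i > 0"
begin

definition ell :: "nat \<Rightarrow> 'a \<Rightarrow> real" where
  "ell i x = x \<bullet> u i + c i"

definition vert :: "nat set \<Rightarrow> 'a" where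
  "vert V = - (\<Sum>i\<in>V. c i *\<^sub>R \<alpha> V i)"

definition generic :: "'a \<Rightarrow> bool" where
  "generic \<xi> \<longleftrightarrow> (\<forall>V\<in>VV. \<forall>i\<in>V. \<xi> \<bullet> \<alpha> V i \<noteq> 0)"

text \<open>If \<xi> decreases along the edge, this is the weight itself, supported on s >= 0.
  Otherwise q is subtracted, which leaves -q for s < 0, w i - q at s = 0 and 0 beyond. For generic
  \<xi>, multiplication by \<open>exp ((\<xi> \<bullet> \<alpha> V i) * s)\<close> gives exponential
  decay on the support in both cases.\<close>

definition pterm :: "complex \<Rightarrow> (nat \<Rightarrow> complex) \<Rightarrow> 'a \<Rightarrow> nat set \<Rightarrow> nat \<Rightarrow> real \<Rightarrow> complex" where
  "pterm q w \<xi> V i s = step_weight q (w i) s - (if \<xi> \<bullet> \<alpha> V i < 0 then 0 else q)"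

definition psum :: "complex \<Rightarrow> (nat \<Rightarrow> complex) \<Rightarrow> 'a \<Rightarrow> 'a \<Rightarrow> complex" where
  "psum q w \<xi> x = (\<Sum>V\<in>VV. \<Prod>i\<in>V. pterm q w \<xi> V i (ell i x))"

lemma finite_VV: "finite VV"
  using finite_I VV_sub by (meson PowI finite_Pow_iff finite_subset subsetI)

lemma finite_V: "V \<in> VV \<Longrightarrow> finite V"
  using finite_I VV_sub finite_subset by blast

lemma \<alpha>_ne0: "V \<in> VV \<Longrightarrow> i \<in> V \<Longrightarrow> \<alpha> V i \<noteq> 0"
  using dual[of V i i] by auto

lemma vert_dot: "V \<in> VV \<Longrightarrow> i \<in> V \<Longrightarrow> vert V \<bullet> u i = - c i"
  using finite_V[of V]
  by (simp add: vert_def inner_sum_left dual if_distrib[of "\<lambda>x. _ * x"] cong: if_cong)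

lemma ell_vert: "V \<in> VV \<Longrightarrow> i \<in> V \<Longrightarrow> ell i (vert V) = 0"
  by (simp add: ell_def vert_dot)

lemma ell_vert_pos: "V \<in> VV \<Longrightarrow> i \<in> I - V \<Longrightarrow> ell i (vert V) > 0"
  using pos[of V i] by (simp add: ell_def vert_def)

lemma ell_vert_nonneg: "V \<in> VV \<Longrightarrow> i \<in> I \<Longrightarrow> ell i (vert V) \<ge> 0"
  using ell_vert ell_vert_pos by (metis DiffI less_eq_real_def)

lemma diff_vert: "V \<in> VV \<Longrightarrow> x - vert V = (\<Sum>i\<in>V. ell i x *\<^sub>R \<alpha> V i)"
  using expand[of V "x - vert V"] vert_dot[of V] by (simp add: inner_diff_left ell_def)

lemma dot_diff_vert: "V \<in> VV \<Longrightarrow> \<xi> \<bullet> (x - vert V) = (\<Sum>i\<in>V. ell i x * (\<xi> \<bullet> \<alpha> V i))"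
  by (simp add: diff_vert inner_sum_right)

section \<open>Edges between neighbouring vertices\<close>

lemma nbrE:
  assumes "V \<in> VV" "i \<in> V"
  obtains V' i' where "V' \<in> VV" "i' \<notin> V" "i' \<noteq> i" "V' = insert i' (V - {i})"
proof -
  obtain V' where V': "V' \<in> VV" "V' \<noteq> V" "V - {i} \<subseteq> V'" using nbr[OF assms] by blast
  have cV: "card V' = card V" using V' assms VV_card by simp
  have fin: "finite V" "finite V'" using V' assms finite_V by auto
  have "i \<notin> V'"
  proof
    assume "i \<in> V'"
    then have "V \<subseteq> V'" using V' by blast
    then show False using V' cV fin card_subset_eq by metis
  qed
  have "card V > 0" using assms fin by (auto simp: card_gt_0_iff)
  moreover have "card (V' - (V - {i})) = card V' - card (V - {i})"
    using V' fin by (intro card_Diff_subset) auto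
  ultimately have "card (V' - (V - {i})) = 1"
    using cV assms by (simp add: card_Diff_singleton)
  then obtain i' where i': "V' - (V - {i}) = {i'}" by (meson card_1_singletonE)
  then have "V' = insert i' (V - {i})" using V' by blast
  moreover have "i' \<noteq> i" using i' \<open>i \<notin> V'\<close> by blast
  moreover have "i' \<notin> V" using i' \<open>i' \<noteq> i\<close> by blast
  ultimately show ?thesis using that V' by blast
qed

lemma edge_diff:
  assumes "V \<in> VV" "V' \<in> VV" "i \<in> V" "V - {i} \<subseteq> V'"
  shows "vert V' - vert V = ell i (vert V') *\<^sub>R \<alpha> V i"
proof -
  have "vert V' - vert V = (\<Sum>j\<in>V. ell j (vert V') *\<^sub>R \<alpha> V j)"
    using diff_vert assms by blast
  also have "\<dots> = ell i (vert V') *\<^sub>R \<alpha> V i + (\<Sum>j\<in>V-{i}. ell j (vert V') *\<^sub>R \<alpha> V j)"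
    using assms finite_V by (simp add: sum.remove)
  also have "(\<Sum>j\<in>V-{i}. ell j (vert V') *\<^sub>R \<alpha> V j) = 0"
    using assms ell_vert by (intro sum.neutral) auto
  finally show ?thesis by simp
qed

text \<open>Both directions are positive multiples of the difference of the two vertices, taken in
  opposite order; the factors are positive because each end satisfies the other end's extra
  constraint strictly.\<close>

lemma edge_opposite:
  assumes "V \<in> VV" "V' \<in> VV" "i \<in> V" "i' \<notin> V" "i' \<noteq> i" "V' = insert i' (V - {i})"
  obtains s where "s > 0" "\<alpha> V' i' = - s *\<^sub>R \<alpha> V i"
proof -
  let ?a = "ell i (vert V')" and ?b = "ell i' (vert V)"
  have "?a > 0" "?b > 0" using assms VV_sub ell_vert_pos by auto
  have "vert V' - vert V = ?a *\<^sub>R \<alpha> V i" using edge_diff assms by blast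
  moreover have "vert V - vert V' = ?b *\<^sub>R \<alpha> V' i'" using edge_diff[of V' V i'] assms by blast
  ultimately have *: "?b *\<^sub>R \<alpha> V' i' = - ?a *\<^sub>R \<alpha> V i" by (metis minus_diff_eq scaleR_minus_left)
  have "\<alpha> V' i' = (1 / ?b) *\<^sub>R (?b *\<^sub>R \<alpha> V' i')" using \<open>?b > 0\<close> by simp
  also have "\<dots> = - (?a / ?b) *\<^sub>R \<alpha> V i" unfolding * by simp
  finally show ?thesis using that[of "?a / ?b"] \<open>?a > 0\<close> \<open>?b > 0\<close> by simp
qed

text \<open>The difference of the two directions pairs to zero with every normal of V except that of
  i, so its expansion at V has a single term. Consequently a vector orthogonal to the edge polarises
  the remaining directions alike at both ends.\<close>

lemma edge_common:
  assumes "V \<in> VV" "V' \<in> VV" "i \<in> V" "V - {i} \<subseteq> V'" "j \<in> V - {i}"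
  obtains s where "\<alpha> V' j = \<alpha> V j + s *\<^sub>R \<alpha> V i"
proof -
  let ?x = "\<alpha> V' j - \<alpha> V j"
  have "?x = (\<Sum>l\<in>V. (?x \<bullet> u l) *\<^sub>R \<alpha> V l)" using expand[of V ?x] assms by simp
  also have "\<dots> = (?x \<bullet> u i) *\<^sub>R \<alpha> V i + (\<Sum>l\<in>V-{i}. (?x \<bullet> u l) *\<^sub>R \<alpha> V l)"
    using assms finite_V by (simp add: sum.remove)
  also have "(\<Sum>l\<in>V-{i}. (?x \<bullet> u l) *\<^sub>R \<alpha> V l) = 0"
    using assms by (intro sum.neutral ballI) (auto simp: inner_diff_left dual subset_iff)
  finally show ?thesis using that by (metis add.commute add.right_neutral diff_add_cancel)
qed

text \<open>An edge along which \<xi> increases would lead to a neighbour with a larger value, since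
  the neighbour sits at the positive parameter \<open>ell i (vert V')\<close> of that edge. The best
  of the finitely many vertices is thus maximal in its whole tangent cone.\<close>

lemma exists_max_vert:
  obtains V where "V \<in> VV" "\<And>i. i \<in> V \<Longrightarrow> \<xi> \<bullet> \<alpha> V i \<le> 0"
proof -
  define f where "f V = \<xi> \<bullet> vert V" for V
  have "Max (f ` VV) \<in> f ` VV" using finite_VV VV_ne by (intro Max_in) auto
  then obtain V where "V \<in> VV" "Max (f ` VV) = f V" by auto
  then have V: "V \<in> VV" "\<And>W. W \<in> VV \<Longrightarrow> \<xi> \<bullet> vert W \<le> \<xi> \<bullet> vert V"
    using finite_VV by (auto simp: f_def[symmetric] dest: Max_ge[of "f ` VV", OF finite_imageI imageI])
  have "\<xi> \<bullet> \<alpha> V i \<le> 0" if "i \<in> V" for i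
  proof -
    obtain V' i' where V': "V' \<in> VV" "i' \<notin> V" "i' \<noteq> i" "V' = insert i' (V - {i})"
      using nbrE[OF V(1) \<open>i \<in> V\<close>] .
    have "V - {i} \<subseteq> V'" using V'(4) by auto
    then have "\<xi> \<bullet> (vert V' - vert V) = ell i (vert V') * (\<xi> \<bullet> \<alpha> V i)"
      by (simp only: edge_diff[OF V(1) V'(1) that] inner_scaleR_right)
    moreover have "ell i (vert V') > 0" using V' V(1) that VV_sub ell_vert_pos by auto
    ultimately show ?thesis using V(2)[OF V'(1)]
      by (metis diff_le_0_iff_le inner_diff_right mult_le_0_iff not_less)
  qed
  then show ?thesis using that V by blast
qed

text \<open>
  When \<open>\<xi>\<close> crosses the hyperplane orthogonal to some edges, the terms of the two ends of each such
  edge change by opposite amounts.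
\<close>

lemma wall_crossing:
  assumes one: "\<And>V i j. V \<in> VV \<Longrightarrow> i \<in> V \<Longrightarrow> j \<in> V \<Longrightarrow> \<eta> \<bullet> \<alpha> V i = 0 \<Longrightarrow> \<eta> \<bullet> \<alpha> V j = 0 \<Longrightarrow> i = j"
    and gen: "generic \<xi>0" "generic \<xi>1"
    and sg: "\<And>V i. V \<in> VV \<Longrightarrow> i \<in> V \<Longrightarrow> \<eta> \<bullet> \<alpha> V i \<noteq> 0 \<Longrightarrow> (\<xi>0 \<bullet> \<alpha> V i < 0 \<longleftrightarrow> \<eta> \<bullet> \<alpha> V i < 0) \<and> (\<xi>1 \<bullet> \<alpha> V i < 0 \<longleftrightarrow> \<eta> \<bullet> \<alpha> V i < 0)"
  shows "psum q w \<xi>0 x = psum q w \<xi>1 x"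
proof -
  \<comment> \<open>The edges that \<xi>0 and \<xi>1 polarise differently. They are orthogonal to
    \<eta>, so each vertex has at most one of them.\<close>
  define flip where "flip V i \<longleftrightarrow> i \<in> V \<and> (\<xi>0 \<bullet> \<alpha> V i < 0) \<noteq> (\<xi>1 \<bullet> \<alpha> V i < 0)" for V i
  define X where "X = {V\<in>VV. \<exists>i. flip V i}"
  have flip0: "\<eta> \<bullet> \<alpha> V i = 0" if "V \<in> VV" "flip V i" for V i
    using that sg[of V i] by (auto simp: flip_def)
  have flip_unique: "i = j" if "V \<in> VV" "flip V i" "flip V j" for V i j
    using that flip0 one unfolding flip_def by blast
  define T where "T V = (\<Prod>i\<in>V. pterm q w \<xi>0 V i (ell i x)) - (\<Prod>i\<in>V. pterm q w \<xi>1 V i (ell i x))" for V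
  define z where "z V = (THE i. flip V i)" for V
  have z: "flip V (z V)" if "V \<in> X" for V
    using that flip_unique theI[of "flip V"] unfolding X_def z_def by blast
  \<comment> \<open>\<open>N\<close> walks along the flipped edge to its other end. It turns out to
    be an involution of \<open>X\<close> that reverses the sign of \<open>T\<close>, so that the
    differences cancel in pairs.\<close>
  define N where "N V = (THE V'. V' \<in> VV \<and> V' \<noteq> V \<and> V - {z V} \<subseteq> V')" for V
  have Tz: "T V = (\<Prod>j\<in>V-{z V}. pterm q w \<eta> V j (ell j x)) * (if \<xi>0 \<bullet> \<alpha> V (z V) < 0 then q else -q)"
    if "V \<in> X" for V
  proof -
    have V: "V \<in> VV" "z V \<in> V" "flip V (z V)" using that z by (auto simp: X_def flip_def)
    have *: "pterm q w \<xi>0 V j s = pterm q w \<eta> V j s" "pterm q w \<xi>1 V j s = pterm q w \<eta> V j s" if "j \<in> V - {z V}" for j s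
    proof -
      have "\<eta> \<bullet> \<alpha> V j \<noteq> 0" using one[of V j "z V"] flip0[of V "z V"] V that by auto
      then show "pterm q w \<xi>0 V j s = pterm q w \<eta> V j s" "pterm q w \<xi>1 V j s = pterm q w \<eta> V j s"
        using sg[of V j] V that by (auto simp: pterm_def)
    qed
    have "T V = (\<Prod>j\<in>V-{z V}. pterm q w \<eta> V j (ell j x)) *
       (pterm q w \<xi>0 V (z V) (ell (z V) x) - pterm q w \<xi>1 V (z V) (ell (z V) x))"
      using V finite_V[OF V(1)] * by (simp add: T_def prod.remove[of V "z V"] algebra_simps)
    also have "pterm q w \<xi>0 V (z V) (ell (z V) x) - pterm q w \<xi>1 V (z V) (ell (z V) x) =
        (if \<xi>0 \<bullet> \<alpha> V (z V) < 0 then q else -q)"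
      using V(3) by (auto simp: pterm_def flip_def)
    finally show ?thesis .
  qed
  have N: "N V \<in> X \<and> N (N V) = V \<and> T (N V) = - T V" if VX: "V \<in> X" for V
  proof -
    define i where "i = z V"
    have V: "V \<in> VV" "i \<in> V" "flip V i" using that z by (auto simp: X_def flip_def i_def)
    obtain V' i' where V': "V' \<in> VV" "i' \<notin> V" "i' \<noteq> i" "V' = insert i' (V - {i})"
      using nbrE[OF V(1) \<open>i \<in> V\<close>] .
    have NV: "N V = V'" unfolding N_def i_def[symmetric]
      using V' V by (intro the1_equality nbr) auto
    obtain s where s: "s > 0" "\<alpha> V' i' = - s *\<^sub>R \<alpha> V i"
      using edge_opposite[OF V(1) V'(1) V(2) V'(2,3,4)] .
    have neg: "\<xi> \<bullet> \<alpha> V' i' < 0 \<longleftrightarrow> \<xi> \<bullet> \<alpha> V i > 0" for \<xi>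
      using s by (auto simp: zero_less_mult_iff)
    have ne: "\<xi>0 \<bullet> \<alpha> V i \<noteq> 0" "\<xi>1 \<bullet> \<alpha> V i \<noteq> 0" using gen V by (auto simp: generic_def)
    have fl': "flip V' i'" using V(3) V' ne unfolding flip_def neg by auto
    then have V'X: "V' \<in> X" using V' by (auto simp: X_def)
    have z': "z V' = i'" using z[OF V'X] fl' flip_unique V' by blast
    have NV': "N V' = V" unfolding N_def z'
      using V' V by (intro the1_equality nbr) auto
    have \<eta>0: "\<eta> \<bullet> \<alpha> V i = 0" using flip0 V by blast
    have same: "pterm q w \<eta> V' j s = pterm q w \<eta> V j s" if j: "j \<in> V - {i}" for j s
    proof -
      obtain s where "\<alpha> V' j = \<alpha> V j + s *\<^sub>R \<alpha> V i"
        using edge_common[OF V(1) V'(1) V(2) _ j] V' by blast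
      then show ?thesis using \<eta>0 by (simp add: pterm_def inner_add_right)
    qed
    have V'd: "V' - {i'} = V - {i}" using V' by auto
    \<comment> \<open>The common factors agree because \<eta> is orthogonal to the edge; the flipped
      factors q and -q are exchanged because the edge is reversed at the other end.\<close>
    have "T V' = - T V"
      unfolding Tz[OF VX] Tz[OF V'X] z' i_def[symmetric] V'd
      using same neg[of \<xi>0] ne by (simp add: not_less)
    then show ?thesis using NV NV' V'X by simp
  qed
  have "psum q w \<xi>0 x - psum q w \<xi>1 x = sum T VV"
    by (simp add: psum_def T_def sum_subtractf)
  also have "\<dots> = sum T X"
  proof (rule sum.mono_neutral_right)
    show "\<forall>V\<in>VV - X. T V = 0"
    proof
      fix V assume "V \<in> VV - X"
      then have "pterm q w \<xi>0 V i s = pterm q w \<xi>1 V i s" if "i \<in> V" for i s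
        using that by (auto simp: X_def flip_def pterm_def)
      then show "T V = 0" by (simp add: T_def)
    qed
  qed (use finite_VV X_def in auto)
  also have "sum T X = 0"
  proof -
    have "sum T X = sum (\<lambda>V. T (N V)) X"
      by (rule sum.reindex_bij_witness[of X N N]) (use N in auto)
    also have "\<dots> = - sum T X" using N by (simp add: sum_negf)
    finally show ?thesis by simp
  qed
  finally show ?thesis by simp
qed

text \<open>The determinant condition prevents any point of the line through \<xi>0 and \<xi>1 from
  being orthogonal to two edges at the same vertex. So \<open>wall_crossing\<close> applies around
  every point, \<open>psum\<close> is locally constant on the generic parameters, and connectedness
  of the line joins the parameters 0 and 1.\<close>

lemma psum_path:
  assumes gen: "generic \<xi>0" "generic \<xi>1"
    and one: "\<And>V i j. V \<in> VV \<Longrightarrow> i \<in> V \<Longrightarrow> j \<in> V \<Longrightarrow> i \<noteq> j \<Longrightarrow>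
      (\<xi>0 \<bullet> \<alpha> V i) * (\<xi>1 \<bullet> \<alpha> V j) \<noteq> (\<xi>0 \<bullet> \<alpha> V j) * (\<xi>1 \<bullet> \<alpha> V i)"
  shows "psum q w \<xi>0 x = psum q w \<xi>1 x"
proof -
  define \<xi> where "\<xi> t = \<xi>0 + t *\<^sub>R (\<xi>1 - \<xi>0)" for t
  have dot: "\<xi> t \<bullet> a = (1 - t) * (\<xi>0 \<bullet> a) + t * (\<xi>1 \<bullet> a)" for t a
    by (simp add: \<xi>_def inner_add_left inner_diff_left algebra_simps)
  have "psum q w (\<xi> 0) x = psum q w (\<xi> 1) x"
  proof (rule connected_equivalence_relation_gen[where S=UNIV and P="\<lambda>t. generic (\<xi> t)" and
        R="\<lambda>s t. psum q w (\<xi> s) x = psum q w (\<xi> t) x"])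
    show "generic (\<xi> 0)" "generic (\<xi> 1)" using gen by (auto simp: \<xi>_def)
    show "\<exists>z. z \<in> T \<and> generic (\<xi> z)" if "openin (top_of_set UNIV) T" "a \<in> T" for T and a :: real
    proof -
      have "open T" using that by simp
      then have "infinite T" using that(2) by (metis empty_iff finite_imp_not_open)
      moreover have "finite {t. \<not> generic (\<xi> t)}"
      proof (rule finite_subset)
        show "{t. \<not> generic (\<xi> t)} \<subseteq> (\<Union>V\<in>VV. \<Union>i\<in>V. {t. \<xi> t \<bullet> \<alpha> V i = 0})"
          by (auto simp: generic_def)
        have "finite {t. \<xi> t \<bullet> \<alpha> V i = 0}" if "V \<in> VV" "i \<in> V" for V i
        proof -
          have n0: "\<xi>0 \<bullet> \<alpha> V i \<noteq> 0" using gen(1) that by (auto simp: generic_def)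
          have "{t. \<xi> t \<bullet> \<alpha> V i = 0} \<subseteq> {(\<xi>0 \<bullet> \<alpha> V i) / (\<xi>0 \<bullet> \<alpha> V i - \<xi>1 \<bullet> \<alpha> V i)}"
          proof safe
            fix t assume "\<xi> t \<bullet> \<alpha> V i = 0"
            then have *: "t * (\<xi>0 \<bullet> \<alpha> V i - \<xi>1 \<bullet> \<alpha> V i) = \<xi>0 \<bullet> \<alpha> V i"
              by (simp add: dot algebra_simps)
            then have "\<xi>0 \<bullet> \<alpha> V i - \<xi>1 \<bullet> \<alpha> V i \<noteq> 0" using n0 by auto
            then show "t = (\<xi>0 \<bullet> \<alpha> V i) / (\<xi>0 \<bullet> \<alpha> V i - \<xi>1 \<bullet> \<alpha> V i)"
              using * by (simp add: eq_divide_eq)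
          qed
          then show ?thesis using finite_subset by blast
        qed
        then show "finite (\<Union>V\<in>VV. \<Union>i\<in>V. {t. \<xi> t \<bullet> \<alpha> V i = 0})"
          using finite_VV finite_V by blast
      qed
      ultimately have "\<not> T \<subseteq> {t. \<not> generic (\<xi> t)}" using finite_subset by blast
      then show ?thesis by blast
    qed
    show "\<exists>T. openin (top_of_set UNIV) T \<and> a \<in> T \<and>
           (\<forall>s\<in>T. \<forall>t\<in>T. generic (\<xi> s) \<and> generic (\<xi> t) \<longrightarrow> psum q w (\<xi> s) x = psum q w (\<xi> t) x)" for a
    proof -
      define B where "B = {(V,i). V \<in> VV \<and> i \<in> V \<and> \<xi> a \<bullet> \<alpha> V i \<noteq> 0}"
      have finB: "finite B"
      proof (rule finite_subset)
        show "B \<subseteq> Sigma VV (\<lambda>V. V)" by (auto simp: B_def)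
        show "finite (Sigma VV (\<lambda>V. V))" using finite_VV finite_V by blast
      qed
      \<comment> \<open>A neighbourhood of a in which every product that is nonzero at a keeps its
        sign; only edges orthogonal to \<open>\<xi> a\<close> can flip there.\<close>
      define T where "T = (\<Inter>(V,i)\<in>B. {t. (\<xi> t \<bullet> \<alpha> V i) * (\<xi> a \<bullet> \<alpha> V i) > 0})"
      have opT: "open T" unfolding T_def using finB
        by (intro open_INT) (auto simp: \<xi>_def intro!: open_Collect_less continuous_intros)
      have aT: "a \<in> T"
        by (auto simp: T_def B_def zero_less_mult_iff)
      have same: "psum q w (\<xi> s) x = psum q w (\<xi> t) x"
        if st: "s \<in> T" "t \<in> T" "generic (\<xi> s)" "generic (\<xi> t)" for s t
      proof (rule wall_crossing[of "\<xi> a"])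
        show "i = j" if h: "V \<in> VV" "i \<in> V" "j \<in> V" "\<xi> a \<bullet> \<alpha> V i = 0" "\<xi> a \<bullet> \<alpha> V j = 0" for V i j
        proof (rule ccontr)
          assume "i \<noteq> j"
          from h(4,5) have e: "(1 - a) * (\<xi>0 \<bullet> \<alpha> V i) + a * (\<xi>1 \<bullet> \<alpha> V i) = 0"
            "(1 - a) * (\<xi>0 \<bullet> \<alpha> V j) + a * (\<xi>1 \<bullet> \<alpha> V j) = 0" by (auto simp: dot)
          \<comment> \<open>Eliminating between the two equations shows that both 1 - a and a
            annihilate the determinant, which therefore vanishes.\<close>
          have "(1 - a) * ((\<xi>0 \<bullet> \<alpha> V i) * (\<xi>1 \<bullet> \<alpha> V j) - (\<xi>0 \<bullet> \<alpha> V j) * (\<xi>1 \<bullet> \<alpha> V i)) = 0"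
            "a * ((\<xi>0 \<bullet> \<alpha> V i) * (\<xi>1 \<bullet> \<alpha> V j) - (\<xi>0 \<bullet> \<alpha> V j) * (\<xi>1 \<bullet> \<alpha> V i)) = 0"
            using e by algebra+
          then show False using one[OF h(1-3) \<open>i \<noteq> j\<close>] by auto
        qed
        show "generic (\<xi> s)" "generic (\<xi> t)" using st by auto
        show "(\<xi> s \<bullet> \<alpha> V i < 0 \<longleftrightarrow> \<xi> a \<bullet> \<alpha> V i < 0) \<and> (\<xi> t \<bullet> \<alpha> V i < 0 \<longleftrightarrow> \<xi> a \<bullet> \<alpha> V i < 0)"
          if "V \<in> VV" "i \<in> V" "\<xi> a \<bullet> \<alpha> V i \<noteq> 0" for V i
        proof -
          have "(V, i) \<in> B" using that by (auto simp: B_def)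
          then have "(\<xi> s \<bullet> \<alpha> V i) * (\<xi> a \<bullet> \<alpha> V i) > 0" "(\<xi> t \<bullet> \<alpha> V i) * (\<xi> a \<bullet> \<alpha> V i) > 0"
            using st by (auto simp: T_def)
          then show ?thesis by (auto simp: zero_less_mult_iff)
        qed
      qed
      show ?thesis
      proof (intro exI[of _ T] conjI ballI impI)
        show "openin (top_of_set UNIV) T" using opT by simp
      qed (use aT same in blast)+
    qed
  qed auto
  then show ?thesis by (simp add: \<xi>_def)
qed

text \<open>The target is chosen in S off finitely many hyperplanes: those of \<open>D1\<close> make
  it generic, those of \<open>D2\<close> express the determinant condition of
  \<open>psum_path\<close> for the fixed starting vector.\<close>

lemma psum_move:
  assumes "generic \<xi>0" "open S" "S \<noteq> {}"
  obtains \<xi>1 where "\<xi>1 \<in> S" "generic \<xi>1" "psum q w \<xi>0 x = psum q w \<xi>1 x"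
proof -
  define D1 where "D1 = (\<Union>V\<in>VV. \<alpha> V ` V)"
  define D2 where "D2 = (\<Union>V\<in>VV. \<Union>i\<in>V. \<Union>j\<in>V-{i}. {(\<xi>0 \<bullet> \<alpha> V i) *\<^sub>R \<alpha> V j - (\<xi>0 \<bullet> \<alpha> V j) *\<^sub>R \<alpha> V i})"
  have "finite (D1 \<union> D2)" unfolding D1_def D2_def using finite_VV finite_V by blast
  moreover have "0 \<notin> D1 \<union> D2"
  proof
    assume "0 \<in> D1 \<union> D2"
    moreover have "0 \<notin> D1" using \<alpha>_ne0 by (auto simp: D1_def)
    ultimately obtain V i j where h: "V \<in> VV" "i \<in> V" "j \<in> V" "i \<noteq> j"
      "(\<xi>0 \<bullet> \<alpha> V i) *\<^sub>R \<alpha> V j - (\<xi>0 \<bullet> \<alpha> V j) *\<^sub>R \<alpha> V i = 0" by (auto simp: D2_def)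
    \<comment> \<open>Pairing with u j isolates the coefficient
      \<open>\<xi>0 \<bullet> \<alpha> V i\<close>, which is nonzero since \<xi>0 is
      generic.\<close>
    then have "((\<xi>0 \<bullet> \<alpha> V i) *\<^sub>R \<alpha> V j - (\<xi>0 \<bullet> \<alpha> V j) *\<^sub>R \<alpha> V i) \<bullet> u j = 0" by simp
    then show False using h(1-4) assms(1) by (auto simp: inner_diff_left dual generic_def)
  qed
  ultimately obtain \<xi>1 where x: "\<xi>1 \<in> S" "\<And>d. d \<in> D1 \<union> D2 \<Longrightarrow> \<xi>1 \<bullet> d \<noteq> 0"
    using open_avoid_hyperplanes assms by metis
  have "generic \<xi>1" using x(2) by (auto simp: generic_def D1_def)
  moreover have "psum q w \<xi>0 x = psum q w \<xi>1 x"
  proof (rule psum_path)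
    fix V i j assume h: "V \<in> VV" "i \<in> V" "j \<in> V" "i \<noteq> j"
    then have "\<xi>1 \<bullet> ((\<xi>0 \<bullet> \<alpha> V i) *\<^sub>R \<alpha> V j - (\<xi>0 \<bullet> \<alpha> V j) *\<^sub>R \<alpha> V i) \<noteq> 0"
      by (intro x(2)) (auto simp: D2_def)
    then show "(\<xi>0 \<bullet> \<alpha> V i) * (\<xi>1 \<bullet> \<alpha> V j) \<noteq> (\<xi>0 \<bullet> \<alpha> V j) * (\<xi>1 \<bullet> \<alpha> V i)"
      by (simp add: inner_diff_right)
  qed fact+
  ultimately show ?thesis using that x by blast
qed

text \<open>A nonzero term places x in the polarised cone of V, where each edge coordinate
  \<open>ell i x\<close> has the sign for which its contribution to \<xi> is nonpositive.\<close>

lemma pterm_prod_nonzero_imp: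
  assumes "V \<in> VV" "generic \<xi>" "(\<Prod>i\<in>V. pterm q w \<xi> V i (ell i x)) \<noteq> 0"
  shows "\<xi> \<bullet> (x - vert V) \<le> 0"
proof -
  have "ell i x * (\<xi> \<bullet> \<alpha> V i) \<le> 0" if "i \<in> V" for i
  proof -
    have "pterm q w \<xi> V i (ell i x) \<noteq> 0" using assms that finite_V by (auto simp: prod_zero_iff)
    then show ?thesis
      by (auto simp: pterm_def step_weight_def mult_le_0_iff split: if_splits)
  qed
  then show ?thesis using assms by (simp add: dot_diff_vert sum_nonpos)
qed

text \<open>
  As the sum does not depend on \<open>\<xi>\<close>, it may be evaluated for a \<open>\<xi>\<close> adapted to \<open>x\<close>: close to \<open>- u k\<close> if
  \<open>x\<close> violates the constraint \<open>k\<close>, and otherwise close to minus the sum of the normals of the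
  constraints that are tight at \<open>x\<close>. Then all terms vanish, except for that of the \<open>\<xi>\<close>-maximal vertex
  in the second case.
\<close>

theorem polarised_decomposition:
  assumes gen: "generic \<xi>"
  shows "(\<Prod>i\<in>I. step_weight q (w i) (ell i x)) = q ^ (card I - DIM('a)) * psum q w \<xi> x"
proof -
  define n where "n = DIM('a)"
  have nI: "n \<le> card I"
    using VV_ne VV_sub VV_card finite_I card_mono unfolding n_def by (metis all_not_in_conv)
  show ?thesis
  proof (cases "\<forall>i\<in>I. ell i x \<ge> 0")
    case False
    then obtain k where k: "k \<in> I" "ell k x < 0" by auto
    define S where "S = {\<xi>. \<forall>V\<in>VV. \<xi> \<bullet> (x - vert V) > 0}"
    have "S = (\<Inter>V\<in>VV. {\<xi>. \<xi> \<bullet> (x - vert V) > 0})" by (auto simp: S_def)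
    then have "open S" using finite_VV by (auto intro!: open_INT open_Collect_less continuous_intros)
    moreover have "- u k \<in> S"
    proof -
      have "0 < - u k \<bullet> (x - vert V)" if "V \<in> VV" for V
        using k ell_vert_nonneg[OF that k(1)] by (simp add: ell_def inner_diff_right inner_commute)
      then show ?thesis by (auto simp: S_def)
    qed
    ultimately obtain \<xi>1 where x1: "\<xi>1 \<in> S" "generic \<xi>1" "psum q w \<xi> x = psum q w \<xi>1 x"
      using psum_move[OF gen] by (metis empty_iff)
    have "psum q w \<xi>1 x = 0" unfolding psum_def
      using pterm_prod_nonzero_imp[OF _ x1(2)] x1(1) by (intro sum.neutral) (force simp: S_def)
    moreover have "(\<Prod>i\<in>I. step_weight q (w i) (ell i x)) = 0"
      using k finite_I by (intro prod_zero bexI[of _ k]) (auto simp: step_weight_def)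
    ultimately show ?thesis using x1 by simp
  next
    case True
    define J where "J = {i\<in>I. ell i x = 0}"
    have finJ: "finite J" "J \<subseteq> I" using finite_I by (auto simp: J_def)
    define S1 where "S1 = (\<Inter>V\<in>{V\<in>VV. \<not> J \<subseteq> V}. {\<xi>. \<xi> \<bullet> (x - vert V) > 0})"
    define S2 where "S2 = (\<Inter>V\<in>{V\<in>VV. J \<subseteq> V}. \<Inter>i\<in>J. {\<xi>. \<xi> \<bullet> \<alpha> V i < 0})"
    have "open S1" unfolding S1_def using finite_VV
      by (intro open_INT) (auto intro!: open_Collect_less continuous_intros)
    moreover have "open S2" unfolding S2_def using finite_VV finJ
      by (intro open_INT) (auto intro!: open_Collect_less continuous_intros)
    ultimately have "open (S1 \<inter> S2)" by blast
    moreover have "- (\<Sum>i\<in>J. u i) \<in> S1 \<inter> S2"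
    proof
      have "0 < - (\<Sum>i\<in>J. u i) \<bullet> (x - vert V)" if V: "V \<in> VV" "\<not> J \<subseteq> V" for V
      proof -
        have "- (\<Sum>i\<in>J. u i) \<bullet> (x - vert V) = (\<Sum>i\<in>J. ell i (vert V) - ell i x)"
          by (simp add: inner_sum_left ell_def inner_sum_right sum_subtractf inner_diff_right sum_negf inner_commute)
        also have "\<dots> = (\<Sum>i\<in>J. ell i (vert V))" by (simp add: J_def)
        also have "\<dots> > 0"
        proof -
          obtain i where "i \<in> J" "i \<notin> V" using V by auto
          then show ?thesis using finJ V ell_vert_nonneg[OF V(1)]
            by (intro sum_pos2[where i=i]) (auto simp: ell_vert_pos)
        qed
        finally show ?thesis .
      qed
      then show "- (\<Sum>i\<in>J. u i) \<in> S1" by (auto simp: S1_def)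
      have "- (\<Sum>i\<in>J. u i) \<bullet> \<alpha> V i < 0" if V: "V \<in> VV" "J \<subseteq> V" "i \<in> J" for V i
      proof -
        have "(\<Sum>j\<in>J. u j) \<bullet> \<alpha> V i = (\<Sum>j\<in>J. if i = j then 1 else 0)"
          unfolding inner_sum_left
        proof (intro sum.cong refl)
          fix j assume "j \<in> J"
          then have "i \<in> V" "j \<in> V" using V by auto
          then show "u j \<bullet> \<alpha> V i = (if i = j then 1 else 0)"
            using dual[OF V(1)] by (simp add: inner_commute)
        qed
        then show ?thesis using V finJ by simp
      qed
      then show "- (\<Sum>i\<in>J. u i) \<in> S2" by (auto simp: S2_def)
    qed
    ultimately obtain \<xi>1 where x1: "\<xi>1 \<in> S1 \<inter> S2" "generic \<xi>1" "psum q w \<xi> x = psum q w \<xi>1 x"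
      using psum_move[OF gen] by (metis empty_iff)
    obtain V0 where V0: "V0 \<in> VV" "\<And>i. i \<in> V0 \<Longrightarrow> \<xi>1 \<bullet> \<alpha> V0 i \<le> 0"
      using exists_max_vert[of \<xi>1] by blast
    have V0neg: "\<xi>1 \<bullet> \<alpha> V0 i < 0" if "i \<in> V0" for i
      using V0 x1(2) that unfolding generic_def by (metis order_le_less)
    have JV0: "J \<subseteq> V0"
    proof (rule ccontr)
      assume "\<not> J \<subseteq> V0"
      then have "\<xi>1 \<bullet> (x - vert V0) > 0" using x1(1) V0(1) by (auto simp: S1_def)
      moreover have "\<xi>1 \<bullet> (x - vert V0) \<le> 0" unfolding dot_diff_vert[OF V0(1)]
        using True V0 VV_sub by (intro sum_nonpos mult_nonneg_nonpos) auto
      ultimately show False by simp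
    qed
    \<comment> \<open>A second vertex with a nonzero term would contain J, and all its edges would
      decrease \<xi>1: those in J by the choice of \<open>S2\<close>, the others because an edge
      coordinate that is positive forces the unflipped case. Two distinct vertices cannot both be
      maximal, as V0 has an index at which V is strictly inside.\<close>
    have other: "(\<Prod>i\<in>V. pterm q w \<xi>1 V i (ell i x)) = 0" if V: "V \<in> VV" "V \<noteq> V0" for V
    proof (rule ccontr)
      assume nz: "(\<Prod>i\<in>V. pterm q w \<xi>1 V i (ell i x)) \<noteq> 0"
      have JV: "J \<subseteq> V"
        using pterm_prod_nonzero_imp[OF V(1) x1(2) nz] x1(1) V(1) by (auto simp: S1_def)
      have neg: "\<xi>1 \<bullet> \<alpha> V i < 0" if "i \<in> V" for i
      proof (cases "i \<in> J")
        case True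
        then show ?thesis using x1(1) V JV by (auto simp: S2_def)
      next
        case False
        then have "ell i x > 0" using that V VV_sub True by (force simp: J_def)
        moreover have "pterm q w \<xi>1 V i (ell i x) \<noteq> 0"
          using nz that finite_V V by (auto simp: prod_zero_iff)
        ultimately show ?thesis by (auto simp: pterm_def step_weight_def split: if_splits)
      qed
      have "\<xi>1 \<bullet> (vert V0 - vert V) \<le> 0" unfolding dot_diff_vert[OF V(1)]
        using neg V VV_sub ell_vert_nonneg[OF V0(1)] by (intro sum_nonpos mult_nonneg_nonpos) (auto intro: less_imp_le)
      moreover have "\<xi>1 \<bullet> (vert V - vert V0) < 0" unfolding dot_diff_vert[OF V0(1)]
      proof -
        have cVV: "card V0 = card V" using V V0 VV_card by simp
        have "\<not> V0 \<subseteq> V" using V V0 card_subset_eq[OF finite_V[OF V(1)] _ cVV] by auto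
        then obtain i where i: "i \<in> V0" "i \<notin> V" by auto
        have "0 < (\<Sum>i\<in>V0. - (ell i (vert V) * (\<xi>1 \<bullet> \<alpha> V0 i)))"
        proof (rule sum_pos2[of _ i])
          show "0 < - (ell i (vert V) * (\<xi>1 \<bullet> \<alpha> V0 i))"
          proof -
            have "i \<in> I - V" using i V0(1) VV_sub by blast
            then show ?thesis
              using ell_vert_pos[OF V(1), of i] V0neg[OF i(1)] by (simp add: mult_pos_neg)
          qed
          show "0 \<le> - (ell j (vert V) * (\<xi>1 \<bullet> \<alpha> V0 j))" if "j \<in> V0" for j
          proof -
            have "j \<in> I" using that V0(1) VV_sub by blast
            then show ?thesis
              using ell_vert_nonneg[OF V(1), of j] V0(2)[OF that] by (simp add: mult_nonneg_nonpos)
          qed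
        qed (use finite_V V0 i in auto)
        then show "(\<Sum>i\<in>V0. ell i (vert V) * (\<xi>1 \<bullet> \<alpha> V0 i)) < 0" by (simp add: sum_negf)
      qed
      ultimately show False by (simp add: inner_diff_right)
    qed
    have "psum q w \<xi>1 x = (\<Sum>V\<in>{V0}. \<Prod>i\<in>V. pterm q w \<xi>1 V i (ell i x))"
      unfolding psum_def using V0 finite_VV other by (intro sum.mono_neutral_right) auto
    also have "\<dots> = (\<Prod>i\<in>V0. step_weight q (w i) (ell i x))"
      using V0neg by (simp add: pterm_def)
    finally have ps: "psum q w \<xi>1 x = (\<Prod>i\<in>V0. step_weight q (w i) (ell i x))" .
    have "(\<Prod>i\<in>I. step_weight q (w i) (ell i x)) =
        (\<Prod>i\<in>I - V0. step_weight q (w i) (ell i x)) * (\<Prod>i\<in>V0. step_weight q (w i) (ell i x))"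
      using finite_I VV_sub V0 by (simp add: prod.subset_diff)
    \<comment> \<open>All tight indices lie in V0, so each facet outside V0 is passed strictly and
      contributes q. These factors form the power of q in the statement.\<close>
    also have "(\<Prod>i\<in>I - V0. step_weight q (w i) (ell i x)) = (\<Prod>i\<in>I - V0. q)"
    proof (rule prod.cong)
      fix i assume "i \<in> I - V0"
      then have "ell i x > 0" using True JV0 by (force simp: J_def)
      then show "step_weight q (w i) (ell i x) = q" by (simp add: step_weight_def)
    qed simp
    also have "\<dots> = q ^ (card I - DIM('a))"
      using V0 VV_card VV_sub finite_V by (simp add: card_Diff_subset)
    finally show ?thesis using ps x1 by simp
  qed
qed

end


section \<open>Characters of the group of a cone\<close>

lemma power_int_sum:
  fixes x :: "'a::field"
  assumes "x \<noteq> 0"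
  shows "x powi (\<Sum>j\<in>A. f j) = (\<Prod>j\<in>A. x powi f j)"
  using assms by (induction A rule: infinite_finite_induct) (auto simp: power_int_add)

lemma power_int_prod:
  fixes f :: "'b \<Rightarrow> 'a::field"
  shows "(\<Prod>j\<in>A. f j) powi k = (\<Prod>j\<in>A. f j powi k)"
  by (induction A rule: infinite_finite_induct) (auto simp: power_int_mult_distrib)

definition ipair :: "int ^ 'n \<Rightarrow> int ^ 'n \<Rightarrow> int" where
  "ipair m v = (\<Sum>j\<in>UNIV. m $ j * v $ j)"

lemma lat_dot: "lat m \<bullet> lat v = of_int (ipair m v)"
  by (simp add: lat_def ipair_def inner_vec_def)

lemma lat_add: "lat (m + m') = lat m + lat m'"
  by (simp add: lat_def vec_eq_iff)

lemma lat_diff: "lat (m - m') = lat m - lat m'"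
  by (simp add: lat_def vec_eq_iff)

lemma lat_inject [simp]: "lat m = lat m' \<longleftrightarrow> m = m'"
  by (simp add: lat_def vec_eq_iff)

lemma range_lat_iff: "x \<in> range lat \<longleftrightarrow> (\<forall>j. x $ j \<in> \<int>)"
proof
  assume "\<forall>j. x $ j \<in> \<int>"
  then have "x = lat (\<chi> j. \<lfloor>x $ j\<rfloor>)" by (simp add: lat_def vec_eq_iff)
  then show "x \<in> range lat" by blast
qed (auto simp: lat_def)

text \<open>The data of a single vertex. Sending m to its pairings with the U i embeds M into the
  group of integer vectors indexed by V, with finite index; \<open>chars\<close> below is the
  character group of the quotient, and its order takes the place of the determinant of U.\<close>

locale lattice_basis =
  fixes V :: "nat set" and U :: "nat \<Rightarrow> int ^ 'n" and al :: "nat \<Rightarrow> real ^ 'n" and e :: "nat \<Rightarrow> complex"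
  assumes finV: "finite V"
    and dual: "i \<in> V \<Longrightarrow> j \<in> V \<Longrightarrow> al i \<bullet> lat (U j) = (if i = j then 1 else 0)"
    and expand: "(\<Sum>i\<in>V. (x \<bullet> lat (U i)) *\<^sub>R al i) = x"
begin

text \<open>The values outside \<open>V\<close> are prescribed by \<open>e\<close>, so that the elements are determined by
  their restrictions to \<open>V\<close>.\<close>

definition chars :: "(nat \<Rightarrow> complex) set" where
  "chars = {g. (\<forall>i\<in>V. g i \<noteq> 0) \<and> (\<forall>i. i \<notin> V \<longrightarrow> g i = e i) \<and> (\<forall>j. (\<Prod>i\<in>V. g i powi (U i $ j)) = 1)}"

definition eval_char :: "(nat \<Rightarrow> complex) \<Rightarrow> (nat \<Rightarrow> int) \<Rightarrow> complex" where
  "eval_char g k = (\<Prod>i\<in>V. g i powi k i)"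

definition in_lattice :: "(nat \<Rightarrow> int) \<Rightarrow> bool" where
  "in_lattice k \<longleftrightarrow> (\<exists>m. \<forall>i\<in>V. k i = ipair m (U i))"

lemma eval_char_lattice:
  assumes "g \<in> chars" "in_lattice k"
  shows "eval_char g k = 1"
proof -
  obtain m where m: "\<And>i. i \<in> V \<Longrightarrow> k i = ipair m (U i)" using assms by (auto simp: in_lattice_def)
  have "eval_char g k = (\<Prod>i\<in>V. \<Prod>j\<in>UNIV. (g i powi (U i $ j)) powi (m $ j))"
    unfolding eval_char_def
    using assms(1) by (intro prod.cong refl)
      (simp add: m ipair_def power_int_sum chars_def power_int_mult[symmetric] mult.commute)
  also have "\<dots> = (\<Prod>j\<in>UNIV. (\<Prod>i\<in>V. g i powi (U i $ j)) powi (m $ j))"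
    unfolding power_int_prod by (rule prod.swap)
  also have "\<dots> = 1" using assms(1) by (simp add: chars_def)
  finally show ?thesis .
qed

text \<open>The coordinates of \<open>al\<close> form the inverse of the matrix of \<open>U\<close>:
  compare coordinate j0 in the expansion of the j-th axis vector.\<close>

lemma axis_expand: "(\<Sum>i\<in>V. al i $ j0 * of_int (U i $ j)) = (if j0 = j then 1 else 0)"
proof -
  have "(\<Sum>i\<in>V. (axis j 1 \<bullet> lat (U i)) *\<^sub>R al i) $ j0 = (axis j 1 :: real^'n) $ j0"
    by (simp only: expand)
  moreover have "(axis j 1 :: real^'n) \<bullet> lat (U i) = of_int (U i $ j)" for i
    by (simp add: inner_axis' lat_def)
  ultimately show ?thesis
    by (simp add: axis_def mult.commute)
qed

lemma exp_char_powi: "exp (2 * of_real pi * \<i> * of_real x) powi k = exp (2 * of_real pi * \<i> * of_real (x * of_int k))"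
proof -
  have "exp (2 * of_real pi * \<i> * of_real x) powi k = exp (of_int k * (2 * of_real pi * \<i> * of_real x))"
    by (simp add: exp_power_int)
  then show ?thesis by (simp add: algebra_simps)
qed

lemma exp_2pi_eq_1_iff: "exp (2 * of_real pi * \<i> * of_real x) = 1 \<longleftrightarrow> x \<in> \<int>"
proof -
  have "exp (2 * of_real pi * \<i> * of_real x) = 1 \<longleftrightarrow> (\<exists>n::int. 2 * pi * x = of_int (2 * n) * pi)"
    by (subst exp_eq_1) simp
  also have "\<dots> \<longleftrightarrow> (\<exists>n::int. x = of_int n)" by simp
  finally show ?thesis by (auto elim: Ints_cases)
qed

text \<open>A vector k outside the lattice corresponds to a point x with some non-integral
  coordinate j0. The exponentials of the j0-th coordinates of the \<open>al i\<close> define a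
  character by \<open>axis_expand\<close>, and its value at k is exp(2 \<pi> i x_j0), which differs
  from 1.\<close>

lemma nontrivial_char:
  assumes "\<not> in_lattice k"
  obtains g where "g \<in> chars" "eval_char g k \<noteq> 1"
proof -
  define x where "x = (\<Sum>i\<in>V. of_int (k i) *\<^sub>R al i)"
  have xU: "x \<bullet> lat (U i) = of_int (k i)" if "i \<in> V" for i
    using that finV by (simp add: x_def inner_sum_left dual if_distrib[of "\<lambda>x. _ * x"] cong: if_cong)
  have "x \<notin> range lat"
  proof
    assume "x \<in> range lat"
    then obtain m where "x = lat m" by auto
    then have "k i = ipair m (U i)" if "i \<in> V" for i using xU[OF that] by (simp add: lat_dot)
    then show False using assms by (auto simp: in_lattice_def)
  qed
  then obtain j0 where j0: "x $ j0 \<notin> \<int>" by (auto simp: range_lat_iff)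
  define g where "g i = (if i \<in> V then exp (2 * of_real pi * \<i> * of_real (al i $ j0)) else e i)" for i
  have val: "eval_char g k' = exp (2 * of_real pi * \<i> * of_real (\<Sum>i\<in>V. al i $ j0 * of_int (k' i)))" for k'
    unfolding eval_char_def using finV
    by (simp add: g_def exp_char_powi exp_sum[symmetric] sum_distrib_left)
  have "(\<Prod>i\<in>V. g i powi (U i $ j)) = 1" for j
    using val[of "\<lambda>i. U i $ j"] unfolding axis_expand eval_char_def
    by (auto simp: exp_2pi_eq_1_iff[of 1, simplified])
  then have "g \<in> chars" by (auto simp: chars_def g_def)
  moreover have "eval_char g k \<noteq> 1"
    using j0 unfolding val exp_2pi_eq_1_iff by (simp add: x_def mult.commute)
  ultimately show ?thesis using that by blast
qed

lemma lat_pairing_inj: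
  assumes "\<And>i. i \<in> V \<Longrightarrow> x \<bullet> lat (U i) = y \<bullet> lat (U i)"
  shows "x = y"
  using expand[of x] expand[of y] assms by (metis (no_types, lifting) sum.cong)

lemma inj_pairing: "inj (\<lambda>m. \<lambda>i\<in>V. ipair m (U i))"
proof (rule injI)
  fix m m' assume h: "(\<lambda>i\<in>V. ipair m (U i)) = (\<lambda>i\<in>V. ipair m' (U i))"
  have "lat m = lat m'"
  proof (rule lat_pairing_inj)
    fix i assume "i \<in> V"
    then show "lat m \<bullet> lat (U i) = lat m' \<bullet> lat (U i)"
      using fun_cong[OF h, of i] by (simp add: lat_dot)
  qed
  then show "m = m'" by simp
qed

lemma bij_betw_pairing:
  assumes "B \<subseteq> extensional V"
  shows "bij_betw (\<lambda>m. \<lambda>i\<in>V. ipair m (U i)) {m. (\<lambda>i\<in>V. ipair m (U i)) \<in> B} {k\<in>B. in_lattice k}"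
  unfolding bij_betw_def
proof (intro conjI set_eqI iffI)
  show "inj_on (\<lambda>m. \<lambda>i\<in>V. ipair m (U i)) {m. (\<lambda>i\<in>V. ipair m (U i)) \<in> B}"
    using inj_pairing by (rule inj_on_subset) simp
next
  fix k assume "k \<in> {k\<in>B. in_lattice k}"
  then obtain m where m: "\<And>i. i \<in> V \<Longrightarrow> k i = ipair m (U i)" and k: "k \<in> B" by (auto simp: in_lattice_def)
  have "k = (\<lambda>i\<in>V. ipair m (U i))" using k m assms by (auto simp: fun_eq_iff extensional_def)
  then show "k \<in> (\<lambda>m. \<lambda>i\<in>V. ipair m (U i)) ` {m. (\<lambda>i\<in>V. ipair m (U i)) \<in> B}" using k by blast
qed (auto simp: in_lattice_def)

definition pairing_bound :: "nat \<Rightarrow> int" where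
  "pairing_bound i = (\<Sum>j\<in>UNIV. \<bar>U i $ j\<bar>)"

lemma cube_bound:
  fixes x :: "real ^ 'n"
  assumes "\<And>j. 0 \<le> x $ j" "\<And>j. x $ j < 1"
  shows "\<bar>x \<bullet> lat (U i)\<bar> \<le> of_int (pairing_bound i)"
proof -
  have "\<bar>x \<bullet> lat (U i)\<bar> \<le> (\<Sum>j\<in>UNIV. \<bar>x $ j * of_int (U i $ j)\<bar>)"
    by (simp add: inner_vec_def lat_def)
  also have "\<dots> \<le> (\<Sum>j\<in>UNIV. of_int \<bar>U i $ j\<bar>)"
  proof (intro sum_mono)
    fix j
    have "\<bar>x $ j\<bar> * \<bar>of_int (U i $ j)\<bar> \<le> 1 * \<bar>of_int (U i $ j) :: real\<bar>"
      using assms[of j] by (intro mult_right_mono) auto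
    then show "\<bar>x $ j * of_int (U i $ j)\<bar> \<le> of_int \<bar>U i $ j\<bar>" by (simp add: abs_mult)
  qed
  finally show ?thesis by (simp add: pairing_bound_def)
qed

text \<open>
  Pigeonhole principle: the multiples of \<open>al i\<close> fall into finitely many classes modulo the lattice,
  because their pairings with all \<open>U l\<close> are integers.
\<close>

lemma multiple_in_lattice:
  assumes "i \<in> V"
  obtains D :: nat where "D > 0" "real D *\<^sub>R al i \<in> range lat"
proof -
  \<comment> \<open>Representatives in the unit cube. A point is determined by its pairings with the
    U l, which here are integers and bounded on the cube, so there are finitely many.\<close>
  define S where "S = {x :: real^'n. (\<forall>j. 0 \<le> x $ j \<and> x $ j < 1) \<and> (\<forall>l\<in>V. x \<bullet> lat (U l) \<in> \<int>)}"
  have "finite S"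
  proof (rule inj_on_finite)
    let ?f = "\<lambda>x. \<lambda>l\<in>V. \<lfloor>x \<bullet> lat (U l)\<rfloor>"
    show "inj_on ?f S"
    proof (rule inj_onI)
      fix x y assume h: "x \<in> S" "y \<in> S" "?f x = ?f y"
      show "x = y"
      proof (rule lat_pairing_inj)
        fix l assume l: "l \<in> V"
        then have "\<lfloor>x \<bullet> lat (U l)\<rfloor> = \<lfloor>y \<bullet> lat (U l)\<rfloor>" using h(3) by (metis restrict_apply)
        then show "x \<bullet> lat (U l) = y \<bullet> lat (U l)"
          using h l by (metis (mono_tags, lifting) S_def mem_Collect_eq of_int_floor)
      qed
    qed
    show "?f ` S \<subseteq> PiE V (\<lambda>l. {- pairing_bound l .. pairing_bound l})"
    proof (clarsimp simp: PiE_iff, intro conjI)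
      fix x l assume "x \<in> S" "l \<in> V"
      then have b: "\<bar>x \<bullet> lat (U l)\<bar> \<le> of_int (pairing_bound l)" by (intro cube_bound) (auto simp: S_def)
      then show "- pairing_bound l \<le> \<lfloor>x \<bullet> lat (U l)\<rfloor>" by (simp add: le_floor_iff)
      show "\<lfloor>x \<bullet> lat (U l)\<rfloor> \<le> pairing_bound l" using b by linarith
    qed
    show "finite (PiE V (\<lambda>l. {- pairing_bound l .. pairing_bound l}))" using finV by (intro finite_PiE) auto
  qed
  define fr where "fr x = x - lat (\<chi> j. \<lfloor>x $ j\<rfloor>)" for x :: "real^'n"
  define f where "f n = fr (real n *\<^sub>R al i)" for n
  have "range f \<subseteq> S"
  proof clarify
    fix n
    have "0 \<le> f n $ j \<and> f n $ j < 1" for j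
      unfolding f_def fr_def lat_def by (simp, linarith)
    moreover have "f n \<bullet> lat (U l) \<in> \<int>" if "l \<in> V" for l
      using assms that by (auto simp: f_def fr_def inner_diff_left lat_dot dual)
    ultimately show "f n \<in> S" by (auto simp: S_def)
  qed
  then have "\<not> inj f" using \<open>finite S\<close> finite_imageD[of f UNIV] finite_subset by auto
  then obtain n n' where "n < n'" "f n = f n'" by (metis injI linorder_neqE_nat)
  then have "real (n' - n) *\<^sub>R al i = lat ((\<chi> j. \<lfloor>(real n' *\<^sub>R al i) $ j\<rfloor>) - (\<chi> j. \<lfloor>(real n *\<^sub>R al i) $ j\<rfloor>))"
    unfolding f_def fr_def lat_diff by (simp add: of_nat_diff scaleR_diff_left algebra_simps)
  then show ?thesis using that[of "n' - n"] \<open>n < n'\<close> by auto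
qed

lemma common_multiple:
  obtains D :: nat where "D > 0" "\<And>i. i \<in> V \<Longrightarrow> real D *\<^sub>R al i \<in> range lat"
proof -
  have "\<forall>i\<in>V. \<exists>D::nat. D > 0 \<and> real D *\<^sub>R al i \<in> range lat"
    using multiple_in_lattice by metis
  then obtain d where d: "\<And>i. i \<in> V \<Longrightarrow> d i > (0::nat)" "\<And>i. i \<in> V \<Longrightarrow> real (d i) *\<^sub>R al i \<in> range lat"
    by metis
  have "real (\<Prod>j\<in>V. d j) *\<^sub>R al i \<in> range lat" if "i \<in> V" for i
  proof -
    have "real (\<Prod>j\<in>V. d j) *\<^sub>R al i = real (\<Prod>j\<in>V-{i}. d j) *\<^sub>R (real (d i) *\<^sub>R al i)"
      using finV that by (simp add: prod.remove)
    then show ?thesis using d(2)[OF that] unfolding range_lat_iff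
      by (auto intro!: Ints_mult Ints_of_nat simp del: of_nat_prod scaleR_scaleR)
  qed
  then show ?thesis using that[of "\<Prod>j\<in>V. d j"] d(1) finV by (simp add: prod_pos)
qed

text \<open>D times the i-th unit vector is the image of a lattice point, hence every character is
  trivial on it.\<close>

lemma char_root_of_unity:
  assumes "real D *\<^sub>R al i \<in> range lat" "i \<in> V" "g \<in> chars"
  shows "g i ^ D = 1"
proof -
  obtain m where m: "real D *\<^sub>R al i = lat m" using assms by auto
  have "in_lattice (\<lambda>l. if l = i then int D else 0)"
    unfolding in_lattice_def
  proof (intro exI[of _ m] ballI)
    fix l assume "l \<in> V"
    then have "real_of_int (ipair m (U l)) = (if l = i then D else 0)"
      using assms by (simp add: lat_dot[symmetric] m[symmetric] dual)
    then show "(if l = i then int D else 0) = ipair m (U l)" by (auto split: if_splits)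
  qed
  then have "eval_char g (\<lambda>l. if l = i then int D else 0) = 1" using eval_char_lattice assms by blast
  moreover have "eval_char g (\<lambda>l. if l = i then int D else 0) = (\<Prod>l\<in>V. if l = i then g i ^ D else 1)"
    unfolding eval_char_def by (intro prod.cong) auto
  ultimately show ?thesis using finV assms by simp
qed

lemma finite_chars: "finite chars"
proof -
  obtain D where D: "D > 0" "\<And>i. i \<in> V \<Longrightarrow> real D *\<^sub>R al i \<in> range lat" using common_multiple by blast
  show ?thesis
  proof (rule inj_on_finite)
    show "inj_on (\<lambda>g. restrict g V) chars"
    proof (rule inj_onI)
      fix g g' assume h: "g \<in> chars" "g' \<in> chars" "restrict g V = restrict g' V"
      show "g = g'"
      proof
        fix i
        show "g i = g' i" using h by (cases "i \<in> V") (auto simp: chars_def dest: fun_cong[of _ _ i])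
      qed
    qed
    show "(\<lambda>g. restrict g V) ` chars \<subseteq> PiE V (\<lambda>_. {z. z ^ D = 1})"
      using char_root_of_unity D by auto
    show "finite (PiE V (\<lambda>_. {z::complex. z ^ D = 1}))"
      using finV D by (intro finite_PiE) (auto intro!: finite_roots_unity)
  qed
qed

definition unit_char :: "nat \<Rightarrow> complex" where
  "unit_char i = (if i \<in> V then 1 else e i)"

lemma unit_char_in: "unit_char \<in> chars"
  by (simp add: chars_def unit_char_def)

lemma card_chars_pos: "card chars > 0"
  using finite_chars unit_char_in card_gt_0_iff by blast

text \<open>Orthogonality of characters: multiplication by a character h permutes
  \<open>chars\<close> and multiplies the sum by its value at k, which can be chosen different from
  1 unless k is in the lattice. The maps \<open>tr\<close> and \<open>tl\<close> leave the
  prescribed values \<open>e\<close> outside V alone.\<close>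

lemma char_sum:
  "(\<Sum>g\<in>chars. eval_char g k) = (if in_lattice k then of_nat (card chars) else 0)"
proof (cases "in_lattice k")
  case True
  then show ?thesis using eval_char_lattice by simp
next
  case False
  then obtain h where h: "h \<in> chars" "eval_char h k \<noteq> 1" using nontrivial_char by blast
  define tr where "tr g i = (if i \<in> V then h i * g i else e i)" for g i
  define tl where "tl g i = (if i \<in> V then g i / h i else e i)" for g i
  have hV: "h i \<noteq> 0" if "i \<in> V" for i using h that by (auto simp: chars_def)
  have tr: "tr g \<in> chars" and tl: "tl g \<in> chars" if "g \<in> chars" for g
    using that h by (auto simp: chars_def tr_def tl_def power_int_mult_distrib power_int_divide_distrib prod.distrib prod_dividef)
  have "(\<Sum>g\<in>chars. eval_char g k) = (\<Sum>g\<in>chars. eval_char (tr g) k)"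
  proof (rule sum.reindex_bij_witness[of chars tr tl])
    show "tr (tl g) = g" "tl (tr g) = g" if "g \<in> chars" for g
      using that hV by (auto simp: chars_def tr_def tl_def fun_eq_iff)
    then show "eval_char (tr (tl g)) k = eval_char g k" if "g \<in> chars" for g using that by simp
  qed (use tr tl in auto)
  also have "\<dots> = (\<Sum>g\<in>chars. eval_char h k * eval_char g k)"
    by (simp add: eval_char_def tr_def power_int_mult_distrib prod.distrib)
  also have "\<dots> = eval_char h k * (\<Sum>g\<in>chars. eval_char g k)" by (simp add: sum_distrib_left)
  finally show ?thesis using h False by auto
qed

end

section \<open>Lattice points in boxes and volumes of parallelepipeds\<close>

lemma sum_powi_root_of_unity:
  fixes z :: complex
  assumes "z ^ D = 1" "D > 0"
  shows "(\<Sum>k\<in>{a..<a + int D}. z powi k) = (if z = 1 then of_nat D else 0)"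
proof -
  have "z \<noteq> 0" using assms by (auto simp: power_0_left)
  have "(\<Sum>k\<in>{a..<a + int D}. z powi k) = (\<Sum>j<D. z powi (a + int j))"
    by (rule sum.reindex_bij_witness[of _ "\<lambda>j. a + int j" "\<lambda>k. nat (k - a)"]) auto
  also have "\<dots> = z powi a * (\<Sum>j<D. z ^ j)"
    using \<open>z \<noteq> 0\<close> by (simp add: power_int_add sum_distrib_left)
  finally show ?thesis using assms by (auto simp: geometric_sum)
qed

text \<open>Cauchy's functional equation: nonnegativity makes f monotone, and comparing f (k t) with
  the values at the neighbouring integers bounds k times the deviation from linearity by f 1, for
  every k.\<close>

lemma additive_nonneg_linear:
  fixes f :: "real \<Rightarrow> real"
  assumes add: "\<And>r s. r \<ge> 0 \<Longrightarrow> s \<ge> 0 \<Longrightarrow> f (r + s) = f r + f s"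
    and nonneg: "\<And>r. r \<ge> 0 \<Longrightarrow> f r \<ge> 0" and "t \<ge> 0"
  shows "f t = t * f 1"
proof -
  have mult: "f (real n * s) = real n * f s" if "s \<ge> 0" for n s
  proof (induction n)
    case 0
    then show ?case using add[of 0 0] by simp
  next
    case (Suc n)
    then show ?case using add[of "real n * s" s] that by (simp add: algebra_simps)
  qed
  have mono: "f r \<le> f s" if "0 \<le> r" "r \<le> s" for r s
    using add[of r "s - r"] nonneg[of "s - r"] that by simp
  have "real k * \<bar>f t - t * f 1\<bar> \<le> f 1" for k
  proof -
    define n where "n = nat \<lfloor>real k * t\<rfloor>"
    have n: "real n \<le> real k * t" "real k * t \<le> real n + 1"
    proof -
      have "0 \<le> \<lfloor>real k * t\<rfloor>" using \<open>t \<ge> 0\<close> by simp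
      then have "real n = of_int \<lfloor>real k * t\<rfloor>" by (simp add: n_def)
      then show "real n \<le> real k * t" "real k * t \<le> real n + 1" by linarith+
    qed
    have "real n * f 1 \<le> f (real k * t)"
      using mult[of 1 n] mono[OF _ n(1)] by simp
    moreover have "f (real k * t) \<le> (real n + 1) * f 1"
      using mult[of 1 "Suc n"] mono[OF _ n(2)] \<open>t \<ge> 0\<close> by (simp add: add.commute)
    moreover have "f (real k * t) = real k * f t" using mult \<open>t \<ge> 0\<close> by simp
    moreover have "real n * f 1 \<le> real k * t * f 1" "real k * t * f 1 \<le> (real n + 1) * f 1"
      using n nonneg[of 1] by (auto intro!: mult_right_mono)
    ultimately have "\<bar>real k * f t - real k * t * f 1\<bar> \<le> f 1"
      by (auto simp: algebra_simps abs_le_iff)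
    moreover have "real k * f t - real k * t * f 1 = real k * (f t - t * f 1)" by (simp add: algebra_simps)
    ultimately show ?thesis by (simp add: abs_mult)
  qed
  then have "\<bar>f t - t * f 1\<bar> \<le> 0"
    by (metis abs_ge_zero abs_le_zero_iff ex_less_of_nat_mult not_less order_le_less)
  then show ?thesis by simp
qed

context lattice_basis
begin

text \<open>Sum all characters over a box of side D. A nontrivial one has a component that is a D-th
  root of unity other than 1, so its sum vanishes; the trivial one contributes the number of points
  of the box. By \<open>char_sum\<close> the total also equals the number of lattice points times
  the number of characters.\<close>

lemma lattice_count:
  assumes D: "D > 0" "\<And>i. i \<in> V \<Longrightarrow> real D *\<^sub>R al i \<in> range lat"
  shows "card {m. \<forall>i\<in>V. a i \<le> ipair m (U i) \<and> ipair m (U i) < a i + int D} * card chars = D ^ card V"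
proof -
  define B where "B = PiE V (\<lambda>i. {a i..<a i + int D})"
  define M where "M = {m. \<forall>i\<in>V. a i \<le> ipair m (U i) \<and> ipair m (U i) < a i + int D}"
  have finB: "finite B" using finV by (simp add: B_def finite_PiE)
  have "M = {m. (\<lambda>i\<in>V. ipair m (U i)) \<in> B}" by (auto simp: M_def B_def)
  moreover have "B \<subseteq> extensional V" by (auto simp: B_def PiE_iff)
  ultimately have "bij_betw (\<lambda>m. \<lambda>i\<in>V. ipair m (U i)) M {k\<in>B. in_lattice k}"
    using bij_betw_pairing[of B] by (simp only:)
  then have card_eq: "card M = card {k\<in>B. in_lattice k}" by (rule bij_betw_same_card)
  have "(\<Sum>k\<in>B. \<Sum>g\<in>chars. eval_char g k) = of_nat (card {k\<in>B. in_lattice k} * card chars)"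
    using finB by (simp add: char_sum sum.inter_filter[symmetric])
  moreover have "(\<Sum>k\<in>B. \<Sum>g\<in>chars. eval_char g k) = (\<Sum>g\<in>chars. if g = unit_char then of_nat (D ^ card V) else 0)"
  proof (subst sum.swap, rule sum.cong[OF refl])
    fix g assume g: "g \<in> chars"
    have "(\<Sum>k\<in>B. eval_char g k) = (\<Prod>i\<in>V. \<Sum>k\<in>{a i..<a i + int D}. g i powi k)"
      unfolding eval_char_def B_def using finV by (subst prod_sum_PiE) auto
    also have "\<dots> = (\<Prod>i\<in>V. if g i = 1 then of_nat D else 0)"
      using g D char_root_of_unity by (intro prod.cong refl sum_powi_root_of_unity) auto
    also have "\<dots> = (if \<forall>i\<in>V. g i = 1 then of_nat (D ^ card V) else 0)"
      using finV by (auto intro!: prod_zero)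
    also have "(\<forall>i\<in>V. g i = 1) \<longleftrightarrow> g = unit_char"
      using g by (auto simp: unit_char_def chars_def fun_eq_iff)
    finally show "(\<Sum>k\<in>B. eval_char g k) = (if g = unit_char then of_nat (D ^ card V) else 0)" .
  qed
  ultimately have "of_nat (card {k\<in>B. in_lattice k} * card chars) = (of_nat (D ^ card V) :: complex)"
    using finite_chars unit_char_in by simp
  then show ?thesis unfolding M_def[symmetric] card_eq by (simp only: of_nat_eq_iff)
qed

text \<open>Half-open, so that slabs placed side by side are disjoint and a side of integral length
  D always meets exactly D integers after translation.\<close>

definition slab :: "(nat \<Rightarrow> real) \<Rightarrow> (nat \<Rightarrow> real) \<Rightarrow> (real ^ 'n) set" where
  "slab a t = {x. \<forall>i\<in>V. a i \<le> x \<bullet> lat (U i) \<and> x \<bullet> lat (U i) < a i + t i}"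

lemma slab_sets [measurable]: "slab a t \<in> sets borel"
  unfolding slab_def using finV by measurable

lemma al_comb_dot: "i \<in> V \<Longrightarrow> (\<Sum>j\<in>V. a j *\<^sub>R al j) \<bullet> lat (U i) = a i"
  using finV by (simp add: inner_sum_left dual if_distrib[of "\<lambda>x. _ * x"] cong: if_cong)

lemma emeasure_slab_translate: "emeasure lborel (slab a t) = emeasure lborel (slab (\<lambda>_. 0) t)"
proof -
  define v where "v = (\<Sum>j\<in>V. a j *\<^sub>R al j)"
  have "emeasure lborel (slab a t) = emeasure (distr lborel borel ((+) v)) (slab a t)"
    by (simp add: lborel_distr_plus)
  also have "\<dots> = emeasure lborel ((+) v -` slab a t)"
    by (subst emeasure_distr) (auto simp: slab_sets)
  also have "(+) v -` slab a t = slab (\<lambda>_. 0) t"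
    unfolding slab_def v_def by (auto simp: inner_add_left al_comb_dot)
  finally show ?thesis .
qed

definition cube :: "(real ^ 'n) set" where
  "cube = {x. \<forall>j. 0 \<le> x $ j \<and> x $ j < 1}"

lemma cube_sets [measurable]: "cube \<in> sets borel"
  unfolding cube_def by measurable

lemma emeasure_cube: "emeasure lborel cube = 1"
proof (rule antisym)
  have One: "(One :: real^'n) $ j = 1" for j
  proof -
    have "(\<Sum>b\<in>Basis. (1::real) *\<^sub>R (b::real^'n)) \<bullet> axis j 1 = 1"
      by (rule inner_sum_left_Basis) simp
    then show ?thesis by (simp add: inner_axis)
  qed
  have "cube \<subseteq> cbox 0 One"
    by (auto simp: cube_def mem_box_cart less_imp_le One simp del: sum_component)
  then have "emeasure lborel cube \<le> emeasure lborel (cbox 0 One :: (real^'n) set)"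
    by (intro emeasure_mono) auto
  then show "emeasure lborel cube \<le> 1" by simp
  have "box 0 One \<subseteq> cube"
    by (auto simp: cube_def mem_box_cart less_imp_le One simp del: sum_component)
  then have "emeasure lborel (box 0 One :: (real^'n) set) \<le> emeasure lborel cube"
    by (intro emeasure_mono) (auto simp: cube_sets)
  then show "1 \<le> emeasure lborel cube" by simp
qed

text \<open>
  By \<open>lattice_count\<close>, each translate of the slab contains the same number of lattice points;
  integrate this number over the unit cube.
\<close>

lemma emeasure_slab_multiple:
  assumes D: "D > 0" "\<And>i. i \<in> V \<Longrightarrow> real D *\<^sub>R al i \<in> range lat"
  shows "emeasure lborel (slab (\<lambda>_. 0) (\<lambda>_. real D)) = ennreal (real (D ^ card V) / real (card chars))"
proof -
  define A where "A = slab (\<lambda>_. 0) (\<lambda>_. real D)"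
  have [measurable]: "A \<in> sets borel" by (simp add: A_def)
  \<comment> \<open>The lattice translations that bring some point of the unit cube into A.
    Finiteness of this set allows sums and integrals to be exchanged freely.\<close>
  define M0 where "M0 = {m. \<exists>x\<in>cube. x + lat m \<in> A}"
  have finM0: "finite M0"
  proof (rule inj_on_finite)
    let ?f = "\<lambda>m. \<lambda>i\<in>V. ipair m (U i)"
    show "inj_on ?f M0" using inj_pairing by (rule inj_on_subset) simp
    show "?f ` M0 \<subseteq> PiE V (\<lambda>i. {- pairing_bound i .. int D + pairing_bound i})"
    proof (clarsimp simp: PiE_iff)
      fix m i assume "m \<in> M0" "i \<in> V"
      then obtain x where x: "x \<in> cube" "x + lat m \<in> A" by (auto simp: M0_def)
      have "\<bar>x \<bullet> lat (U i)\<bar> \<le> of_int (pairing_bound i)" using x(1) by (intro cube_bound) (auto simp: cube_def)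
      moreover have "0 \<le> x \<bullet> lat (U i) + of_int (ipair m (U i))" "x \<bullet> lat (U i) + of_int (ipair m (U i)) < real D"
        using x(2) \<open>i \<in> V\<close> by (auto simp: A_def slab_def inner_add_left lat_dot)
      ultimately show "- pairing_bound i \<le> ipair m (U i) \<and> ipair m (U i) \<le> int D + pairing_bound i" by linarith
    qed
    show "finite (PiE V (\<lambda>i. {- pairing_bound i .. int D + pairing_bound i}))" using finV by (intro finite_PiE) auto
  qed
  have count: "(\<Sum>m\<in>M0. indicator A (x + lat m)) = (of_nat (D ^ card V) / of_nat (card chars) :: real)"
    if "x \<in> cube" for x
  proof -
    have "{m. x + lat m \<in> A} = {m. \<forall>i\<in>V. \<lceil>- (x \<bullet> lat (U i))\<rceil> \<le> ipair m (U i) \<and>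
        ipair m (U i) < \<lceil>- (x \<bullet> lat (U i))\<rceil> + int D}"
    proof (intro Collect_cong)
      fix m
      have "(0 \<le> s + real_of_int k \<and> s + of_int k < real D) \<longleftrightarrow> (\<lceil>- s\<rceil> \<le> k \<and> k < \<lceil>- s\<rceil> + int D)" for s k
      proof -
        have "s + of_int k < real D \<longleftrightarrow> \<not> - s \<le> of_int (k - int D)" by auto
        also have "\<dots> \<longleftrightarrow> k < \<lceil>- s\<rceil> + int D" unfolding ceiling_le_iff[symmetric] by auto
        finally show ?thesis by (auto simp: ceiling_le_iff)
      qed
      then show "(x + lat m \<in> A) = (\<forall>i\<in>V. \<lceil>- (x \<bullet> lat (U i))\<rceil> \<le> ipair m (U i) \<and>
        ipair m (U i) < \<lceil>- (x \<bullet> lat (U i))\<rceil> + int D)"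
        by (simp add: A_def slab_def inner_add_left lat_dot)
    qed
    then have "card {m. x + lat m \<in> A} * card chars = D ^ card V" using lattice_count[OF D] by simp
    moreover have "(\<Sum>m\<in>M0. indicator A (x + lat m)) = real (card {m. x + lat m \<in> A})"
    proof -
      have "(\<Sum>m\<in>M0. indicator A (x + lat m)) = (\<Sum>m\<in>{m\<in>M0. x + lat m \<in> A}. 1::real)"
        using finM0 by (simp add: sum.inter_filter indicator_def Int_def)
      also have "{m\<in>M0. x + lat m \<in> A} = {m. x + lat m \<in> A}" using that by (auto simp: M0_def)
      finally show ?thesis by simp
    qed
    ultimately have "(\<Sum>m\<in>M0. indicator A (x + lat m)) * real (card chars) = real (D ^ card V)"
      by (metis of_nat_mult)
    then show ?thesis using card_chars_pos by (simp add: eq_divide_eq)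
  qed
  \<comment> \<open>The lattice translates of the half-open unit cube tile the space; the one
    containing x is given by the integer parts of the coordinates.\<close>
  have tile: "indicator A x = (\<Sum>m\<in>M0. indicator A x * indicator cube (x - lat m) :: ennreal)" for x
  proof (cases "x \<in> A")
    case True
    define m0 where "m0 = (\<chi> j. \<lfloor>x $ j\<rfloor>)"
    have "x - lat m \<in> cube \<longleftrightarrow> m = m0" for m
    proof
      assume c: "x - lat m \<in> cube"
      have "\<lfloor>x $ j\<rfloor> = m $ j" for j
        using c by (intro floor_unique) (auto simp: cube_def lat_def algebra_simps)
      then show "m = m0" by (simp add: m0_def vec_eq_iff)
    next
      assume "m = m0"
      have "0 \<le> x $ j - of_int \<lfloor>x $ j\<rfloor> \<and> x $ j - of_int \<lfloor>x $ j\<rfloor> < 1" for j by linarith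
      then show "x - lat m \<in> cube" by (simp add: \<open>m = m0\<close> m0_def cube_def lat_def)
    qed
    moreover have "m0 \<in> M0" using True calculation[of m0] unfolding M0_def
      by (auto intro!: bexI[of _ "x - lat m0"])
    ultimately show ?thesis using finM0 True by (simp add: indicator_def)
  qed simp
  have "emeasure lborel A = (\<integral>\<^sup>+x. indicator A x \<partial>lborel)" by simp
  also have "\<dots> = (\<integral>\<^sup>+x. (\<Sum>m\<in>M0. indicator A x * indicator cube (x - lat m)) \<partial>lborel)"
    using tile by simp
  also have "\<dots> = (\<Sum>m\<in>M0. \<integral>\<^sup>+x. indicator A x * indicator cube (x - lat m) \<partial>lborel)"
    by (intro nn_integral_sum) auto
  also have "\<dots> = (\<Sum>m\<in>M0. \<integral>\<^sup>+x. indicator A (x + lat m) * indicator cube x \<partial>lborel)"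
  proof (rule sum.cong[OF refl])
    fix m
    have "(\<integral>\<^sup>+x. indicator A x * indicator cube (x - lat m) \<partial>lborel) =
       (\<integral>\<^sup>+x. indicator A x * indicator cube (x - lat m) \<partial>(distr lborel borel ((+) (lat m))))"
      by (simp add: lborel_distr_plus)
    also have "\<dots> = (\<integral>\<^sup>+x. indicator A (x + lat m) * indicator cube x \<partial>lborel)"
      by (subst nn_integral_distr) (auto simp: add.commute)
    finally show "(\<integral>\<^sup>+x. indicator A x * indicator cube (x - lat m) \<partial>lborel) =
      (\<integral>\<^sup>+x. indicator A (x + lat m) * indicator cube x \<partial>lborel)" .
  qed
  also have "\<dots> = (\<integral>\<^sup>+x. (\<Sum>m\<in>M0. indicator A (x + lat m) * indicator cube x) \<partial>lborel)"
    by (intro nn_integral_sum[symmetric]) auto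
  also have "\<dots> = (\<integral>\<^sup>+x. ennreal (real (D ^ card V) / real (card chars)) * indicator cube x \<partial>lborel)"
  proof (intro nn_integral_cong)
    fix x
    have "(\<Sum>m\<in>M0. indicator A (x + lat m) * indicator cube x :: ennreal) =
        ennreal (\<Sum>m\<in>M0. indicator A (x + lat m)) * indicator cube x"
      by (simp add: sum_distrib_right[symmetric] sum_ennreal[symmetric] ennreal_indicator del: sum_ennreal)
    then show "(\<Sum>m\<in>M0. indicator A (x + lat m) * indicator cube x :: ennreal) =
       ennreal (real (D ^ card V) / real (card chars)) * indicator cube x"
      using count[of x] by (auto simp: indicator_def)
  qed
  also have "\<dots> = ennreal (real (D ^ card V) / real (card chars))"
    by (simp add: nn_integral_cmult_indicator emeasure_cube)
  finally show ?thesis by (simp add: A_def)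
qed

lemma slab_mono: "(\<And>i. i \<in> V \<Longrightarrow> t i \<le> t' i) \<Longrightarrow> slab a t \<subseteq> slab a t'"
  unfolding slab_def by (force intro: less_le_trans)

lemma slab_finite: "emeasure lborel (slab a t) < \<infinity>"
proof -
  obtain D where D: "D > 0" "\<And>i. i \<in> V \<Longrightarrow> real D *\<^sub>R al i \<in> range lat" using common_multiple by blast
  obtain k :: nat where k: "\<And>i. i \<in> V \<Longrightarrow> t i \<le> real k"
  proof -
    have "\<exists>k::nat. \<forall>i\<in>V. t i \<le> real k"
    proof (intro exI ballI)
      fix i assume "i \<in> V"
      then have "t i \<le> Max (t ` V)" using finV by simp
      also have "\<dots> \<le> real (nat \<lceil>Max (t ` V)\<rceil>)" by linarith
      finally show "t i \<le> real (nat \<lceil>Max (t ` V)\<rceil>)" .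
    qed
    then show ?thesis using that by blast
  qed
  define E where "E = D * Suc k"
  have E: "E > 0" "\<And>i. i \<in> V \<Longrightarrow> real E *\<^sub>R al i \<in> range lat" "\<And>i. i \<in> V \<Longrightarrow> t i \<le> real E"
  proof -
    show "E > 0" using D by (simp add: E_def)
    fix i assume i: "i \<in> V"
    have "real E *\<^sub>R al i = real (Suc k) *\<^sub>R (real D *\<^sub>R al i)" by (simp add: E_def algebra_simps)
    then show "real E *\<^sub>R al i \<in> range lat" using D(2)[OF i] unfolding range_lat_iff
      by (auto intro!: Ints_mult Ints_of_nat simp del: of_nat_Suc scaleR_scaleR)
    have "1 * k \<le> D * Suc k" using D(1) by (intro mult_le_mono) auto
    then have "k \<le> E" by (simp add: E_def)
    then show "t i \<le> real E" using k[OF i] by linarith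
  qed
  have "emeasure lborel (slab a t) = emeasure lborel (slab (\<lambda>_. 0) t)" by (rule emeasure_slab_translate)
  also have "\<dots> \<le> emeasure lborel (slab (\<lambda>_. 0) (\<lambda>_. real E))"
    using E(3) by (intro emeasure_mono slab_mono) auto
  also have "\<dots> < \<infinity>" using emeasure_slab_multiple[OF E(1,2)] by simp
  finally show ?thesis .
qed

definition slab_volume :: "(nat \<Rightarrow> real) \<Rightarrow> real" where
  "slab_volume t = measure lborel (slab (\<lambda>_. 0) t)"

lemma slab_volume_translate: "measure lborel (slab a t) = slab_volume t"
  by (simp add: slab_volume_def measure_def emeasure_slab_translate[of a])

lemma slab_volume_add:
  assumes "k \<in> V" "r \<ge> 0" "s \<ge> 0"
  shows "slab_volume (t(k := r + s)) = slab_volume (t(k := r)) + slab_volume (t(k := s))"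
proof -
  define R where "R x \<longleftrightarrow> (\<forall>i\<in>V-{k}. 0 \<le> x \<bullet> lat (U i) \<and> x \<bullet> lat (U i) < t i)" for x
  have mem: "x \<in> slab ((\<lambda>_. 0)(k := p)) (t(k := q)) \<longleftrightarrow> R x \<and> p \<le> x \<bullet> lat (U k) \<and> x \<bullet> lat (U k) < p + q" for x p q
  proof -
    have "V = insert k (V - {k})" using \<open>k \<in> V\<close> by blast
    then have "(\<forall>i\<in>V. S i) \<longleftrightarrow> S k \<and> (\<forall>i\<in>V-{k}. S i)" for S by (metis insert_iff)
    from this[of "\<lambda>i. ((\<lambda>_. 0)(k := p)) i \<le> x \<bullet> lat (U i) \<and> x \<bullet> lat (U i) < ((\<lambda>_. 0)(k := p)) i + (t(k := q)) i"]
    show ?thesis unfolding slab_def R_def mem_Collect_eq by simp blast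
  qed
  have mem0: "x \<in> slab (\<lambda>_. 0) (t(k := q)) \<longleftrightarrow> R x \<and> 0 \<le> x \<bullet> lat (U k) \<and> x \<bullet> lat (U k) < q" for x q
  proof -
    have "(\<lambda>_. 0::real)(k := 0) = (\<lambda>_. 0)" by auto
    then show ?thesis using mem[of x 0 q] by (simp only: add_0)
  qed
  have "slab (\<lambda>_. 0) (t(k := r + s)) = slab (\<lambda>_. 0) (t(k := r)) \<union> slab ((\<lambda>_. 0)(k := r)) (t(k := s))"
    using assms unfolding set_eq_iff Un_iff mem mem0 by (auto simp del: fun_upd_apply)
  moreover have "slab (\<lambda>_. 0) (t(k := r)) \<inter> slab ((\<lambda>_. 0)(k := r)) (t(k := s)) = {}"
    using assms unfolding set_eq_iff Int_iff mem mem0 by (auto simp del: fun_upd_apply)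
  ultimately have "slab_volume (t(k := r + s)) = measure lborel (slab (\<lambda>_. 0) (t(k := r))) + measure lborel (slab ((\<lambda>_. 0)(k := r)) (t(k := s)))"
    using measure_Union[of lborel "slab (\<lambda>_. 0) (t(k := r))" "slab ((\<lambda>_. 0)(k := r)) (t(k := s))"]
      slab_finite by (simp add: slab_volume_def less_top[symmetric] less_imp_neq)
  then show ?thesis by (simp only: slab_volume_translate)
qed

text \<open>In each side length separately the volume is additive and nonnegative, hence linear. The
  sides are replaced by 1 one after the other.\<close>

lemma slab_volume_prod:
  assumes "\<And>i. i \<in> V \<Longrightarrow> t i \<ge> 0"
  shows "slab_volume t = (\<Prod>i\<in>V. t i) * slab_volume (\<lambda>_. 1)"
proof -
  have "slab_volume t = (\<Prod>i\<in>S. t i) * slab_volume (\<lambda>i. if i \<in> S then 1 else t i)" if "S \<subseteq> V" for S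
    using finite_subset[OF that finV] that
  proof (induction S rule: finite_induct)
    case (insert k S)
    let ?t = "\<lambda>i. if i \<in> S then 1 else t i"
    have e: "?t = ?t(k := t k)" "(\<lambda>i. if i \<in> insert k S then 1 else t i) = ?t(k := 1)" using insert by auto
    have "slab_volume (?t(k := t k)) = t k * slab_volume (?t(k := 1))"
      using insert assms by (intro additive_nonneg_linear[where f="\<lambda>r. slab_volume (?t(k := r))"] slab_volume_add) (auto simp: slab_volume_def)
    then show ?case using insert unfolding e(2) by (simp add: e(1)[symmetric])
  qed simp
  from this[of V] have "slab_volume t = (\<Prod>i\<in>V. t i) * slab_volume (\<lambda>i. if i \<in> V then 1 else t i)" by simp
  also have "slab (\<lambda>_. 0) (\<lambda>i. if i \<in> V then 1 else t i) = slab (\<lambda>_. 0) (\<lambda>_. 1)" by (auto simp: slab_def)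
  then have "slab_volume (\<lambda>i. if i \<in> V then 1 else t i) = slab_volume (\<lambda>_. 1)" by (simp add: slab_volume_def)
  finally show ?thesis .
qed

text \<open>The Jacobian of the pairing map appears directly as a number of characters: the slab
  whose sides are a common multiple D has a volume known by counting, and multilinearity scales it
  down to side 1.\<close>

lemma slab_volume_one: "slab_volume (\<lambda>_. 1) = 1 / card chars"
proof -
  obtain D where D: "D > 0" "\<And>i. i \<in> V \<Longrightarrow> real D *\<^sub>R al i \<in> range lat" using common_multiple by blast
  have "slab_volume (\<lambda>_. real D) = real D ^ card V * slab_volume (\<lambda>_. 1)" by (subst slab_volume_prod) auto
  moreover have "slab_volume (\<lambda>_. real D) = real D ^ card V / real (card chars)"
    by (simp add: slab_volume_def measure_def emeasure_slab_multiple[OF D])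
  ultimately have "real D ^ card V * slab_volume (\<lambda>_. 1) = real D ^ card V * (1 / card chars)" by simp
  then show ?thesis using D(1) by (metis mult_left_cancel of_nat_0_less_iff order_less_irrefl zero_less_power)
qed

lemma emeasure_slab:
  assumes "\<And>i. i \<in> V \<Longrightarrow> t i \<ge> 0"
  shows "emeasure lborel (slab a t) = ennreal ((\<Prod>i\<in>V. t i) / card chars)"
proof -
  have "emeasure lborel (slab a t) = ennreal (measure lborel (slab a t))"
    using slab_finite[of a t] by (intro emeasure_eq_ennreal_measure) (auto simp: less_top)
  then show ?thesis using slab_volume_prod[OF assms] by (simp add: slab_volume_translate slab_volume_one)
qed

end

section \<open>Integration in the coordinates given by the pairings\<close>

lemma prod_Basis_vec: "(\<Prod>b\<in>(Basis :: (real^'n) set). f b) = (\<Prod>j\<in>UNIV. f (axis j 1))"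
proof -
  have "(Basis :: (real^'n) set) = (\<lambda>j. axis j 1) ` UNIV" by (auto simp: Basis_vec_def)
  moreover have "inj (\<lambda>j::'n. axis j (1::real))" by (auto simp: inj_def axis_eq_axis)
  ultimately show ?thesis by (subst \<open>Basis = _\<close>, subst prod.reindex) auto
qed

text \<open>Fubini for the product measure over \<open>Basis\<close>; \<open>k\<close> translates a
  basis vector back into its coordinate.\<close>

lemma integral_prod_vec:
  fixes \<psi> :: "'n::finite \<Rightarrow> real \<Rightarrow> complex"
  assumes int: "\<And>j. integrable lborel (\<psi> j)"
  shows "integrable lborel (\<lambda>y::real^'n. \<Prod>j\<in>UNIV. \<psi> j (y $ j))"
    and "integral\<^sup>L lborel (\<lambda>y::real^'n. \<Prod>j\<in>UNIV. \<psi> j (y $ j)) = (\<Prod>j\<in>UNIV. \<integral>s. \<psi> j s \<partial>lborel)"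
proof -
  interpret product_sigma_finite "\<lambda>_::real^'n. lborel :: real measure" by standard
  define k where "k = inv_into UNIV (\<lambda>j::'n. axis j (1::real))"
  have k: "k (axis j 1) = j" for j
    unfolding k_def by (intro inv_into_f_f) (auto simp: inj_def axis_eq_axis)
  define \<psi>' where "\<psi>' b = \<psi> (k b)" for b
  have m [measurable]: "\<psi> j \<in> borel_measurable borel" for j
    using borel_measurable_integrable[OF int[of j]] by simp
  have m' [measurable]: "\<psi>' b \<in> borel_measurable borel" for b by (simp add: \<psi>'_def)
  have eq: "(\<Prod>j\<in>UNIV. \<psi> j (y $ j)) = (\<Prod>b\<in>Basis. \<psi>' b (y \<bullet> b))" for y :: "real^'n"
    unfolding prod_Basis_vec by (simp add: \<psi>'_def k inner_axis)
  have eq2: "(\<Prod>b\<in>Basis. \<psi>' b ((\<Sum>b'\<in>Basis. f b' *\<^sub>R b') \<bullet> b)) = (\<Prod>b\<in>Basis. \<psi>' b (f b))" for f :: "real^'n \<Rightarrow> real"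
    by (intro prod.cong) auto
  have T: "(\<lambda>f. \<Sum>b\<in>Basis. f b *\<^sub>R b) \<in> measurable (Pi\<^sub>M Basis (\<lambda>_. lborel)) (borel :: (real^'n) measure)"
    by measurable
  have meas: "(\<lambda>y. \<Prod>b\<in>Basis. \<psi>' b (y \<bullet> b)) \<in> borel_measurable (borel :: (real^'n) measure)"
    by measurable
  have "integrable (Pi\<^sub>M Basis (\<lambda>_. lborel)) (\<lambda>f. \<Prod>b\<in>Basis. \<psi>' b (f b))"
    by (intro product_integrable_prod) (auto simp: \<psi>'_def int)
  then show "integrable lborel (\<lambda>y::real^'n. \<Prod>j\<in>UNIV. \<psi> j (y $ j))"
    unfolding eq by (subst lborel_eq) (simp add: integrable_distr_eq[OF T meas] eq2)
  have "(\<integral>y. (\<Prod>b\<in>Basis. \<psi>' b (y \<bullet> b)) \<partial>(lborel :: (real^'n) measure)) =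
      (\<integral>f. (\<Prod>b\<in>Basis. \<psi>' b (f b)) \<partial>Pi\<^sub>M Basis (\<lambda>_. lborel))"
    by (subst lborel_eq) (simp add: integral_distr[OF T meas] eq2)
  also have "\<dots> = (\<Prod>b\<in>Basis. \<integral>s. \<psi>' b s \<partial>lborel)"
    by (intro product_integral_prod) (auto simp: \<psi>'_def int)
  finally show "integral\<^sup>L lborel (\<lambda>y::real^'n. \<Prod>j\<in>UNIV. \<psi> j (y $ j)) = (\<Prod>j\<in>UNIV. \<integral>s. \<psi> j s \<partial>lborel)"
    unfolding eq by (simp add: prod_Basis_vec \<psi>'_def k)
qed

context lattice_basis
begin

lemma lat_U_nonzero: "i \<in> V \<Longrightarrow> lat (U i) \<noteq> 0"
  using dual[of i i] by auto

lemma AE_not_on_hyperplane: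
  assumes "i \<in> V"
  shows "AE x in lborel. x \<bullet> lat (U i) \<noteq> a"
proof -
  have "negligible {x. lat (U i) \<bullet> x = a}"
    using lat_U_nonzero[OF assms] by (intro negligible_hyperplane) auto
  then have "{x. lat (U i) \<bullet> x = a} \<in> null_sets lebesgue" by (simp add: negligible_iff_null_sets)
  moreover have "{x. lat (U i) \<bullet> x = a} \<in> sets lborel" by simp
  ultimately have "{x. lat (U i) \<bullet> x = a} \<in> null_sets lborel" using null_sets_completion_iff by blast
  then show ?thesis by (rule AE_I') (auto simp: inner_commute)
qed

text \<open>Lebesgue measure is determined by its values on open boxes, and the preimage of such a
  box under the pairing map is a slab up to the hyperplanes bounding it.\<close>

lemma lborel_pairing:
  assumes b: "bij_betw b (UNIV :: 'n set) V"
  shows "lborel = density (distr lborel borel (\<lambda>x. \<chi> j. x \<bullet> lat (U (b j)))) (\<lambda>_. ennreal (real (card chars)))"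
proof (rule lborel_eqI)
  fix l w :: "real^'n" assume le: "\<And>b. b \<in> Basis \<Longrightarrow> l \<bullet> b \<le> w \<bullet> b"
  define L :: "real^'n \<Rightarrow> real^'n" where "L x = (\<chi> j. x \<bullet> lat (U (b j)))" for x
  have L [measurable]: "L \<in> borel_measurable borel"
    unfolding L_def by (intro borel_measurable_continuous_onI continuous_on_vec_lambda continuous_intros)
  have le': "l $ j \<le> w $ j" for j using le[of "axis j 1"] by (simp add: inner_axis)
  define k where "k = inv_into UNIV b"
  have kb: "k (b j) = j" for j using b by (simp add: k_def bij_betw_def)
  have bV: "b j \<in> V" for j using b by (auto simp: bij_betw_def)
  define a where "a i = l $ k i" for i
  define t where "t i = w $ k i - l $ k i" for i
  have prodV: "(\<Prod>i\<in>V. t i) = (\<Prod>b\<in>Basis. (w - l) \<bullet> b)"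
    unfolding prod_Basis_vec prod.reindex_bij_betw[OF b, symmetric]
    by (simp add: t_def kb inner_axis inner_diff_left)
  have vim: "L -` box l w = {x. \<forall>i\<in>V. a i < x \<bullet> lat (U i) \<and> x \<bullet> lat (U i) < a i + t i}"
  proof -
    have "(\<forall>j. P (b j) j) \<longleftrightarrow> (\<forall>i\<in>V. P i (k i))" for P
      using b kb by (auto simp: bij_betw_def)
    from this[of "\<lambda>i j. l $ j < x \<bullet> lat (U i) \<and> x \<bullet> lat (U i) < w $ j" for x]
    show ?thesis by (auto simp: mem_box_cart L_def a_def t_def)
  qed
  have AE: "AE x in lborel. \<forall>i\<in>V. x \<bullet> lat (U i) \<noteq> a i"
    using finV AE_not_on_hyperplane by (intro AE_finite_allI) auto
  have "emeasure lborel (L -` box l w) = emeasure lborel (slab a t)"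
  proof (rule emeasure_eq_AE)
    show "AE x in lborel. x \<in> L -` box l w \<longleftrightarrow> x \<in> slab a t"
      using AE by eventually_elim (force simp: vim slab_def)
    show "L -` box l w \<in> sets lborel" using measurable_sets[OF L, of "box l w"] by simp
  qed simp
  also have "\<dots> = ennreal ((\<Prod>i\<in>V. t i) / card chars)"
    using le' by (intro emeasure_slab) (simp add: t_def)
  finally have e: "emeasure lborel (L -` box l w) = ennreal ((\<Prod>b\<in>Basis. (w - l) \<bullet> b) / card chars)"
    by (simp add: prodV)
  have "emeasure (density (distr lborel borel L) (\<lambda>_. ennreal (real (card chars)))) (box l w) =
    ennreal (real (card chars)) * ennreal ((\<Prod>b\<in>Basis. (w - l) \<bullet> b) / card chars)"
    by (simp add: emeasure_density_const emeasure_distr e)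
  also have "\<dots> = ennreal (\<Prod>b\<in>Basis. (w - l) \<bullet> b)"
    using card_chars_pos by (subst ennreal_mult'[symmetric]) auto
  finally show "emeasure (density (distr lborel borel (\<lambda>x. \<chi> j. x \<bullet> lat (U (b j)))) (\<lambda>_. ennreal (real (card chars)))) (box l w) =
    ennreal (\<Prod>b\<in>Basis. (w - l) \<bullet> b)" by (simp add: L_def[abs_def])
qed simp

text \<open>The pairing map transports the integral to coordinate space at the cost of the factor
  \<open>1 / card chars\<close>, and there the integrand is a product of functions of one coordinate
  each.\<close>

theorem integral_pairing_prod:
  fixes \<psi> :: "nat \<Rightarrow> real \<Rightarrow> complex"
  assumes cardV: "card V = CARD('n)" and int: "\<And>i. i \<in> V \<Longrightarrow> integrable lborel (\<psi> i)"
  shows "integrable lborel (\<lambda>x. \<Prod>i\<in>V. \<psi> i (x \<bullet> lat (U i)))"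
    and "(\<integral>x. (\<Prod>i\<in>V. \<psi> i (x \<bullet> lat (U i))) \<partial>lborel) = (\<Prod>i\<in>V. \<integral>s. \<psi> i s \<partial>lborel) / of_nat (card chars)"
proof -
  obtain b where b: "bij_betw b (UNIV :: 'n set) V"
    using cardV finV by (metis finite_class.finite_UNIV finite_same_card_bij)
  define L :: "real^'n \<Rightarrow> real^'n" where "L x = (\<chi> j. x \<bullet> lat (U (b j)))" for x
  have L [measurable]: "L \<in> borel_measurable borel"
    unfolding L_def by (intro borel_measurable_continuous_onI continuous_on_vec_lambda continuous_intros)
  have bV: "b j \<in> V" for j using b by (auto simp: bij_betw_def)
  define F where "F y = (\<Prod>j\<in>UNIV. \<psi> (b j) (y $ j))" for y :: "real^'n"
  have F: "integrable lborel F" "integral\<^sup>L lborel F = (\<Prod>j\<in>UNIV. \<integral>s. \<psi> (b j) s \<partial>lborel)"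
    unfolding F_def using integral_prod_vec[of "\<lambda>j. \<psi> (b j)"] int bV by auto
  have Fm [measurable]: "F \<in> borel_measurable borel" using borel_measurable_integrable[OF F(1)] by simp
  have FL: "F (L x) = (\<Prod>i\<in>V. \<psi> i (x \<bullet> lat (U i)))" for x
    unfolding F_def L_def using prod.reindex_bij_betw[OF b, of "\<lambda>i. \<psi> i (x \<bullet> lat (U i))"] by simp
  have lb: "lborel = density (distr lborel borel L) (\<lambda>_. ennreal (real (card chars)))"
    using lborel_pairing[OF b] by (simp add: L_def[abs_def])
  have N: "real (card chars) \<noteq> 0" using card_chars_pos by simp
  from F(1) have "integrable (density (distr lborel borel L) (\<lambda>_. ennreal (real (card chars)))) F"
    using lb by metis
  then have "integrable (distr lborel borel L) (\<lambda>y. real (card chars) *\<^sub>R F y)"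
    by (subst (asm) integrable_density) auto
  then have "integrable (distr lborel borel L) (\<lambda>y. (1 / real (card chars)) *\<^sub>R (real (card chars) *\<^sub>R F y))"
    by (rule integrable_scaleR_right)
  then have "integrable (distr lborel borel L) F" using N by simp
  then show "integrable lborel (\<lambda>x. \<Prod>i\<in>V. \<psi> i (x \<bullet> lat (U i)))"
    by (simp add: integrable_distr_eq FL)
  have "integral\<^sup>L lborel F = integral\<^sup>L (density (distr lborel borel L) (\<lambda>_. ennreal (real (card chars)))) F"
    using lb by metis
  also have "\<dots> = real (card chars) *\<^sub>R integral\<^sup>L (distr lborel borel L) F"
    by (subst integral_density) auto
  also have "integral\<^sup>L (distr lborel borel L) F = (\<integral>x. F (L x) \<partial>lborel)"
    by (intro integral_distr) auto
  finally have "integral\<^sup>L lborel F = real (card chars) *\<^sub>R (\<integral>x. (\<Prod>i\<in>V. \<psi> i (x \<bullet> lat (U i))) \<partial>lborel)"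
    by (simp add: FL)
  moreover have "integral\<^sup>L lborel F = (\<Prod>i\<in>V. \<integral>s. \<psi> i s \<partial>lborel)"
    unfolding F(2) by (rule prod.reindex_bij_betw[OF b])
  ultimately show "(\<integral>x. (\<Prod>i\<in>V. \<psi> i (x \<bullet> lat (U i))) \<partial>lborel) = (\<Prod>i\<in>V. \<integral>s. \<psi> i s \<partial>lborel) / of_nat (card chars)"
    using N by (simp add: scaleR_conv_of_real field_simps)
qed

end


section \<open>Exponential integrals and sums over simplicial cones\<close>

lemma exp_halfline_integral:
  fixes b :: real
  assumes "b < 0"
  shows "has_bochner_integral lborel (\<lambda>s. indicator {0..} s * exp (b * s)) (- 1 / b)"
proof (rule has_bochner_integral_nn_integral)
  have "(\<integral>\<^sup>+x. ennreal (exp (b * x)) * indicator {0..} x \<partial>lborel) = ennreal (0 - exp (b * 0) / b)"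
  proof (rule nn_integral_FTC_atLeast)
    show "((\<lambda>x. exp (b * x) / b) has_real_derivative exp (b * x)) (at x)" for x
      using assms by (auto intro!: derivative_eq_intros)
    have "LIM x at_top. b * x :> at_bot"
      using assms by (intro filterlim_tendsto_neg_mult_at_bot[OF tendsto_const _ filterlim_ident]) auto
    then have "((\<lambda>x. exp (b * x)) \<longlongrightarrow> 0) at_top"
      by (rule filterlim_compose[OF exp_at_bot])
    then show "((\<lambda>x. exp (b * x) / b) \<longlongrightarrow> 0) at_top"
      using tendsto_divide[of _ 0 at_top "\<lambda>_. b" b] assms by simp
  qed auto
  then show "(\<integral>\<^sup>+x. ennreal (indicator {0..} x * exp (b * x)) \<partial>lborel) = ennreal (- 1 / b)"
    by (simp add: ennreal_mult ennreal_indicator mult.commute)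
qed (use assms in \<open>auto simp: divide_nonneg_neg divide_nonpos_neg\<close>)

text \<open>Both signs of b lead to the same value. For b > 0 the polarised weight is, off 0, minus
  the indicator of the negative half-line, and this sign turns the integral 1 / b into -1 /
  b.\<close>

lemma step_exp_integral:
  fixes b :: real
  assumes "b \<noteq> 0"
  shows "has_bochner_integral lborel
    (\<lambda>s. (step_weight 1 1 s - (if b < 0 then 0 else 1)) * exp (complex_of_real (b * s))) (complex_of_real (- 1 / b))"
proof (cases "b < 0")
  case True
  have "has_bochner_integral lborel (\<lambda>s. complex_of_real (indicator {0..} s * exp (b * s))) (complex_of_real (- 1 / b))"
    using exp_halfline_integral[OF True] by (rule has_bochner_integral_of_real)
  also have "(\<lambda>s. complex_of_real (indicator {0..} s * exp (b * s))) =
     (\<lambda>s. (step_weight 1 1 s - (if b < 0 then 0 else 1)) * exp (complex_of_real (b * s)))"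
    using True by (auto simp: fun_eq_iff step_weight_def indicator_def exp_of_real[symmetric])
  finally show ?thesis .
next
  case False
  then have b: "b > 0" using assms by simp
  have "has_bochner_integral lborel (\<lambda>s. indicator {0..} (0 + (-1) * s) * exp (- b * (0 + (-1) * s))) ((- 1 / (- b)) /\<^sub>R \<bar>-1\<bar>)"
    using exp_halfline_integral[of "- b"] b
    by (subst lborel_has_bochner_integral_real_affine_iff[symmetric]) auto
  then have h: "has_bochner_integral lborel (\<lambda>s. complex_of_real (- (indicator {0..} (- s) * exp (b * s)))) (complex_of_real (- 1 / b))"
    by (intro has_bochner_integral_of_real) (drule has_bochner_integral_minus, simp)
  have ae: "AE s in lborel. complex_of_real (- (indicator {0..} (- s) * exp (b * s))) =
       (step_weight 1 1 s - (if b < 0 then 0 else 1)) * exp (complex_of_real (b * s))"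
    by (rule AE_mp[OF AE_lborel_singleton[of "0::real"]])
      (use b in \<open>auto intro!: AE_I2 simp: step_weight_def indicator_def exp_of_real[symmetric]\<close>)
  have m1: "(\<lambda>s. (step_weight 1 1 s - (if b < 0 then 0 else 1)) * exp (complex_of_real (b * s))) \<in> borel_measurable lborel"
    unfolding step_weight_def by measurable
  have m2: "(\<lambda>s. complex_of_real (- (indicator {0..} (- s) * exp (b * s)))) \<in> borel_measurable lborel"
    by measurable
  show ?thesis using h by (rule iffD1[OF has_bochner_integral_cong_AE[OF m2 m1 ae]])
qed

lemma step_series_nat:
  fixes z :: complex
  assumes "norm z < 1"
  shows "(\<lambda>n. norm ((if n = 0 then w else q) * z ^ n)) summable_on (UNIV :: nat set)"
    and "((\<lambda>n. (if n = 0 then w else q) * z ^ n) has_sum (w + q * z / (1 - z))) (UNIV :: nat set)"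
proof -
  let ?f = "\<lambda>n. (if n = 0 then w else q) * z ^ n"
  have "summable (\<lambda>n. (norm w + norm q) * norm z ^ n)" using assms by (intro summable_mult summable_geometric) simp
  then have sm: "summable (\<lambda>n. norm (?f n))"
  proof (rule summable_comparison_test'[where N=0])
    show "norm (norm (?f n)) \<le> (norm w + norm q) * norm z ^ n" for n
      by (auto simp: norm_mult norm_power intro!: mult_right_mono)
  qed
  then show "(\<lambda>n. norm (?f n)) summable_on UNIV" by (simp add: norm_summable_imp_summable_on)
  have "(\<lambda>n. q * z ^ n) sums (q * (1 / (1 - z)))" using assms by (intro sums_mult geometric_sums) simp
  moreover have "(\<lambda>n. if n = 0 then w - q else 0) sums (w - q)" by (rule sums_single)
  ultimately have sums: "(\<lambda>n. q * z ^ n + (if n = 0 then w - q else 0)) sums (q * (1 / (1 - z)) + (w - q))"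
    by (rule sums_add)
  have fe: "(\<lambda>n. q * z ^ n + (if n = 0 then w - q else 0)) = ?f" by auto
  have "z \<noteq> 1" using assms by auto
  then have eq: "q * (1 / (1 - z)) + (w - q) = w + q * z / (1 - z)" by (simp add: field_simps)
  have "?f sums (w + q * z / (1 - z))" using sums unfolding eq fe .
  with sm show "(?f has_sum (w + q * z / (1 - z))) UNIV" by (rule norm_summable_imp_has_sum)
qed

lemma step_series_lt:
  fixes z :: complex
  assumes "norm z < 1"
  shows "(\<lambda>k. norm (step_weight q w (of_int k) * z powi k)) summable_on (UNIV :: int set)"
    and "((\<lambda>k. step_weight q w (of_int k) * z powi k) has_sum (w + q * z / (1 - z))) (UNIV :: int set)"
proof -
  let ?f = "\<lambda>k::int. step_weight q w (of_int k) * z powi k"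
  have inj: "inj int" by (simp add: inj_on_def)
  have comp: "?f \<circ> int = (\<lambda>n. (if n = 0 then w else q) * z ^ n)"
    by (auto simp: step_weight_def)
  have out: "?f k = 0" if "k \<in> UNIV - range int" for k
  proof -
    have "k < 0" using that by (metis DiffD2 nonneg_int_cases not_less rangeI)
    then show ?thesis by (simp add: step_weight_def)
  qed
  have "(?f has_sum (w + q * z / (1 - z))) (range int)"
    unfolding has_sum_reindex[OF inj] comp by (rule step_series_nat[OF assms])
  then show "(?f has_sum (w + q * z / (1 - z))) UNIV"
    by (rule has_sum_cong_neutral[THEN iffD1, rotated -1]) (use out in auto)
  have "(norm \<circ> ?f) summable_on (range int)"
    unfolding summable_on_reindex[OF inj] comp_assoc comp
    using step_series_nat(1)[OF assms, of w q] by (simp only: comp_def)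
  then have "(norm \<circ> ?f) summable_on UNIV"
    by (rule summable_on_cong_neutral[THEN iffD1, rotated -1]) (use out in auto)
  then show "(\<lambda>k. norm (?f k)) summable_on UNIV" by (simp add: comp_def)
qed

text \<open>The sum is the same rational function of z on both sides of the unit circle, because
  subtracting q removes the diverging half of the series and keeps the other half with the opposite
  sign.\<close>

lemma step_series:
  fixes z q w :: complex
  assumes "norm z \<noteq> 1" "z \<noteq> 0"
  defines "f \<equiv> \<lambda>k::int. (step_weight q w (of_int k) - (if norm z < 1 then 0 else q)) * z powi k"
  shows "(\<lambda>k. norm (f k)) summable_on UNIV" and "infsum f UNIV = w + q * z / (1 - z)"
proof -
  have *: "(\<lambda>k. norm (f k)) summable_on UNIV \<and> infsum f UNIV = w + q * z / (1 - z)"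
  proof (cases "norm z < 1")
    case True
    then have "f = (\<lambda>k. step_weight q w (of_int k) * z powi k)" by (auto simp: f_def)
    with step_series_lt[OF True, of q w] show ?thesis by (auto intro: infsumI)
  next
    case False
    let ?z = "inverse z"
    have z: "norm ?z < 1" using False assms(1) by (simp add: norm_inverse inverse_less_1_iff)
    \<comment> \<open>Outside the unit disc the support is k <= 0, with value w - q at 0 and -q
      below. Reversing k and the sign gives a series in the inverse of z with the same q and with q
      - w in place of w.\<close>
    let ?g = "\<lambda>k::int. step_weight q (q - w) (of_int k) * ?z powi k"
    have fg: "f = (\<lambda>k. - ?g (- k))"
      using False by (auto simp: f_def step_weight_def fun_eq_iff power_int_minus power_int_inverse)
    have bij: "bij (uminus :: int \<Rightarrow> int)" by (simp add: bij_uminus)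
    have gs: "(\<lambda>k. norm (?g k)) summable_on UNIV" "(?g has_sum (q - w + q * ?z / (1 - ?z))) UNIV"
      using step_series_lt[OF z] by auto
    have "(\<lambda>k. norm (?g (- k))) summable_on UNIV"
      using gs(1) summable_on_reindex_bij_betw[OF bij, of "\<lambda>k. norm (?g k)"] by simp
    then have "(\<lambda>k. norm (f k)) summable_on UNIV" by (simp add: fg)
    moreover have "((\<lambda>k. ?g (- k)) has_sum (q - w + q * ?z / (1 - ?z))) UNIV"
      using gs(2) has_sum_reindex_bij_betw[OF bij, of ?g] by simp
    then have "(f has_sum - (q - w + q * ?z / (1 - ?z))) UNIV" unfolding fg by (rule has_sum_uminusI)
    moreover have "- (q - w + q * ?z / (1 - ?z)) = w + q * z / (1 - z)"
    proof -
      have "z - 1 \<noteq> 0" "1 - z \<noteq> 0" using assms(1) by auto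
      have "q * ?z / (1 - ?z) = q / (z - 1)" using assms by (simp add: field_simps)
      also have "\<dots> = - (q / (1 - z))" by (metis minus_diff_eq minus_divide_right)
      finally show ?thesis using \<open>1 - z \<noteq> 0\<close> by (simp add: field_simps)
    qed
    ultimately show ?thesis by (simp add: infsumI)
  qed
  then show "(\<lambda>k. norm (f k)) summable_on UNIV" "infsum f UNIV = w + q * z / (1 - z)" by auto
qed

lemma has_sum_finite_sum:
  fixes f :: "'a \<Rightarrow> 'b \<Rightarrow> complex"
  assumes "finite S" "\<And>g. g \<in> S \<Longrightarrow> (f g has_sum s g) A"
  shows "((\<lambda>k. \<Sum>g\<in>S. f g k) has_sum (\<Sum>g\<in>S. s g)) A"
  using assms by (induction S) (auto intro!: has_sum_add)

context lattice_basis
begin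

lemma char_norm:
  assumes "g \<in> chars" "i \<in> V"
  shows "norm (g i) = 1"
proof -
  obtain D where "D > 0" "\<And>i. i \<in> V \<Longrightarrow> real D *\<^sub>R al i \<in> range lat" using common_multiple by blast
  then have "g i ^ D = 1" using char_root_of_unity assms by blast
  then show ?thesis using \<open>D > 0\<close> by (metis norm_one norm_power norm_ge_zero power_eq_1_iff less_not_refl2)
qed

text \<open>The sum over M is a sum over all integer vectors indexed by V, restricted to a
  sublattice. The average of the characters is the indicator of this sublattice, and for each
  character the sum factorises over V.\<close>

lemma has_sum_pairing:
  fixes F :: "nat \<Rightarrow> int \<Rightarrow> complex"
  assumes "\<And>g i. g \<in> chars \<Longrightarrow> i \<in> V \<Longrightarrow> (\<lambda>k. norm (g i powi k * F i k)) summable_on UNIV"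
    and "\<And>g i. g \<in> chars \<Longrightarrow> i \<in> V \<Longrightarrow> infsum (\<lambda>k. g i powi k * F i k) UNIV = S g i"
  shows "((\<lambda>m. \<Prod>i\<in>V. F i (ipair m (U i))) has_sum ((\<Sum>g\<in>chars. \<Prod>i\<in>V. S g i) / of_nat (card chars))) UNIV"
proof -
  let ?B = "PiE V (\<lambda>_. UNIV :: int set)"
  let ?N = "of_nat (card chars) :: complex"
  have N: "?N \<noteq> 0" using card_chars_pos by simp
  have "((\<lambda>k. \<Prod>i\<in>V. g i powi k i * F i (k i)) has_sum (\<Prod>i\<in>V. S g i)) ?B" if g: "g \<in> chars" for g
  proof -
    have "(\<lambda>k. norm (\<Prod>i\<in>V. g i powi k i * F i (k i))) summable_on ?B"
    proof (rule iffD2[OF abs_summable_equivalent[of "\<lambda>k. \<Prod>i\<in>V. g i powi k i * F i (k i)"]])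
      show "Infinite_Set_Sum.abs_summable_on (\<lambda>k. \<Prod>i\<in>V. g i powi k i * F i (k i)) ?B"
      proof (rule abs_summable_on_prod_PiE[OF finV])
        show "Infinite_Set_Sum.abs_summable_on (\<lambda>k. g i powi k * F i k) UNIV" if "i \<in> V" for i
          using assms(1)[OF g that] by (rule iffD1[OF abs_summable_equivalent[of "\<lambda>k. g i powi k * F i k"]])
      qed simp
    qed
    then have "((\<lambda>k. \<Prod>i\<in>V. g i powi k i * F i (k i)) has_sum infsum (\<lambda>k. \<Prod>i\<in>V. g i powi k i * F i (k i)) ?B) ?B"
      by (rule has_sum_infsum[OF abs_summable_summable])
    also have "infsum (\<lambda>k. \<Prod>i\<in>V. g i powi k i * F i (k i)) ?B = (\<Prod>i\<in>V. infsum (\<lambda>k. g i powi k * F i k) UNIV)"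
      by (rule infsum_prod_PiE_abs[OF finV assms(1)[OF g]])
    also have "\<dots> = (\<Prod>i\<in>V. S g i)" using assms(2)[OF g] by simp
    finally show ?thesis .
  qed
  then have "((\<lambda>k. \<Sum>g\<in>chars. \<Prod>i\<in>V. g i powi k i * F i (k i)) has_sum (\<Sum>g\<in>chars. \<Prod>i\<in>V. S g i)) ?B"
    using finite_chars by (intro has_sum_finite_sum) auto
  then have "((\<lambda>k. (\<Sum>g\<in>chars. \<Prod>i\<in>V. g i powi k i * F i (k i)) / ?N) has_sum ((\<Sum>g\<in>chars. \<Prod>i\<in>V. S g i) / ?N)) ?B"
    by (rule has_sum_divide_const)
  also have "(\<lambda>k. (\<Sum>g\<in>chars. \<Prod>i\<in>V. g i powi k i * F i (k i)) / ?N) =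
      (\<lambda>k. if in_lattice k then \<Prod>i\<in>V. F i (k i) else 0)"
  proof
    fix k
    have "(\<Sum>g\<in>chars. \<Prod>i\<in>V. g i powi k i * F i (k i)) = (\<Sum>g\<in>chars. eval_char g k) * (\<Prod>i\<in>V. F i (k i))"
      by (simp add: eval_char_def prod.distrib sum_distrib_right)
    then show "(\<Sum>g\<in>chars. \<Prod>i\<in>V. g i powi k i * F i (k i)) / ?N = (if in_lattice k then \<Prod>i\<in>V. F i (k i) else 0)"
      using N by (simp add: char_sum)
  qed
  finally have *: "((\<lambda>k. \<Prod>i\<in>V. F i (k i)) has_sum ((\<Sum>g\<in>chars. \<Prod>i\<in>V. S g i) / ?N)) {k\<in>?B. in_lattice k}"
    by (rule has_sum_cong_neutral[THEN iffD1, rotated -1]) auto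
  have "?B \<subseteq> extensional V" by (auto simp: PiE_iff)
  moreover have "{m. (\<lambda>i\<in>V. ipair m (U i)) \<in> ?B} = UNIV" by auto
  ultimately have "bij_betw (\<lambda>m. \<lambda>i\<in>V. ipair m (U i)) UNIV {k\<in>?B. in_lattice k}"
    using bij_betw_pairing[of ?B] by (simp only:)
  note bij = this
  have "((\<lambda>m. \<Prod>i\<in>V. F i ((\<lambda>i\<in>V. ipair m (U i)) i)) has_sum ((\<Sum>g\<in>chars. \<Prod>i\<in>V. S g i) / ?N)) UNIV"
    using has_sum_reindex_bij_betw[OF bij, of "\<lambda>k. \<Prod>i\<in>V. F i (k i)"] * by blast
  then show ?thesis by (simp cong: prod.cong)
qed

end

locale lattice_vertex_system = vertex_system I "\<lambda>i. lat (U i)" VV \<alpha> c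
  for I :: "nat set" and U :: "nat \<Rightarrow> int ^ 'n" and VV :: "nat set set"
    and \<alpha> :: "nat set \<Rightarrow> nat \<Rightarrow> real ^ 'n" and c :: "nat \<Rightarrow> real" +
  fixes e :: "nat \<Rightarrow> complex"
begin

lemma lattice_basis_vertex: "V \<in> VV \<Longrightarrow> lattice_basis V U (\<alpha> V)"
  by standard (auto simp: finite_V dual expand)

abbreviation vchars :: "nat set \<Rightarrow> (nat \<Rightarrow> complex) set" where
  "vchars V \<equiv> lattice_basis.chars V U e"

abbreviation index :: "nat set \<Rightarrow> complex" where
  "index V \<equiv> of_nat (card (vchars V))"

lemma exp_split:
  assumes "V \<in> VV"
  shows "exp (complex_of_real (\<xi> \<bullet> x)) = exp (complex_of_real (\<xi> \<bullet> vert V)) *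
    (\<Prod>i\<in>V. exp (complex_of_real ((\<xi> \<bullet> \<alpha> V i) * ell i x)))"
proof -
  have "\<xi> \<bullet> x = \<xi> \<bullet> vert V + (\<Sum>i\<in>V. (\<xi> \<bullet> \<alpha> V i) * ell i x)"
    using dot_diff_vert[OF assms, of \<xi> x] by (simp add: inner_diff_right mult.commute)
  then show ?thesis using finite_V[OF assms] by (simp add: exp_add exp_sum)
qed

definition pterm_exp :: "complex \<Rightarrow> (nat \<Rightarrow> complex) \<Rightarrow> real ^ 'n \<Rightarrow> nat set \<Rightarrow> nat \<Rightarrow> real \<Rightarrow> complex" where
  "pterm_exp q w \<xi> V i s = pterm q w \<xi> V i s * exp (complex_of_real ((\<xi> \<bullet> \<alpha> V i) * s))"

lemma psum_exp:
  "psum q w \<xi> x * exp (complex_of_real (\<xi> \<bullet> x)) =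
   (\<Sum>V\<in>VV. exp (complex_of_real (\<xi> \<bullet> vert V)) * (\<Prod>i\<in>V. pterm_exp q w \<xi> V i (ell i x)))"
  unfolding psum_def sum_distrib_right
proof (intro sum.cong refl)
  fix V assume "V \<in> VV"
  from exp_split[OF this, of \<xi> x]
  show "(\<Prod>i\<in>V. pterm q w \<xi> V i (ell i x)) * exp (complex_of_real (\<xi> \<bullet> x)) =
    exp (complex_of_real (\<xi> \<bullet> vert V)) * (\<Prod>i\<in>V. pterm_exp q w \<xi> V i (ell i x))"
    by (simp only: pterm_exp_def prod.distrib mult_ac)
qed

text \<open>For q = w = 1 the polarised decomposition represents the indicator of the polytope.
  Since all the flipped cones decay for the same \<xi>, the vertex terms may be integrated one by
  one.\<close>

theorem exp_integral:
  assumes gen: "generic \<xi>"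
  shows "has_bochner_integral lborel
    (\<lambda>x. indicator {x. \<forall>i\<in>I. ell i x \<ge> 0} x *\<^sub>R exp (complex_of_real (\<xi> \<bullet> x)))
    (\<Sum>V\<in>VV. exp (complex_of_real (\<xi> \<bullet> vert V)) * ((\<Prod>i\<in>V. complex_of_real (- 1 / (\<xi> \<bullet> \<alpha> V i))) / index V))"
proof -
  have "has_bochner_integral lborel (\<lambda>x. \<Prod>i\<in>V. pterm_exp 1 (\<lambda>_. 1) \<xi> V i (ell i x))
     ((\<Prod>i\<in>V. complex_of_real (- 1 / (\<xi> \<bullet> \<alpha> V i))) / index V)" if V: "V \<in> VV" for V
  proof -
    interpret lb: lattice_basis V U "\<alpha> V" e by (rule lattice_basis_vertex[OF V])
    define \<psi> where "\<psi> i s = pterm_exp 1 (\<lambda>_. 1) \<xi> V i (c i + 1 * s)" for i s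
    have \<psi>: "has_bochner_integral lborel (\<psi> i) (complex_of_real (- 1 / (\<xi> \<bullet> \<alpha> V i)))" if "i \<in> V" for i
    proof -
      have "has_bochner_integral lborel (pterm_exp 1 (\<lambda>_. 1) \<xi> V i) (complex_of_real (- 1 / (\<xi> \<bullet> \<alpha> V i)))"
        unfolding pterm_exp_def pterm_def using gen V that
        by (intro step_exp_integral) (auto simp: generic_def)
      then show ?thesis unfolding \<psi>_def
        by (subst (asm) lborel_has_bochner_integral_real_affine_iff[of 1 _ _ "c i"]) auto
    qed
    have "(\<Prod>i\<in>V. pterm_exp 1 (\<lambda>_. 1) \<xi> V i (ell i x)) = (\<Prod>i\<in>V. \<psi> i (x \<bullet> lat (U i)))" for x
      by (simp add: \<psi>_def ell_def add.commute)
    moreover have "card V = CARD('n)" using VV_card[OF V] by simp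
    ultimately show ?thesis
      using lb.integral_pairing_prod[of \<psi>] \<psi> by (simp add: has_bochner_integral_iff)
  qed
  then have "has_bochner_integral lborel (\<lambda>x. psum 1 (\<lambda>_. 1) \<xi> x * exp (complex_of_real (\<xi> \<bullet> x)))
    (\<Sum>V\<in>VV. exp (complex_of_real (\<xi> \<bullet> vert V)) * ((\<Prod>i\<in>V. complex_of_real (- 1 / (\<xi> \<bullet> \<alpha> V i))) / index V))"
    unfolding psum_exp by (intro has_bochner_integral_sum has_bochner_integral_mult_right) auto
  moreover have "psum 1 (\<lambda>_. 1) \<xi> x = complex_of_real (indicator {x. \<forall>i\<in>I. ell i x \<ge> 0} x)" for x
  proof -
    have "psum 1 (\<lambda>_. 1) \<xi> x = (\<Prod>i\<in>I. step_weight 1 1 (ell i x))"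
      using polarised_decomposition[OF gen, of 1 "\<lambda>_. 1" x] by simp
    also have "\<dots> = (\<Prod>i\<in>I. if ell i x \<ge> 0 then 1 else 0)"
      by (intro prod.cong) (auto simp: step_weight_def)
    also have "\<dots> = complex_of_real (indicator {x. \<forall>i\<in>I. ell i x \<ge> 0} x)"
      using finite_I by (auto simp: indicator_def not_le intro!: prod_zero)
    finally show ?thesis .
  qed
  ultimately show ?thesis by (simp only: scaleR_conv_of_real)
qed

text \<open>The discrete analogue of \<open>exp_integral\<close> with general weights: at each
  vertex a product of two-sided geometric series, averaged over the characters of that
  vertex.\<close>

theorem exp_lattice_sum:
  assumes gen: "generic \<xi>" and lattice: "\<And>V. V \<in> VV \<Longrightarrow> vert V \<in> range lat"
  shows "((\<lambda>m. psum q w \<xi> (lat m) * exp (complex_of_real (\<xi> \<bullet> lat m))) has_sum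
    (\<Sum>V\<in>VV. exp (complex_of_real (\<xi> \<bullet> vert V)) *
      ((\<Sum>g\<in>vchars V. \<Prod>i\<in>V. w i + q * (g i * exp (complex_of_real (\<xi> \<bullet> \<alpha> V i))) /
          (1 - g i * exp (complex_of_real (\<xi> \<bullet> \<alpha> V i)))) / index V))) UNIV"
proof -
  have "((\<lambda>m. \<Prod>i\<in>V. pterm_exp q w \<xi> V i (ell i (lat m))) has_sum
     ((\<Sum>g\<in>vchars V. \<Prod>i\<in>V. w i + q * (g i * exp (complex_of_real (\<xi> \<bullet> \<alpha> V i))) /
          (1 - g i * exp (complex_of_real (\<xi> \<bullet> \<alpha> V i)))) / index V)) UNIV" if V: "V \<in> VV" for V
  proof -
    interpret lb: lattice_basis V U "\<alpha> V" e by (rule lattice_basis_vertex[OF V])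
    obtain p where p: "vert V = lat p" using lattice[OF V] by auto
    \<comment> \<open>Since the vertex is a lattice point, translation by it makes the facet
      functionals of V homogeneous, and on M they become the integer pairings.\<close>
    have ell: "ell i (lat (p + m)) = of_int (ipair m (U i))" if "i \<in> V" for m i
      using vert_dot[OF V that] by (simp add: ell_def lat_add p inner_add_left lat_dot)
    let ?z = "\<lambda>g i. g i * exp (complex_of_real (\<xi> \<bullet> \<alpha> V i))"
    have ser: "(\<lambda>k. norm (g i powi k * pterm_exp q w \<xi> V i (of_int k))) summable_on UNIV \<and>
      infsum (\<lambda>k. g i powi k * pterm_exp q w \<xi> V i (of_int k)) UNIV = w i + q * ?z g i / (1 - ?z g i)"
      if g: "g \<in> vchars V" and i: "i \<in> V" for g i
    proof -
      have ng: "norm (g i) = 1" using lb.char_norm g i by blast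
      have b: "\<xi> \<bullet> \<alpha> V i \<noteq> 0" using gen V i by (auto simp: generic_def)
      have nz: "norm (?z g i) = exp (\<xi> \<bullet> \<alpha> V i)" by (simp add: norm_mult ng norm_exp_eq_Re)
      \<comment> \<open>Characters have modulus 1, so the half of the series that converges depends
        on \<xi> alone. The polarisation in \<open>pterm\<close> is therefore the right one for all
        g at once.\<close>
      have lt: "norm (?z g i) < 1 \<longleftrightarrow> \<xi> \<bullet> \<alpha> V i < 0" unfolding nz by simp
      have z: "norm (?z g i) \<noteq> 1" "?z g i \<noteq> 0" using b ng unfolding nz by auto
      have eq: "g i powi k * pterm_exp q w \<xi> V i (of_int k) =
         (step_weight q (w i) (of_int k) - (if norm (?z g i) < 1 then 0 else q)) * ?z g i powi k" for k
      proof -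
        have "exp (complex_of_real (\<xi> \<bullet> \<alpha> V i)) powi k = exp (complex_of_real ((\<xi> \<bullet> \<alpha> V i) * of_int k))"
          by (simp add: exp_power_int mult.commute)
        then show "g i powi k * pterm_exp q w \<xi> V i (of_int k) =
          (step_weight q (w i) (of_int k) - (if norm (?z g i) < 1 then 0 else q)) * ?z g i powi k"
          unfolding lt by (simp add: pterm_exp_def pterm_def power_int_mult_distrib)
      qed
      show ?thesis unfolding eq using step_series[OF z, where q=q and w="w i"] by blast
    qed
    have "((\<lambda>m. \<Prod>i\<in>V. pterm_exp q w \<xi> V i (of_int (ipair m (U i)))) has_sum
       ((\<Sum>g\<in>vchars V. \<Prod>i\<in>V. w i + q * ?z g i / (1 - ?z g i)) / index V)) UNIV"
      using ser by (intro lb.has_sum_pairing) blast+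
    then have "((\<lambda>m. \<Prod>i\<in>V. pterm_exp q w \<xi> V i (ell i (lat (p + m)))) has_sum
       ((\<Sum>g\<in>vchars V. \<Prod>i\<in>V. w i + q * ?z g i / (1 - ?z g i)) / index V)) UNIV"
      by (simp add: ell cong: prod.cong)
    moreover have "bij ((+) p)" by (rule bij_plus)
    ultimately show ?thesis
      using has_sum_reindex_bij_betw[of "(+) p" UNIV UNIV "\<lambda>m. \<Prod>i\<in>V. pterm_exp q w \<xi> V i (ell i (lat m))"] by simp
  qed
  then show ?thesis unfolding psum_exp
    by (intro has_sum_finite_sum finite_VV has_sum_cmult_right) auto
qed

end


section \<open>Power series expansions\<close>

text \<open>The zeros of f - g accumulate at the origin, so its expansion vanishes by the identity
  theorem.\<close>

lemma has_fps_expansion_eq_on_pos: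
  fixes f g :: "complex \<Rightarrow> complex"
  assumes F: "f has_fps_expansion F" and G: "g has_fps_expansion G"
    and eq: "\<And>t::real. t > 0 \<Longrightarrow> f (of_real t) = g (of_real t)"
  shows "F = G"
proof -
  let ?h = "\<lambda>z. f z - g z"
  have "?h has_laurent_expansion fps_to_fls (F - G)"
    by (intro has_laurent_expansion_fps has_fps_expansion_diff F G)
  then have h: "(\<lambda>w. ?h (0 + w)) has_laurent_expansion fps_to_fls (F - G)" by simp
  have "frequently (\<lambda>z. ?h z = 0) (at 0)"
    unfolding frequently_at
  proof (intro allI impI)
    fix d :: real assume "d > 0"
    then show "\<exists>x\<in>UNIV. x \<noteq> 0 \<and> dist x 0 < d \<and> ?h x = 0"
      using eq[of "d/2"] by (intro bexI[of _ "of_real (d/2)"]) auto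
  qed
  then have "fps_to_fls (F - G) = 0"
    using has_laurent_expansion_frequently_zero_iff[OF h] by simp
  then show ?thesis by simp
qed

definition todd_den :: "'a::field \<Rightarrow> 'a fps" where
  "todd_den a = 1 - fps_const a * fps_exp (- 1)"

text \<open>For a = 1 this is the Todd series X / (1 - exp (-X)), a quotient of two series without
  constant term; for other a the denominator is invertible.\<close>

definition todd :: "'a::field \<Rightarrow> 'a fps" where
  "todd a = fps_X / todd_den a"

lemma todd_den_nonzero: "todd_den a \<noteq> 0"
proof
  assume "todd_den a = 0"
  then have "fps_nth (todd_den a) 0 = 0" "fps_nth (todd_den a) 1 = 0" by auto
  then show False by (auto simp: todd_den_def)
qed

lemma todd_times_den: "todd a * todd_den a = fps_X"
proof -
  have "subdegree (todd_den a) \<le> 1"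
  proof (cases "a = 1")
    case True
    then have "fps_nth (todd_den a) 1 \<noteq> 0" by (simp add: todd_den_def)
    then show ?thesis by (rule subdegree_leI)
  next
    case False
    then have "fps_nth (todd_den a) 0 \<noteq> 0" by (simp add: todd_den_def)
    then show ?thesis using subdegree_leI by fastforce
  qed
  then have "todd_den a dvd fps_X"
    using todd_den_nonzero by (subst fps_dvd_iff) auto
  then show ?thesis by (simp add: todd_def)
qed

text \<open>Compare lowest coefficients in \<open>todd a * todd_den a = fps_X\<close>. That the
  coefficient vanishes for a \<noteq> 1 is what later selects the characters of a single
  vertex.\<close>

lemma todd_nth_0: "fps_nth (todd a) 0 = (if a = 1 then 1 else 0)"
proof (cases "a = 1")
  case True
  have "fps_nth (todd a * todd_den a) 1 = 1" by (simp only: todd_times_den fps_X_nth) simp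
  then show ?thesis using True by (simp add: fps_mult_nth todd_den_def)
next
  case False
  have "fps_nth (todd a * todd_den a) 0 = 0" by (simp only: todd_times_den fps_X_nth) simp
  then show ?thesis using False by (simp add: todd_den_def)
qed

text \<open>The factor of the operator, with \<open>q = 1 + y\<close>, and \<open>w = 0\<close> or \<open>w = 1\<close> for an index inside
  or outside \<open>K\<close>.\<close>

definition op_factor :: "'a::field \<Rightarrow> 'a \<Rightarrow> 'a \<Rightarrow> 'a fps" where
  "op_factor q w a = fps_const w * fps_X + fps_const q * (todd a - fps_X)"

text \<open>The series \<open>op_factor q w a\<close> at -b X, multiplied by -1 / b. Here b stands
  for \<open>\<xi> \<bullet> \<alpha> V i\<close>: the exponential of \<xi> at the moving vertex is
  an eigenfunction of the derivative in h i with eigenvalue -b, and -1 / b is the factor of the edge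
  in the integral over the tangent cone.\<close>

definition scaled_factor :: "complex \<Rightarrow> complex \<Rightarrow> complex \<Rightarrow> complex \<Rightarrow> complex fps" where
  "scaled_factor q w a b = Abs_fps (\<lambda>j. - 1 / b * (- b) ^ j * fps_nth (op_factor q w a) j)"

text \<open>The series \<open>todd a\<close> at -b t, times -1 / b, is t / (1 - a exp (b t)).
  Subtracting t turns this into t a exp (b t) / (1 - a exp (b t)), so the operator factor reproduces
  t times the closed form of \<open>step_series\<close> with z = a exp (b t).\<close>

lemma scaled_factor_expansion:
  fixes a b q w :: complex
  assumes "b \<noteq> 0"
  obtains h where "h has_fps_expansion scaled_factor q w a b"
    "\<And>t. t \<noteq> 0 \<Longrightarrow> a * exp (b * t) \<noteq> 1 \<Longrightarrow> h t = t * (w + q * (a * exp (b * t)) / (1 - a * exp (b * t)))"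
proof -
  define G where "G = 1 - fps_const a * fps_exp b"
  define T where "T = fps_const (- 1 / b) * (todd a oo (fps_const (- b) * fps_X))"
  have G_comp: "G = todd_den a oo (fps_const (- b) * fps_X)"
    by (simp add: G_def todd_den_def fps_compose_sub_distrib fps_compose_mult_distrib fps_exp_compose_linear)
  have TG: "T * G = fps_X"
  proof -
    have "(todd a oo (fps_const (- b) * fps_X)) * G = (todd a * todd_den a) oo (fps_const (- b) * fps_X)"
      unfolding G_comp by (subst fps_compose_mult_distrib) auto
    also have "\<dots> = fps_const (- b) * fps_X" by (simp add: todd_times_den)
    finally have "T * G = fps_const (- 1 / b) * (fps_const (- b) * fps_X)" by (simp add: T_def mult.assoc)
    then show ?thesis using assms by (simp add: mult.assoc[symmetric] del: fps_const_neg)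
  qed
  have "G \<noteq> 0" using TG by auto
  have T: "T = fps_X / G" using TG \<open>G \<noteq> 0\<close> by (metis nonzero_mult_div_cancel_right)
  have sub: "subdegree G \<le> subdegree (fps_X :: complex fps)"
  proof -
    have "G dvd fps_X" using TG by (metis dvd_triv_right)
    then show ?thesis using \<open>G \<noteq> 0\<close> by (subst (asm) fps_dvd_iff) auto
  qed
  \<comment> \<open>The value at the removable singularity 0 of x / (1 - a exp (b x)).\<close>
  define c where "c = fps_nth fps_X (subdegree G) / fps_nth G (subdegree G)"
  have "(\<lambda>x. if x = 0 then c else x / (1 - a * exp (b * x))) has_fps_expansion T"
    unfolding T c_def using \<open>G \<noteq> 0\<close> sub
    by (intro has_fps_expansion_divide) (auto simp: G_def intro!: fps_expansion_intros)
  then have e: "(\<lambda>x. w * x + q * ((if x = 0 then c else x / (1 - a * exp (b * x))) - x)) has_fps_expansion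
      fps_const w * fps_X + fps_const q * (T - fps_X)"
    by (intro fps_expansion_intros)
  have sf: "scaled_factor q w a b = fps_const w * fps_X + fps_const q * (T - fps_X)"
  proof (rule fps_ext)
    fix j
    define k where "k = - 1 / b * (- b) ^ j"
    define x where "x = fps_nth (fps_X :: complex fps) j"
    \<comment> \<open>The scaling leaves X unchanged: for j = 1 the factor -1 / b * (-b) is 1, and
      all other coefficients of X vanish.\<close>
    have x: "k * x = x" using assms by (cases "j = 1") (auto simp: k_def x_def)
    have Tj: "fps_nth T j = k * fps_nth (todd a) j" by (simp add: T_def k_def)
    have "fps_nth (scaled_factor q w a b) j = k * (w * x + q * (fps_nth (todd a) j - x))"
      by (simp only: scaled_factor_def op_factor_def k_def x_def fps_nth_Abs_fps fps_add_nth fps_sub_nth fps_mult_left_const_nth)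
    also have "\<dots> = w * (k * x) + q * (k * fps_nth (todd a) j - k * x)" by (simp add: algebra_simps)
    also have "\<dots> = fps_nth (fps_const w * fps_X + fps_const q * (T - fps_X)) j"
      by (simp only: x Tj fps_add_nth fps_sub_nth fps_mult_left_const_nth flip: x_def)
    finally show "fps_nth (scaled_factor q w a b) j = fps_nth (fps_const w * fps_X + fps_const q * (T - fps_X)) j" .
  qed
  have val: "w * t + q * ((if t = 0 then c else t / (1 - a * exp (b * t))) - t) =
      t * (w + q * (a * exp (b * t)) / (1 - a * exp (b * t)))" if "t \<noteq> 0" "a * exp (b * t) \<noteq> 1" for t
  proof -
    have nz: "1 - a * exp (b * t) \<noteq> 0" using that by simp
    have "t / (1 - a * exp (b * t)) - t = t * (a * exp (b * t) / (1 - a * exp (b * t)))"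
      using nz by (simp add: field_simps)
    then show ?thesis using that by (simp add: algebra_simps)
  qed
  show ?thesis using e val unfolding sf[symmetric] by (rule that)
qed

section \<open>Moments and lattice sums as coefficients of power series\<close>

context vertex_system
begin

text \<open>Every linear functional is bounded above by its value at a vertex where no edge
  increases it. The argument uses the vertex data only, so it applies to the shifted polytopes as
  well.\<close>

lemma bounded_polytope: "bounded {x. \<forall>i\<in>I. ell i x \<ge> 0}"
proof -
  have bd: "\<exists>B. \<forall>x. (\<forall>i\<in>I. ell i x \<ge> 0) \<longrightarrow> \<xi> \<bullet> x \<le> B" for \<xi>
  proof -
    obtain V where V: "V \<in> VV" "\<And>i. i \<in> V \<Longrightarrow> \<xi> \<bullet> \<alpha> V i \<le> 0" using exists_max_vert by blast
    have "\<xi> \<bullet> x \<le> \<xi> \<bullet> vert V" if "\<forall>i\<in>I. ell i x \<ge> 0" for x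
    proof -
      have "\<xi> \<bullet> (x - vert V) \<le> 0" unfolding dot_diff_vert[OF V(1)]
        using that V VV_sub by (intro sum_nonpos mult_nonneg_nonpos) auto
      then show ?thesis by (simp add: inner_diff_right)
    qed
    then show ?thesis by blast
  qed
  then obtain B where B: "\<And>\<xi> x. (\<forall>i\<in>I. ell i x \<ge> 0) \<Longrightarrow> \<xi> \<bullet> x \<le> B \<xi>" by metis
  show ?thesis
  proof (rule boundedI)
    fix x assume "x \<in> {x. \<forall>i\<in>I. ell i x \<ge> 0}"
    then have x: "\<forall>i\<in>I. ell i x \<ge> 0" by simp
    have "norm x \<le> (\<Sum>b\<in>Basis. \<bar>x \<bullet> b\<bar>)" by (rule norm_le_l1)
    also have "\<dots> \<le> (\<Sum>b\<in>Basis. \<bar>B b\<bar> + \<bar>B (- b)\<bar>)"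
    proof (rule sum_mono)
      fix b :: 'a
      have "x \<bullet> b \<le> B b" "- (x \<bullet> b) \<le> B (- b)"
        using B[OF x, of b] B[OF x, of "- b"] by (auto simp: inner_commute)
      then show "\<bar>x \<bullet> b\<bar> \<le> \<bar>B b\<bar> + \<bar>B (- b)\<bar>" by linarith
    qed
    finally show "norm x \<le> (\<Sum>b\<in>Basis. \<bar>B b\<bar> + \<bar>B (- b)\<bar>)" .
  qed
qed

lemma generic_scaleR: "generic \<xi> \<Longrightarrow> t \<noteq> 0 \<Longrightarrow> generic (t *\<^sub>R \<xi>)"
  by (auto simp: generic_def)

lemma polytope_borel [measurable]: "{x. \<forall>i\<in>I. ell i x \<ge> 0} \<in> sets borel"
proof -
  have "{x. \<forall>i\<in>I. ell i x \<ge> 0} = (\<Inter>i\<in>I. {x. ell i x \<ge> 0})" by auto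
  moreover have "closed (\<Inter>i\<in>I. {x. ell i x \<ge> 0})"
    unfolding ell_def by (intro closed_INT ballI closed_Collect_le continuous_intros)
  ultimately show ?thesis by simp
qed

end

text \<open>On a bounded set \<xi> is bounded by some B, and the exponential series of B times the
  norm of t dominates the integrands. Summation and integration may thus be exchanged, and the
  coefficients are the moments divided by factorials.\<close>

lemma exp_integral_expansion:
  fixes A :: "'a::euclidean_space set"
  assumes A: "A \<in> sets borel" "bounded A"
  shows "(\<lambda>t. LINT x:A|lborel. exp (t * complex_of_real (\<xi> \<bullet> x))) has_fps_expansion
     Abs_fps (\<lambda>k. (LINT x:A|lborel. complex_of_real ((\<xi> \<bullet> x) ^ k)) / fact k)"
proof (rule has_fps_expansionI, rule always_eventually, rule allI)
  fix t :: complex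
  obtain B0 where B0: "\<And>x. x \<in> A \<Longrightarrow> norm x \<le> B0" using A(2) by (auto simp: bounded_iff)
  define B where "B = norm \<xi> * \<bar>B0\<bar>"
  have B: "\<bar>\<xi> \<bullet> x\<bar> \<le> B" if "x \<in> A" for x
    using Cauchy_Schwarz_ineq2[of \<xi> x] B0[OF that] unfolding B_def
    by (smt (verit) mult_left_mono norm_ge_zero)
  have "B \<ge> 0" by (simp add: B_def)
  have finA: "emeasure lborel A < \<infinity>" using emeasure_bounded_finite[OF A(2)] .
  define f where "f k x = indicator A x *\<^sub>R (complex_of_real ((\<xi> \<bullet> x) ^ k) * t ^ k / fact k)" for k x
  have nf: "norm (f k x) \<le> indicator A x *\<^sub>R ((B * norm t) ^ k / fact k)" for k x
  proof (cases "x \<in> A")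
    case True
    have "\<bar>\<xi> \<bullet> x\<bar> ^ k * norm t ^ k \<le> B ^ k * norm t ^ k"
      using B[OF True] by (intro mult_right_mono power_mono) auto
    then show ?thesis using True
      by (simp add: f_def norm_mult norm_divide norm_power power_mult_distrib divide_right_mono)
  qed (simp add: f_def)
  have meas: "f k \<in> borel_measurable lborel" for k unfolding f_def using A(1) by measurable
  have gint: "integrable lborel (\<lambda>x. indicator A x *\<^sub>R ((B * norm t) ^ k / fact k))" for k
    using finA A(1) by (intro integrable_scaleR_left integrable_real_indicator) auto
  have fint: "integrable lborel (f k)" for k
    by (rule Bochner_Integration.integrable_bound[OF gint meas]) (use nf \<open>B \<ge> 0\<close> in \<open>auto intro: order_trans\<close>)
  have es: "(\<lambda>k. complex_of_real ((\<xi> \<bullet> x) ^ k) * t ^ k / fact k) sums exp (t * complex_of_real (\<xi> \<bullet> x))" for x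
    using exp_converges[of "t * complex_of_real (\<xi> \<bullet> x)"]
    by (simp add: power_mult_distrib scaleR_conv_of_real divide_simps mult.commute)
  have fs: "(\<lambda>k. f k x) sums (indicator A x *\<^sub>R exp (t * complex_of_real (\<xi> \<bullet> x)))" for x
    unfolding f_def by (intro sums_scaleR_right es)
  have sexp: "summable (\<lambda>k. (B * norm t) ^ k / fact k)"
    using summable_exp_generic[of "B * norm t"] by (simp add: scaleR_conv_of_real divide_inverse mult.commute)
  have "(\<lambda>k. integral\<^sup>L lborel (f k)) sums (\<integral>x. (\<Sum>k. f k x) \<partial>lborel)"
  proof (rule sums_integral)
    show "AE x in lborel. summable (\<lambda>k. norm (f k x))"
    proof (rule AE_I2)
      fix x
      have "summable (\<lambda>k. indicator A x *\<^sub>R ((B * norm t) ^ k / fact k))"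
        using sexp by (rule summable_scaleR_right)
      then show "summable (\<lambda>k. norm (f k x))"
        by (rule summable_comparison_test'[where N=0]) (use nf in auto)
    qed
    show "summable (\<lambda>k. \<integral>x. norm (f k x) \<partial>lborel)"
    proof (rule summable_comparison_test'[where N=0])
      show "summable (\<lambda>k. measure lborel A * ((B * norm t) ^ k / fact k))"
        using sexp by (rule summable_mult)
      show "norm (\<integral>x. norm (f k x) \<partial>lborel) \<le> measure lborel A * ((B * norm t) ^ k / fact k)" for k
      proof -
        have "(\<integral>x. norm (f k x) \<partial>lborel) \<le> (\<integral>x. indicator A x *\<^sub>R ((B * norm t) ^ k / fact k) \<partial>lborel)"
          using nf fint gint by (intro integral_mono) auto
        also have "\<dots> = measure lborel A * ((B * norm t) ^ k / fact k)"
          using A(1) finA by simp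
        finally show ?thesis by simp
      qed
    qed
  qed (rule fint)
  also have "(\<lambda>x. \<Sum>k. f k x) = (\<lambda>x. indicator A x *\<^sub>R exp (t * complex_of_real (\<xi> \<bullet> x)))"
    using fs by (auto simp: sums_iff)
  finally have "(\<lambda>k. integral\<^sup>L lborel (f k)) sums (LINT x:A|lborel. exp (t * complex_of_real (\<xi> \<bullet> x)))"
    by (simp add: set_lebesgue_integral_def)
  moreover have "integral\<^sup>L lborel (f k) = (LINT x:A|lborel. complex_of_real ((\<xi> \<bullet> x) ^ k)) / fact k * t ^ k" for k
  proof -
    have "f k = (\<lambda>x. (indicator A x *\<^sub>R complex_of_real ((\<xi> \<bullet> x) ^ k)) * (t ^ k / fact k))"
      by (auto simp: f_def fun_eq_iff scaleR_conv_of_real)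
    then show ?thesis
      by (subst \<open>f k = _\<close>, subst integral_mult_left_zero) (simp add: set_lebesgue_integral_def)
  qed
  ultimately show "(\<lambda>k. fps_nth (Abs_fps (\<lambda>k. (LINT x:A|lborel. complex_of_real ((\<xi> \<bullet> x) ^ k)) / fact k)) k * t ^ k)
     sums (LINT x:A|lborel. exp (t * complex_of_real (\<xi> \<bullet> x)))"
    by simp
qed

context lattice_vertex_system
begin

text \<open>The integral of \<open>exp (\<xi> \<bullet> x)\<close> over the polarised tangent cone
  with its apex moved to 0, including the sign produced by the flips.\<close>

definition vcoeff :: "real ^ 'n \<Rightarrow> nat set \<Rightarrow> complex" where
  "vcoeff \<xi> V = (\<Prod>i\<in>V. complex_of_real (- 1 / (\<xi> \<bullet> \<alpha> V i))) / index V"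

text \<open>Replacing \<xi> by t \<xi> gives every vertex term a pole of order n in t. After
  multiplication by t^n both sides are power series, and the coefficient of t^(k + n) is the k-th
  moment divided by k!.\<close>

theorem power_integral:
  assumes gen: "generic \<xi>"
  shows "(LINT x:{x. \<forall>i\<in>I. ell i x \<ge> 0}|lborel. complex_of_real ((\<xi> \<bullet> x) ^ k)) =
    fact k / fact (k + CARD('n)) * (\<Sum>V\<in>VV. vcoeff \<xi> V * complex_of_real (\<xi> \<bullet> vert V) ^ (k + CARD('n)))"
proof -
  let ?A = "{x. \<forall>i\<in>I. ell i x \<ge> 0}"
  let ?n = "CARD('n)"
  let ?J = "\<lambda>k. LINT x:?A|lborel. complex_of_real ((\<xi> \<bullet> x) ^ k)"
  have "fps_X ^ ?n * Abs_fps (\<lambda>k. ?J k / fact k) =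
      (\<Sum>V\<in>VV. fps_const (vcoeff \<xi> V) * fps_exp (complex_of_real (\<xi> \<bullet> vert V)))"
  proof (rule has_fps_expansion_eq_on_pos)
    show "(\<lambda>t. t ^ ?n * (LINT x:?A|lborel. exp (t * complex_of_real (\<xi> \<bullet> x)))) has_fps_expansion
        fps_X ^ ?n * Abs_fps (\<lambda>k. ?J k / fact k)"
      by (intro fps_expansion_intros exp_integral_expansion polytope_borel bounded_polytope)
    show "(\<lambda>t. \<Sum>V\<in>VV. vcoeff \<xi> V * exp (complex_of_real (\<xi> \<bullet> vert V) * t)) has_fps_expansion
      (\<Sum>V\<in>VV. fps_const (vcoeff \<xi> V) * fps_exp (complex_of_real (\<xi> \<bullet> vert V)))"
      by (intro fps_expansion_intros)
    fix t :: real assume t: "t > 0"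
    have "(LINT x:?A|lborel. exp (complex_of_real t * complex_of_real (\<xi> \<bullet> x))) =
      (\<Sum>V\<in>VV. exp (complex_of_real (t * (\<xi> \<bullet> vert V))) * ((\<Prod>i\<in>V. complex_of_real (- 1 / (t * (\<xi> \<bullet> \<alpha> V i)))) / index V))"
      using exp_integral[OF generic_scaleR[OF gen, of t]] t
      by (simp add: has_bochner_integral_iff set_lebesgue_integral_def)
    also have "complex_of_real t ^ ?n * \<dots> = (\<Sum>V\<in>VV. vcoeff \<xi> V * exp (complex_of_real (\<xi> \<bullet> vert V) * complex_of_real t))"
      unfolding sum_distrib_left
    proof (rule sum.cong[OF refl])
      fix V assume V: "V \<in> VV"
      have "complex_of_real t ^ ?n * (\<Prod>i\<in>V. complex_of_real (- 1 / (t * (\<xi> \<bullet> \<alpha> V i)))) =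
         (\<Prod>i\<in>V. complex_of_real t * complex_of_real (- 1 / (t * (\<xi> \<bullet> \<alpha> V i))))"
        using VV_card[OF V] by (simp only: prod.distrib prod_constant) simp
      also have "\<dots> = (\<Prod>i\<in>V. complex_of_real (- 1 / (\<xi> \<bullet> \<alpha> V i)))"
        using t by (intro prod.cong refl) simp
      finally have vcoeff_eq: "complex_of_real t ^ ?n * (\<Prod>i\<in>V. complex_of_real (- 1 / (t * (\<xi> \<bullet> \<alpha> V i)))) / index V = vcoeff \<xi> V"
        by (simp only: vcoeff_def)
      then show "complex_of_real t ^ ?n * (exp (complex_of_real (t * (\<xi> \<bullet> vert V))) *
         ((\<Prod>i\<in>V. complex_of_real (- 1 / (t * (\<xi> \<bullet> \<alpha> V i)))) / index V)) =
        vcoeff \<xi> V * exp (complex_of_real (\<xi> \<bullet> vert V) * complex_of_real t)"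
        by (simp only: of_real_mult times_divide_eq_right times_divide_eq_left mult_ac flip: vcoeff_eq)
    qed
    finally show "complex_of_real t ^ ?n * (LINT x:?A|lborel. exp (complex_of_real t * complex_of_real (\<xi> \<bullet> x))) =
      (\<Sum>V\<in>VV. vcoeff \<xi> V * exp (complex_of_real (\<xi> \<bullet> vert V) * complex_of_real t))" .
  qed
  then have "fps_nth (fps_X ^ ?n * Abs_fps (\<lambda>k. ?J k / fact k)) (k + ?n) =
     fps_nth (\<Sum>V\<in>VV. fps_const (vcoeff \<xi> V) * fps_exp (complex_of_real (\<xi> \<bullet> vert V))) (k + ?n)"
    by simp
  then have "?J k / fact k = (\<Sum>V\<in>VV. vcoeff \<xi> V * complex_of_real (\<xi> \<bullet> vert V) ^ (k + ?n)) / fact (k + ?n)"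
    by (simp add: fps_X_power_mult_nth fps_sum_nth sum_divide_distrib del: of_real_power)
  then show ?thesis by (simp add: field_simps del: of_real_power)
qed

text \<open>The quotient is the value of \<open>psum\<close> at a lattice point when q is nonzero,
  whatever generic \<xi> is used.\<close>

definition weight :: "complex \<Rightarrow> (nat \<Rightarrow> complex) \<Rightarrow> int ^ 'n \<Rightarrow> complex" where
  "weight q w m = (\<Prod>i\<in>I. step_weight q (w i) (ell i (lat m))) / q ^ (card I - CARD('n))"

lemma finite_lattice_points: "finite {m. \<forall>i\<in>I. ell i (lat m) \<ge> 0}"
proof -
  obtain B where B: "\<And>x. \<forall>i\<in>I. ell i x \<ge> 0 \<Longrightarrow> norm x \<le> B"
    using bounded_polytope by (auto simp: bounded_iff)
  have "{m. \<forall>i\<in>I. ell i (lat m) \<ge> 0} \<subseteq> vec_nth -` (PiE UNIV (\<lambda>_. {- \<lceil>B\<rceil> .. \<lceil>B\<rceil>}))"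
  proof
    fix m assume "m \<in> {m. \<forall>i\<in>I. ell i (lat m) \<ge> 0}"
    then have "\<bar>lat m $ j\<bar> \<le> B" for j using B[of "lat m"] component_le_norm_cart order_trans by blast
    then have "\<bar>real_of_int (m $ j)\<bar> \<le> B" for j by (simp add: lat_def)
    then have "- \<lceil>B\<rceil> \<le> m $ j \<and> m $ j \<le> \<lceil>B\<rceil>" for j
    proof -
      have "\<bar>real_of_int (m $ j)\<bar> \<le> of_int \<lceil>B\<rceil>"
        using \<open>\<And>j. \<bar>real_of_int (m $ j)\<bar> \<le> B\<close>[of j] le_of_int_ceiling[of B] by linarith
      then show ?thesis by linarith
    qed
    then show "m \<in> vec_nth -` (PiE UNIV (\<lambda>_. {- \<lceil>B\<rceil> .. \<lceil>B\<rceil>}))" by (auto simp: PiE_def extensional_def)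
  qed
  moreover have "finite (vec_nth -` (PiE UNIV (\<lambda>_. {- \<lceil>B\<rceil> .. \<lceil>B\<rceil>})) :: (int^'n) set)"
    by (intro finite_vimageI finite_PiE) (auto simp: inj_def vec_nth_inject)
  ultimately show ?thesis by (rule finite_subset)
qed

text \<open>The factor t^n is distributed over the n edges of each vertex, where it cancels the
  simple poles of the geometric series; each product is then a \<open>scaled_factor\<close>.\<close>

theorem lattice_sum_expansion:
  assumes gen: "generic \<xi>" and lattice: "\<And>V. V \<in> VV \<Longrightarrow> vert V \<in> range lat" and q: "q \<noteq> 0"
  shows "fps_X ^ CARD('n) * (\<Sum>m | \<forall>i\<in>I. ell i (lat m) \<ge> 0. fps_const (weight q w m) * fps_exp (complex_of_real (\<xi> \<bullet> lat m))) =
    (\<Sum>V\<in>VV. fps_exp (complex_of_real (\<xi> \<bullet> vert V)) * (fps_const (1 / index V) *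
      (\<Sum>g\<in>vchars V. \<Prod>i\<in>V. scaled_factor q (w i) (g i) (complex_of_real (\<xi> \<bullet> \<alpha> V i)))))"
proof -
  let ?n = "CARD('n)"
  let ?b = "\<lambda>V i. complex_of_real (\<xi> \<bullet> \<alpha> V i)"
  let ?M = "{m. \<forall>i\<in>I. ell i (lat m) \<ge> 0}"
  \<comment> \<open>One analytic function for each vertex, character and edge, with the given
    expansion and with the geometric closed form away from the poles.\<close>
  have "\<exists>h. \<forall>V g i. V \<in> VV \<longrightarrow> i \<in> V \<longrightarrow> h V g i has_fps_expansion scaled_factor q (w i) (g i) (?b V i) \<and>
    (\<forall>t. t \<noteq> 0 \<longrightarrow> g i * exp (?b V i * t) \<noteq> 1 \<longrightarrow>
      h V g i t = t * (w i + q * (g i * exp (?b V i * t)) / (1 - g i * exp (?b V i * t))))"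
  proof (intro choice allI)
    fix V g i
    show "\<exists>h. V \<in> VV \<longrightarrow> i \<in> V \<longrightarrow> h has_fps_expansion scaled_factor q (w i) (g i) (?b V i) \<and>
    (\<forall>t. t \<noteq> 0 \<longrightarrow> g i * exp (?b V i * t) \<noteq> 1 \<longrightarrow>
      h t = t * (w i + q * (g i * exp (?b V i * t)) / (1 - g i * exp (?b V i * t))))"
    proof (cases "V \<in> VV \<and> i \<in> V")
      case True
      then have "?b V i \<noteq> 0" using gen by (auto simp: generic_def)
      then show ?thesis using scaled_factor_expansion by metis
    qed auto
  qed
  then obtain h where hh: "\<forall>V g i. V \<in> VV \<longrightarrow> i \<in> V \<longrightarrow> h V g i has_fps_expansion scaled_factor q (w i) (g i) (?b V i) \<and>
    (\<forall>t. t \<noteq> 0 \<longrightarrow> g i * exp (?b V i * t) \<noteq> 1 \<longrightarrow>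
      h V g i t = t * (w i + q * (g i * exp (?b V i * t)) / (1 - g i * exp (?b V i * t))))"
    by (rule exE)
  have h: "\<And>V g i. V \<in> VV \<Longrightarrow> i \<in> V \<Longrightarrow> h V g i has_fps_expansion scaled_factor q (w i) (g i) (?b V i)"
    "\<And>V g i t. V \<in> VV \<Longrightarrow> i \<in> V \<Longrightarrow> t \<noteq> 0 \<Longrightarrow> g i * exp (?b V i * t) \<noteq> 1 \<Longrightarrow>
      h V g i t = t * (w i + q * (g i * exp (?b V i * t)) / (1 - g i * exp (?b V i * t)))"
    using hh by blast+
  show ?thesis
  proof (rule has_fps_expansion_eq_on_pos)
    show "(\<lambda>t. t ^ ?n * (\<Sum>m\<in>?M. weight q w m * exp (complex_of_real (\<xi> \<bullet> lat m) * t))) has_fps_expansion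
      fps_X ^ ?n * (\<Sum>m\<in>?M. fps_const (weight q w m) * fps_exp (complex_of_real (\<xi> \<bullet> lat m)))"
      by (intro fps_expansion_intros)
    show "(\<lambda>t. \<Sum>V\<in>VV. exp (complex_of_real (\<xi> \<bullet> vert V) * t) * (1 / index V * (\<Sum>g\<in>vchars V. \<Prod>i\<in>V. h V g i t))) has_fps_expansion
      (\<Sum>V\<in>VV. fps_exp (complex_of_real (\<xi> \<bullet> vert V)) * (fps_const (1 / index V) *
      (\<Sum>g\<in>vchars V. \<Prod>i\<in>V. scaled_factor q (w i) (g i) (?b V i))))"
      by (intro fps_expansion_intros h)
    fix t :: real assume t: "t > 0"
    have gt: "generic (t *\<^sub>R \<xi>)" using generic_scaleR[OF gen] t by simp
    let ?e = "\<lambda>m. exp (complex_of_real (\<xi> \<bullet> lat m) * complex_of_real t)"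
    have ps: "psum q w (t *\<^sub>R \<xi>) (lat m) = weight q w m" for m
      using polarised_decomposition[OF gt, of q w "lat m"] q by (simp add: weight_def)
    have "((\<lambda>m. psum q w (t *\<^sub>R \<xi>) (lat m) * exp (complex_of_real ((t *\<^sub>R \<xi>) \<bullet> lat m))) has_sum
        (\<Sum>m\<in>?M. weight q w m * ?e m)) UNIV"
    proof (rule has_sum_finite_neutralI[OF finite_lattice_points])
      show "psum q w (t *\<^sub>R \<xi>) (lat m) * exp (complex_of_real ((t *\<^sub>R \<xi>) \<bullet> lat m)) = 0" if m: "m \<in> UNIV - ?M" for m
      proof -
        obtain i where "i \<in> I" "ell i (lat m) < 0" using m by (auto simp: not_le)
        then have "weight q w m = 0" unfolding weight_def using finite_I
          by (auto simp: step_weight_def intro!: prod_zero bexI[of _ i])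
        then show ?thesis by (simp add: ps)
      qed
    qed (auto simp: ps mult_ac)
    define R where "R = (\<Sum>V\<in>VV. exp (complex_of_real (t * (\<xi> \<bullet> vert V))) *
      ((\<Sum>g\<in>vchars V. \<Prod>i\<in>V. w i + q * (g i * exp (?b V i * t)) / (1 - g i * exp (?b V i * t))) / index V))"
    from has_sum_unique[OF \<open>(_ has_sum _) _\<close> exp_lattice_sum[OF gt lattice]]
    have sum_R: "(\<Sum>m\<in>?M. weight q w m * ?e m) = R" unfolding R_def
      by (simp add: mult_ac)
    have "complex_of_real t ^ ?n * R = (\<Sum>V\<in>VV. exp (complex_of_real (\<xi> \<bullet> vert V) * complex_of_real t) *
        (1 / index V * (\<Sum>g\<in>vchars V. \<Prod>i\<in>V. h V g i (complex_of_real t))))"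
      unfolding R_def
    proof (subst sum_distrib_left, rule sum.cong[OF refl])
      fix V assume V: "V \<in> VV"
      interpret lb: lattice_basis V U "\<alpha> V" e by (rule lattice_basis_vertex[OF V])
      have "(\<Sum>g\<in>vchars V. \<Prod>i\<in>V. h V g i (complex_of_real t)) = (\<Sum>g\<in>vchars V. complex_of_real t ^ ?n *
          (\<Prod>i\<in>V. w i + q * (g i * exp (?b V i * t)) / (1 - g i * exp (?b V i * t))))"
      proof (rule sum.cong[OF refl])
        fix g assume g: "g \<in> vchars V"
        have "h V g i (complex_of_real t) = complex_of_real t * (w i + q * (g i * exp (?b V i * t)) / (1 - g i * exp (?b V i * t)))"
          if i: "i \<in> V" for i
        proof (rule h(2)[OF V i])
          \<comment> \<open>The modulus of g i exp (b t) is that of exp (b t), which is not 1 for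
            real b t \<noteq> 0. Hence positive t never hits a pole.\<close>
          have "norm (g i) = 1" using lb.char_norm g i by blast
          moreover have "t * (\<xi> \<bullet> \<alpha> V i) \<noteq> 0" using gen V i t by (auto simp: generic_def)
          ultimately have "norm (g i * exp (?b V i * t)) \<noteq> 1"
            by (simp add: norm_mult mult.commute)
          then show "g i * exp (?b V i * t) \<noteq> 1" by auto
        qed (use t in auto)
        then show "(\<Prod>i\<in>V. h V g i (complex_of_real t)) = complex_of_real t ^ ?n *
          (\<Prod>i\<in>V. w i + q * (g i * exp (?b V i * t)) / (1 - g i * exp (?b V i * t)))"
          using VV_card[OF V] by (simp add: prod.distrib)
      qed
      then have "(\<Sum>g\<in>vchars V. \<Prod>i\<in>V. h V g i (complex_of_real t)) = complex_of_real t ^ ?n * (\<Sum>g\<in>vchars V.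
          (\<Prod>i\<in>V. w i + q * (g i * exp (?b V i * t)) / (1 - g i * exp (?b V i * t))))"
        by (simp only: sum_distrib_left)
      then show "complex_of_real t ^ ?n * (exp (complex_of_real (t * (\<xi> \<bullet> vert V))) *
         ((\<Sum>g\<in>vchars V. \<Prod>i\<in>V. w i + q * (g i * exp (?b V i * t)) / (1 - g i * exp (?b V i * t))) / index V)) =
        exp (complex_of_real (\<xi> \<bullet> vert V) * complex_of_real t) *
        (1 / index V * (\<Sum>g\<in>vchars V. \<Prod>i\<in>V. h V g i (complex_of_real t)))"
        by (simp only: mult_ac of_real_mult divide_inverse mult_1_left)
    qed
    then show "complex_of_real t ^ ?n * (\<Sum>m\<in>?M. weight q w m * ?e m) =
      (\<Sum>V\<in>VV. exp (complex_of_real (\<xi> \<bullet> vert V) * complex_of_real t) *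
        (1 / index V * (\<Sum>g\<in>vchars V. \<Prod>i\<in>V. h V g i (complex_of_real t))))" by (simp only: sum_R)
  qed
qed

end


section \<open>The operator\<close>

text \<open>Multi-indices of total degree above d contribute 0, so the box bound D is free to exceed
  d. This lets different powers be expanded over one common index set.\<close>

lemma fps_prod_coeff:
  fixes H :: "'a::comm_ring_1 fps"
  assumes "finite V" "d \<le> D"
  shows "fps_nth (H * (\<Prod>i\<in>V. F i)) d =
    (\<Sum>\<beta>\<in>PiE V (\<lambda>_. {..D}). (if sum \<beta> V \<le> d then fps_nth H (d - sum \<beta> V) else 0) * (\<Prod>i\<in>V. fps_nth (F i) (\<beta> i)))"
  using assms(1)
proof (induction V arbitrary: H rule: finite_induct)
  case empty
  then show ?case by simp
next
  case (insert k V)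
  let ?P = "PiE V (\<lambda>_. {..D})"
  define S where "S \<beta> = sum \<beta> V" for \<beta> :: "'b \<Rightarrow> nat"
  have coeff: "(if S \<beta> \<le> d then fps_nth (H * F k) (d - S \<beta>) else 0) =
      (\<Sum>j\<le>D. if S \<beta> + j \<le> d then fps_nth H (d - (S \<beta> + j)) * fps_nth (F k) j else 0)" for \<beta>
  proof (cases "S \<beta> \<le> d")
    case True
    let ?e = "d - S \<beta>"
    have "fps_nth (H * F k) ?e = fps_nth (F k * H) ?e" by (simp add: mult.commute)
    also have "\<dots> = (\<Sum>j\<in>{0..?e}. fps_nth (F k) j * fps_nth H (?e - j))" by (simp add: fps_mult_nth)
    also have "\<dots> = (\<Sum>j\<in>{..?e}. fps_nth H (d - (S \<beta> + j)) * fps_nth (F k) j)"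
      by (intro sum.cong) (auto simp: mult.commute atLeast0AtMost)
    also have "{..?e} = {j\<in>{..D}. S \<beta> + j \<le> d}" using True \<open>d \<le> D\<close> by auto
    finally show ?thesis using True by (subst (asm) sum.inter_filter) auto
  qed (auto intro!: sum.neutral[symmetric])
  have PiE_ins: "PiE (insert k V) (\<lambda>_. {..D}) = (\<lambda>(j, \<beta>). \<beta>(k := j)) ` ({..D} \<times> ?P)"
    by (simp add: PiE_insert_eq)
  have inj: "inj_on (\<lambda>(j, \<beta>). \<beta>(k := j)) ({..D} \<times> ?P)"
    using insert.hyps by (intro inj_combinator)
  have "fps_nth (H * (\<Prod>i\<in>insert k V. F i)) d = fps_nth ((H * F k) * (\<Prod>i\<in>V. F i)) d"
    using insert.hyps by (simp add: mult.assoc)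
  also have "\<dots> = (\<Sum>\<beta>\<in>?P. (\<Sum>j\<le>D. if S \<beta> + j \<le> d then fps_nth H (d - (S \<beta> + j)) * fps_nth (F k) j else 0) *
      (\<Prod>i\<in>V. fps_nth (F i) (\<beta> i)))"
    unfolding insert.IH S_def[symmetric] coeff ..
  also have "\<dots> = (\<Sum>\<beta>\<in>?P. \<Sum>j\<le>D. (if S \<beta> + j \<le> d then fps_nth H (d - (S \<beta> + j)) else 0) *
      (fps_nth (F k) j * (\<Prod>i\<in>V. fps_nth (F i) (\<beta> i))))"
    unfolding sum_distrib_right by (intro sum.cong refl) (auto simp: mult.assoc)
  also have "\<dots> = (\<Sum>(j, \<beta>)\<in>{..D} \<times> ?P. (if S \<beta> + j \<le> d then fps_nth H (d - (S \<beta> + j)) else 0) *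
      (fps_nth (F k) j * (\<Prod>i\<in>V. fps_nth (F i) (\<beta> i))))"
    by (subst sum.swap) (simp add: sum.cartesian_product)
  also have "\<dots> = (\<Sum>(j, \<beta>)\<in>{..D} \<times> ?P. (if sum (\<beta>(k := j)) (insert k V) \<le> d then fps_nth H (d - sum (\<beta>(k := j)) (insert k V)) else 0) *
      (\<Prod>i\<in>insert k V. fps_nth (F i) ((\<beta>(k := j)) i)))"
  proof (intro sum.cong refl, clarsimp simp only: split_paired_all prod.case)
    fix j \<beta>
    have "sum (\<beta>(k := j)) V = S \<beta>" "(\<Prod>i\<in>V. fps_nth (F i) ((\<beta>(k := j)) i)) = (\<Prod>i\<in>V. fps_nth (F i) (\<beta> i))"
      using insert.hyps unfolding S_def by (auto intro!: sum.cong prod.cong)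
    then show "(if S \<beta> + j \<le> d then fps_nth H (d - (S \<beta> + j)) else 0) * (fps_nth (F k) j * (\<Prod>i\<in>V. fps_nth (F i) (\<beta> i))) =
      (if sum (\<beta>(k := j)) (insert k V) \<le> d then fps_nth H (d - sum (\<beta>(k := j)) (insert k V)) else 0) *
      (\<Prod>i\<in>insert k V. fps_nth (F i) ((\<beta>(k := j)) i))"
      using insert.hyps by (simp add: add.commute)
  qed
  also have "\<dots> = (\<Sum>\<beta>\<in>PiE (insert k V) (\<lambda>_. {..D}). (if sum \<beta> (insert k V) \<le> d then fps_nth H (d - sum \<beta> (insert k V)) else 0) *
      (\<Prod>i\<in>insert k V. fps_nth (F i) (\<beta> i)))"
    unfolding PiE_ins sum.reindex[OF inj] by (simp add: case_prod_unfold)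
  finally show ?case .
qed

section \<open>Derivatives of sums of powers of affine functions\<close>

definition aff_pow :: "nat \<Rightarrow> ('s \<Rightarrow> complex) \<Rightarrow> ('s \<Rightarrow> complex) \<Rightarrow> ('s \<Rightarrow> nat \<Rightarrow> complex) \<Rightarrow>
    ('s \<Rightarrow> nat) \<Rightarrow> 's set \<Rightarrow> (nat \<Rightarrow> real) \<Rightarrow> complex" where
  "aff_pow r C A B d S h = (\<Sum>s\<in>S. C s * (A s + (\<Sum>i\<in>{1..r}. B s i * complex_of_real (h i))) ^ d s)"

text \<open>The condition is open in each coordinate separately and does not mention coordinates
  outside {1..r}, as needed for differentiating along h(i := t) and for functions whose closed form
  is known near 0 only.\<close>

definition near0 :: "nat \<Rightarrow> real \<Rightarrow> (nat \<Rightarrow> real) set" where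
  "near0 r \<epsilon> = {h. \<forall>i\<in>{1..r}. \<bar>h i\<bar> < \<epsilon>}"

text \<open>The derivative has the same shape on the same neighbourhood, so the rule can be iterated
  although J is known only near 0.\<close>

lemma partial_deriv_aff_pow:
  assumes J: "\<And>h. h \<in> near0 r \<epsilon> \<Longrightarrow> J h = aff_pow r C A B d S h"
    and i: "i \<in> {1..r}" and h: "h \<in> near0 r \<epsilon>"
  shows "partial_deriv i J h = aff_pow r (\<lambda>s. C s * of_nat (d s) * B s i) A B (\<lambda>s. d s - 1) S h"
proof -
  define L where "L s = A s + (\<Sum>j\<in>{1..r}-{i}. B s j * complex_of_real (h j))" for s
  have aff: "A s + (\<Sum>j\<in>{1..r}. B s j * complex_of_real ((h(i := t)) j)) = L s + B s i * complex_of_real t" for s t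
  proof -
    have "(\<Sum>j\<in>{1..r}. B s j * complex_of_real ((h(i := t)) j)) =
        B s i * complex_of_real t + (\<Sum>j\<in>{1..r}-{i}. B s j * complex_of_real ((h(i := t)) j))"
      using i by (subst sum.remove[of _ i]) auto
    also have "(\<Sum>j\<in>{1..r}-{i}. B s j * complex_of_real ((h(i := t)) j)) = (\<Sum>j\<in>{1..r}-{i}. B s j * complex_of_real (h j))"
      by (intro sum.cong) auto
    finally show ?thesis by (simp add: L_def)
  qed
  define p where "p z = (\<Sum>s\<in>S. C s * (L s + B s i * z) ^ d s)" for z
  have "(p has_field_derivative (\<Sum>s\<in>S. C s * of_nat (d s) * B s i * (L s + B s i * z) ^ (d s - 1))) (at z)" for z
    unfolding p_def by (intro DERIV_sum) (auto intro!: derivative_eq_intros)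
  then have dv: "((\<lambda>t. p (complex_of_real t)) has_vector_derivative
      (\<Sum>s\<in>S. C s * of_nat (d s) * B s i * (L s + B s i * complex_of_real (h i)) ^ (d s - 1))) (at (h i))"
    by (rule has_vector_derivative_real_field)
  have eq: "p (complex_of_real t) = J (h(i := t))" if "t \<in> {-\<epsilon><..<\<epsilon>}" for t
  proof -
    have "h(i := t) \<in> near0 r \<epsilon>" using h that by (auto simp: near0_def)
    then have "J (h(i := t)) = aff_pow r C A B d S (h(i := t))" by (rule J)
    then show ?thesis by (simp only: aff_pow_def aff p_def)
  qed
  have hi: "h i \<in> {-\<epsilon><..<\<epsilon>}"
  proof -
    have "\<bar>h i\<bar> < \<epsilon>" using h i by (auto simp: near0_def)
    then show ?thesis by auto
  qed
  have "((\<lambda>t. J (h(i := t))) has_vector_derivative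
      (\<Sum>s\<in>S. C s * of_nat (d s) * B s i * (L s + B s i * complex_of_real (h i)) ^ (d s - 1))) (at (h i))"
    by (rule has_vector_derivative_transform_within_open[OF dv open_greaterThanLessThan hi eq])
  then have "partial_deriv i J h = (\<Sum>s\<in>S. C s * of_nat (d s) * B s i * (L s + B s i * complex_of_real (h i)) ^ (d s - 1))"
    unfolding partial_deriv_def by (rule vector_derivative_at)
  then show ?thesis using aff[of _ "h i"] by (simp add: aff_pow_def)
qed

text \<open>The falling factorial. Truncated subtraction produces a factor 0 as soon as a exceeds d,
  in accordance with the vanishing of higher derivatives.\<close>

definition ffact :: "nat \<Rightarrow> nat \<Rightarrow> complex" where
  "ffact d a = (\<Prod>j<a. of_nat (d - j))"

lemma ffact_fact: "ffact d a * (if a \<le> d then fact (d - a) else 1) = (if a \<le> d then fact d else 0)"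
proof (cases "a \<le> d")
  case True
  then have "ffact d a * fact (d - a) = fact d"
  proof (induction a)
    case (Suc a)
    then have "d - a = Suc (d - Suc a)" by simp
    then have "(fact (d - a) :: complex) = of_nat (d - a) * fact (d - Suc a)" by (metis fact_Suc)
    with Suc show ?case by (simp add: ffact_def mult_ac)
  qed (simp add: ffact_def)
  then show ?thesis using True by simp
next
  case False
  then have "ffact d a = 0" unfolding ffact_def by (intro prod_zero) (auto intro!: bexI[of _ d])
  then show ?thesis using False by simp
qed

lemma ffact_eq: "ffact d a = (if a \<le> d then fact d / fact (d - a) else 0)"
  using ffact_fact[of d a] by (auto simp: field_simps split: if_splits)

lemma partial_deriv_power_aff_pow:
  assumes J: "\<And>h. h \<in> near0 r \<epsilon> \<Longrightarrow> J h = aff_pow r C A B d S h" and i: "i \<in> {1..r}"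
  shows "h \<in> near0 r \<epsilon> \<Longrightarrow> (partial_deriv i ^^ k) J h = aff_pow r (\<lambda>s. C s * ffact (d s) k * B s i ^ k) A B (\<lambda>s. d s - k) S h"
proof (induction k arbitrary: h)
  case 0
  then show ?case using J by (simp add: ffact_def)
next
  case (Suc k)
  have "(partial_deriv i ^^ Suc k) J h = partial_deriv i ((partial_deriv i ^^ k) J) h" by simp
  also have "\<dots> = aff_pow r (\<lambda>s. C s * ffact (d s) k * B s i ^ k * of_nat (d s - k) * B s i) A B (\<lambda>s. d s - k - 1) S h"
    by (rule partial_deriv_aff_pow[OF Suc.IH i Suc.prems])
  finally show ?case by (simp add: ffact_def mult_ac)
qed

lemma ffact_add: "ffact d (a + b) = ffact d a * ffact (d - a) b"
  by (induction b) (auto simp: ffact_def mult_ac)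

lemma foldr_partial_deriv_aff_pow:
  assumes J: "\<And>h. h \<in> near0 r \<epsilon> \<Longrightarrow> J h = aff_pow r C A B d S h"
    and xs: "set xs \<subseteq> {1..r}" "distinct xs"
  shows "h \<in> near0 r \<epsilon> \<Longrightarrow> foldr (\<lambda>i. partial_deriv i ^^ \<beta> i) xs J h =
    aff_pow r (\<lambda>s. C s * ffact (d s) (sum \<beta> (set xs)) * (\<Prod>i\<in>set xs. B s i ^ \<beta> i)) A B (\<lambda>s. d s - sum \<beta> (set xs)) S h"
  using xs
proof (induction xs arbitrary: h)
  case Nil
  then show ?case using J by (simp add: ffact_def)
next
  case (Cons i xs)
  have "foldr (\<lambda>i. partial_deriv i ^^ \<beta> i) (i # xs) J h = (partial_deriv i ^^ \<beta> i) (foldr (\<lambda>i. partial_deriv i ^^ \<beta> i) xs J) h"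
    by simp
  also have "\<dots> = aff_pow r (\<lambda>s. C s * ffact (d s) (sum \<beta> (set xs)) * (\<Prod>i\<in>set xs. B s i ^ \<beta> i) *
      ffact (d s - sum \<beta> (set xs)) (\<beta> i) * B s i ^ \<beta> i) A B (\<lambda>s. d s - sum \<beta> (set xs) - \<beta> i) S h"
    using Cons by (intro partial_deriv_power_aff_pow[OF Cons.IH]) auto
  also have "\<dots> = aff_pow r (\<lambda>s. C s * ffact (d s) (sum \<beta> (set (i # xs))) * (\<Prod>i\<in>set (i # xs). B s i ^ \<beta> i)) A B (\<lambda>s. d s - sum \<beta> (set (i # xs))) S h"
    using Cons.prems(3) by (simp add: add.commute[of "\<beta> i"] ffact_add mult_ac diff_diff_add)
  finally show ?case .
qed

lemma mixed_partial_aff_pow: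
  assumes J: "\<And>h. h \<in> near0 r \<epsilon> \<Longrightarrow> J h = aff_pow r C A B d S h" and "\<epsilon> > 0"
  shows "mixed_partial r \<beta> J (\<lambda>_. 0) =
    (\<Sum>s\<in>S. C s * ffact (d s) (sum \<beta> {1..r}) * (\<Prod>i\<in>{1..r}. B s i ^ \<beta> i) * A s ^ (d s - sum \<beta> {1..r}))"
proof -
  have s: "set [1..<Suc r] = {1..r}" by auto
  have "mixed_partial r \<beta> J (\<lambda>_. 0) =
    aff_pow r (\<lambda>s. C s * ffact (d s) (sum \<beta> {1..r}) * (\<Prod>i\<in>{1..r}. B s i ^ \<beta> i)) A B (\<lambda>s. d s - sum \<beta> {1..r}) S (\<lambda>_. 0)"
    unfolding mixed_partial_def using foldr_partial_deriv_aff_pow[OF J, where xs="[1..<Suc r]" and h="\<lambda>_. 0" and \<beta>=\<beta>] \<open>\<epsilon> > 0\<close>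
    unfolding s by (simp add: near0_def)
  then show ?thesis by (simp add: aff_pow_def)
qed

section \<open>The operator with coefficients in the field of rational functions\<close>

lemma scal_0 [simp]: "scal 0 = 0" by (simp add: scal_def)
lemma scal_1 [simp]: "scal 1 = 1" by (simp add: scal_def one_pCons[symmetric])
lemma scal_add: "scal (x + y) = scal x + scal y" by (simp add: scal_def flip: to_fract_add)
lemma scal_mult: "scal (x * y) = scal x * scal y" by (simp add: scal_def flip: to_fract_mult)
lemma scal_uminus: "scal (- x) = - scal x" by (simp add: scal_def flip: to_fract_uminus)
lemma scal_diff: "scal (x - y) = scal x - scal y" by (simp add: scal_def flip: to_fract_diff)
lemma scal_sum: "scal (sum f A) = (\<Sum>x\<in>A. scal (f x))"
  by (induction A rule: infinite_finite_induct) (auto simp: scal_add)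
lemma scal_of_nat: "scal (of_nat n) = of_nat n" by (induction n) (auto simp: scal_add)
lemma scal_inverse: "scal (inverse x) = inverse (scal x)"
  by (cases "x = 0") (auto simp: scal_mult[symmetric] intro!: inverse_unique[symmetric])
lemma scal_divide: "scal (x / y) = scal x / scal y"
  by (simp add: divide_inverse scal_mult scal_inverse)
lemma scal_power: "scal (x ^ n) = scal x ^ n" by (induction n) (auto simp: scal_mult)

lemma to_fract_power: "to_fract (p ^ n) = to_fract p ^ n"
  by (induction n) auto
lemma to_fract_prod: "to_fract (prod f A) = (\<Prod>x\<in>A. to_fract (f x))"
  by (induction A rule: infinite_finite_induct) auto

text \<open>A nonzero derivative forces the total order to be at most some d s, hence at most D. The
  index set of \<open>apply_at_zero\<close> therefore lies in a finite box, and the additional terms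
  there are zero.\<close>

lemma apply_at_zero_aff_pow:
  assumes J: "\<And>h. h \<in> near0 r \<epsilon> \<Longrightarrow> J h = aff_pow r C A B d S h" and "\<epsilon> > 0"
    and D: "\<And>s. s \<in> S \<Longrightarrow> d s \<le> D"
  shows "apply_at_zero r T J = (\<Sum>s\<in>S. \<Sum>\<beta>\<in>PiE {1..r} (\<lambda>_. {..D}). T \<beta> *
    scal (C s * ffact (d s) (sum \<beta> {1..r}) * (\<Prod>i\<in>{1..r}. B s i ^ \<beta> i) * A s ^ (d s - sum \<beta> {1..r})))"
proof -
  let ?mp = "\<lambda>\<beta>. mixed_partial r \<beta> J (\<lambda>_. 0)"
  have mp: "?mp \<beta> = (\<Sum>s\<in>S. C s * ffact (d s) (sum \<beta> {1..r}) * (\<Prod>i\<in>{1..r}. B s i ^ \<beta> i) * A s ^ (d s - sum \<beta> {1..r}))" for \<beta>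
    by (rule mixed_partial_aff_pow[OF J \<open>\<epsilon> > 0\<close>])
  have sub: "{\<beta>. \<beta> \<in> {1..r} \<rightarrow>\<^sub>E UNIV \<and> ?mp \<beta> \<noteq> 0} \<subseteq> PiE {1..r} (\<lambda>_. {..D})"
  proof clarify
    fix \<beta> :: "nat \<Rightarrow> nat" assume b: "\<beta> \<in> {1..r} \<rightarrow>\<^sub>E UNIV" "?mp \<beta> \<noteq> 0"
    have "\<exists>s\<in>S. ffact (d s) (sum \<beta> {1..r}) \<noteq> 0"
    proof (rule ccontr)
      assume "\<not> ?thesis"
      then have "?mp \<beta> = 0" unfolding mp by (intro sum.neutral) auto
      then show False using b by simp
    qed
    then obtain s where s: "s \<in> S" "ffact (d s) (sum \<beta> {1..r}) \<noteq> 0" by blast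
    then have "sum \<beta> {1..r} \<le> D" using D[OF s(1)] by (auto simp: ffact_eq split: if_splits)
    then have "\<beta> i \<le> D" if "i \<in> {1..r}" for i using member_le_sum[OF that, of \<beta>] by simp
    then show "\<beta> \<in> PiE {1..r} (\<lambda>_. {..D})" using b by auto
  qed
  have "apply_at_zero r T J = (\<Sum>\<beta>\<in>PiE {1..r} (\<lambda>_. {..D}). T \<beta> * scal (?mp \<beta>))"
    unfolding apply_at_zero_def using sub by (intro sum.mono_neutral_left) (auto simp: finite_PiE)
  also have "\<dots> = (\<Sum>\<beta>\<in>PiE {1..r} (\<lambda>_. {..D}). \<Sum>s\<in>S. T \<beta> *
    scal (C s * ffact (d s) (sum \<beta> {1..r}) * (\<Prod>i\<in>{1..r}. B s i ^ \<beta> i) * A s ^ (d s - sum \<beta> {1..r})))"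
    unfolding mp scal_sum sum_distrib_left ..
  finally show ?thesis by (subst (asm) sum.swap)
qed

definition fps_scal :: "complex fps \<Rightarrow> ratfun fps" where
  "fps_scal F = Abs_fps (\<lambda>j. scal (fps_nth F j))"

lemma fps_scal_nth [simp]: "fps_nth (fps_scal F) j = scal (fps_nth F j)"
  by (simp add: fps_scal_def)

lemma fps_scal_mult: "fps_scal (F * G) = fps_scal F * fps_scal G"
  by (rule fps_ext) (simp add: fps_mult_nth scal_sum scal_mult)

lemma fps_scal_X: "fps_scal fps_X = fps_X"
  by (rule fps_ext) simp

lemma todd_den_nth: "fps_nth (todd_den a) j = of_nat (of_bool (j = 0)) - a * ((- 1) ^ j / of_nat (fact j))"
  by (simp add: todd_den_def)

lemma fps_scal_todd_den: "fps_scal (todd_den a) = todd_den (scal a)"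
  by (rule fps_ext)
    (simp only: fps_scal_nth todd_den_nth scal_diff scal_mult scal_divide scal_power scal_uminus scal_1 scal_of_nat)

text \<open>The coefficientwise embedding is multiplicative, and \<open>todd\<close> is determined
  by its product with the nonzero series \<open>todd_den\<close>.\<close>

lemma fps_scal_todd: "fps_scal (todd a) = todd (scal a)"
proof -
  have "fps_scal (todd a) * todd_den (scal a) = fps_X"
    by (simp only: fps_scal_todd_den[symmetric] fps_scal_mult[symmetric] todd_times_den fps_scal_X)
  then show ?thesis using todd_times_den[of "scal a"] todd_den_nonzero[of "scal a"] by (metis mult_right_cancel)
qed

text \<open>With d the denominator, a exp (-X) = 1 - d, so the fraction X a exp (-X) / d equals the
  Todd quotient minus X.\<close>

lemma factor_in_eq: "factor_in a = op_factor (1 + yvar) 0 (scal a)"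
proof -
  let ?d = "todd_den (scal a)"
  have e: "fps_const (scal a) * fps_exp (- 1) = 1 - ?d" by (simp add: todd_den_def)
  have "fps_const (1 + yvar) * fps_const (scal a) * fps_X * fps_exp (- 1) =
      fps_const (1 + yvar) * (fps_X * (fps_const (scal a) * fps_exp (- 1)))" by (simp only: mult_ac)
  also have "\<dots> = fps_const (1 + yvar) * (todd (scal a) * ?d - fps_X * ?d)"
    unfolding e by (simp add: todd_times_den algebra_simps)
  also have "\<dots> = op_factor (1 + yvar) 0 (scal a) * ?d" by (simp add: op_factor_def algebra_simps)
  finally show ?thesis unfolding factor_in_def todd_den_def[symmetric]
    using todd_den_nonzero by (metis nonzero_mult_div_cancel_right)
qed

text \<open>With d the denominator, 1 + y a exp (-X) = d + (1 + y) (1 - d), which splits the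
  quotient into X and the term already present for indices in K.\<close>

lemma factor_out_eq: "factor_out a = op_factor (1 + yvar) 1 (scal a)"
proof -
  let ?d = "todd_den (scal a)"
  have e: "fps_const (scal a) * fps_exp (- 1) = 1 - ?d" by (simp add: todd_den_def)
  have "fps_X * (1 + fps_const yvar * fps_const (scal a) * fps_exp (- 1)) =
      fps_X * (1 + fps_const yvar * (fps_const (scal a) * fps_exp (- 1)))" by (simp only: mult.assoc)
  also have "\<dots> = fps_X * ?d + fps_const (1 + yvar) * (todd (scal a) * ?d - fps_X * ?d)"
    unfolding e by (simp add: todd_times_den algebra_simps flip: fps_const_add)
  also have "\<dots> = op_factor (1 + yvar) 1 (scal a) * ?d" by (simp add: op_factor_def algebra_simps)
  finally show ?thesis unfolding factor_out_def todd_den_def[symmetric]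
    using todd_den_nonzero by (metis nonzero_mult_div_cancel_right)
qed

text \<open>The coefficients of the operator factors are polynomials in y of degree at most 1.
  Stating them in \<open>complex poly\<close> makes evaluation at complex y possible.\<close>

definition factor_poly :: "complex \<Rightarrow> complex \<Rightarrow> nat \<Rightarrow> complex poly" where
  "factor_poly w a j = [:w * fps_nth fps_X j:] + smult (fps_nth (todd a) j - fps_nth fps_X j) [:1, 1:]"

lemma one_plus_yvar: "1 + yvar = to_fract [:1, 1:]"
proof -
  have "(1 :: ratfun) + yvar = to_fract ([:1:] + [:0, 1:])"
    by (simp add: yvar_def one_pCons[symmetric])
  then show ?thesis by simp
qed

lemma op_factor_nth: "fps_nth (op_factor (1 + yvar) (scal w) (scal a)) j = to_fract (factor_poly w a j)"
proof -
  have X: "fps_nth (fps_X :: ratfun fps) j = scal (fps_nth fps_X j)" by simp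
  have sm: "to_fract (smult c p) = scal c * to_fract p" for c p
    by (simp add: scal_def flip: to_fract_mult)
  show ?thesis
    unfolding factor_poly_def to_fract_add sm scal_def[symmetric]
    by (simp only: op_factor_def fps_add_nth fps_sub_nth fps_mult_left_const_nth fps_scal_todd[symmetric]
      fps_scal_nth X one_plus_yvar scal_mult scal_diff mult.commute[of "to_fract [:1, 1:]"])
qed

lemma poly_factor_poly: "poly (factor_poly w a j) y = fps_nth (op_factor (1 + y) w a) j"
  by (simp add: factor_poly_def op_factor_def algebra_simps)

lemma factor_poly_0: "factor_poly w a 0 = (if a = 1 then [:1, 1:] else 0)"
  by (simp add: factor_poly_def todd_nth_0)

lemma one_plus_yvar_nonzero: "1 + yvar \<noteq> 0"
  unfolding one_plus_yvar by simp

lemma T_op_eq: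
  assumes "K \<subseteq> {1..r}" "finite GG"
  shows "T_op n r K GG \<beta> = (1 + yvar) powi (int n - int r) *
    to_fract (\<Sum>g\<in>GG. \<Prod>i\<in>{1..r}. factor_poly (if i \<in> K then 0 else 1) (g i) (\<beta> i))"
proof -
  have "(\<Prod>i\<in>K. fps_nth (factor_in (g i)) (\<beta> i)) * (\<Prod>i\<in>{1..r} - K. fps_nth (factor_out (g i)) (\<beta> i)) =
      (\<Prod>i\<in>{1..r}. to_fract (factor_poly (if i \<in> K then 0 else 1) (g i) (\<beta> i)))" for g
  proof -
    have "(\<Prod>i\<in>K. fps_nth (factor_in (g i)) (\<beta> i)) = (\<Prod>i\<in>K. to_fract (factor_poly (if i \<in> K then 0 else 1) (g i) (\<beta> i)))"
      using op_factor_nth[of 0] by (intro prod.cong) (auto simp: factor_in_eq)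
    moreover have "(\<Prod>i\<in>{1..r} - K. fps_nth (factor_out (g i)) (\<beta> i)) = (\<Prod>i\<in>{1..r} - K. to_fract (factor_poly (if i \<in> K then 0 else 1) (g i) (\<beta> i)))"
      using op_factor_nth[of 1] by (intro prod.cong) (auto simp: factor_out_eq)
    ultimately show ?thesis
      using prod.subset_diff[OF assms(1), of "\<lambda>i. to_fract (factor_poly (if i \<in> K then 0 else 1) (g i) (\<beta> i))"]
      by (simp add: mult.commute)
  qed
  then show ?thesis unfolding T_op_def by (simp add: to_fract_sum to_fract_prod)
qed

text \<open>Outside V only constant coefficients occur, equal to 1 + y if g i = 1 and to 0
  otherwise. The zeros discard all g not supported on V, and the r - n factors 1 + y cancel the
  prefactor of the operator.\<close>

lemma T_op_vertex:
  assumes K: "K \<subseteq> {1..r}" and fin: "finite GG" and V: "V \<subseteq> {1..r}" "card V = n"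
    and \<beta>: "\<And>i. i \<in> {1..r} - V \<Longrightarrow> \<beta> i = 0"
  shows "T_op n r K GG \<beta> = to_fract (\<Sum>g | g \<in> GG \<and> (\<forall>i\<in>{1..r}-V. g i = 1). \<Prod>i\<in>V. factor_poly (if i \<in> K then 0 else 1) (g i) (\<beta> i))"
proof -
  let ?p = "\<lambda>g i. factor_poly (if i \<in> K then 0 else 1) (g i) (\<beta> i)"
  have finV: "finite V" using V finite_subset by blast
  have nr: "n \<le> r" using card_mono[of "{1..r}" V] V by simp
  have cd: "card ({1..r} - V) = r - n" using V finV by (simp add: card_Diff_subset)
  have "(\<Prod>i\<in>{1..r}. ?p g i) = (if \<forall>i\<in>{1..r}-V. g i = 1 then [:1, 1:] ^ (r - n) * (\<Prod>i\<in>V. ?p g i) else 0)" for g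
  proof -
    have "(\<Prod>i\<in>{1..r}. ?p g i) = (\<Prod>i\<in>{1..r}-V. ?p g i) * (\<Prod>i\<in>V. ?p g i)"
      using V by (intro prod.subset_diff) auto
    also have "(\<Prod>i\<in>{1..r}-V. ?p g i) = (\<Prod>i\<in>{1..r}-V. if g i = 1 then [:1, 1:] else 0)"
      using \<beta> by (intro prod.cong) (auto simp: factor_poly_0)
    also have "\<dots> = (if \<forall>i\<in>{1..r}-V. g i = 1 then [:1, 1:] ^ (r - n) else 0)"
      using cd by (auto intro!: prod_zero)
    finally show ?thesis by simp
  qed
  then have "(\<Sum>g\<in>GG. \<Prod>i\<in>{1..r}. ?p g i) =
      (\<Sum>g\<in>GG. if \<forall>i\<in>{1..r}-V. g i = 1 then [:1, 1:] ^ (r - n) * (\<Prod>i\<in>V. ?p g i) else 0)"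
    by (rule sum.cong[OF refl])
  also have "\<dots> = (\<Sum>g | g \<in> GG \<and> (\<forall>i\<in>{1..r}-V. g i = 1). [:1, 1:] ^ (r - n) * (\<Prod>i\<in>V. ?p g i))"
    by (rule sum.inter_filter[OF fin, symmetric])
  also have "\<dots> = [:1, 1:] ^ (r - n) * (\<Sum>g | g \<in> GG \<and> (\<forall>i\<in>{1..r}-V. g i = 1). \<Prod>i\<in>V. ?p g i)"
    by (simp only: sum_distrib_left)
  finally have "(\<Sum>g\<in>GG. \<Prod>i\<in>{1..r}. ?p g i) = [:1, 1:] ^ (r - n) * (\<Sum>g | g \<in> GG \<and> (\<forall>i\<in>{1..r}-V. g i = 1). \<Prod>i\<in>V. ?p g i)" .
  moreover have "(1 + yvar) powi (int n - int r) * to_fract ([:1, 1:] ^ (r - n)) = 1"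
  proof -
    have "to_fract ([:1, 1:] ^ (r - n)) = (1 + yvar) powi (int r - int n)"
    proof -
      have "int r - int n = int (r - n)" using nr by simp
      then have "(1 + yvar) powi (int r - int n) = (1 + yvar) ^ (r - n)" by (simp only: power_int_of_nat)
      then show ?thesis by (simp only: to_fract_power one_plus_yvar)
    qed
    moreover have "(1 + yvar) powi (int n - int r) * (1 + yvar) powi (int r - int n) = 1"
      using power_int_add[of "1 + yvar" "int n - int r" "int r - int n"] one_plus_yvar_nonzero by simp
    ultimately show ?thesis by (simp only:)
  qed
  ultimately show ?thesis unfolding T_op_eq[OF K fin] by (simp only: to_fract_mult mult.assoc[symmetric] mult_1_left)
qed

section \<open>Perturbation of the polytope and coefficients at a vertex\<close>

context vertex_system
begin

text \<open>Minus the sum of the tight normals attains its maximum over the polytope at x. A maximal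
  vertex does at least as well, so the nonnegative values of the tight constraints sum to 0
  there.\<close>

lemma tight_subset_vertex:
  assumes x: "\<And>i. i \<in> I \<Longrightarrow> ell i x \<ge> 0"
  obtains V where "V \<in> VV" "{i\<in>I. ell i x = 0} \<subseteq> V"
proof -
  let ?J = "{i\<in>I. ell i x = 0}"
  let ?\<xi> = "- (\<Sum>i\<in>?J. u i)"
  obtain V where V: "V \<in> VV" "\<And>i. i \<in> V \<Longrightarrow> ?\<xi> \<bullet> \<alpha> V i \<le> 0" using exists_max_vert by blast
  have "?\<xi> \<bullet> (x - vert V) \<le> 0" unfolding dot_diff_vert[OF V(1)]
    using x V VV_sub by (intro sum_nonpos mult_nonneg_nonpos) auto
  moreover have "?\<xi> \<bullet> (x - vert V) = (\<Sum>i\<in>?J. ell i (vert V))"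
  proof -
    have "- (\<Sum>i\<in>J. u i) \<bullet> (x - vert V) = (\<Sum>i\<in>J. ell i (vert V) - ell i x)" for J
      by (simp add: inner_sum_left inner_sum_right ell_def sum_subtractf inner_diff_right sum_negf inner_commute)
    from this[of ?J] show ?thesis by simp
  qed
  ultimately have le0: "(\<Sum>i\<in>?J. ell i (vert V)) \<le> 0" by simp
  have nonneg: "\<And>i. i \<in> ?J \<Longrightarrow> ell i (vert V) \<ge> 0" using ell_vert_nonneg[OF V(1)] by auto
  have "(\<Sum>i\<in>?J. ell i (vert V)) = 0"
    by (intro antisym[OF le0] sum_nonneg nonneg)
  then have "ell i (vert V) = 0" if "i \<in> ?J" for i
    using that finite_I by (subst (asm) sum_nonneg_eq_0_iff) (auto simp: ell_vert_nonneg[OF V(1)])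
  then have "?J \<subseteq> V" using ell_vert_pos[OF V(1)] by fastforce
  then show ?thesis using that V by blast
qed

text \<open>Among the axioms only \<open>pos\<close> involves c, and it consists of finitely many
  strict inequalities that are affine in h.\<close>

lemma vertex_system_perturb:
  obtains \<epsilon> where "\<epsilon> > 0"
    "\<And>h. (\<And>i. i \<in> I \<Longrightarrow> \<bar>h i\<bar> < \<epsilon>) \<Longrightarrow> vertex_system I u VV \<alpha> (\<lambda>i. c i + h i)"
proof -
  define Z where "Z = (SIGMA V:VV. I - V)"
  have finZ: "finite Z" unfolding Z_def using finite_VV finite_I by blast
  \<comment> \<open>If all entries of h in I are smaller than \<epsilon>, the constraint i at the
    vertex V changes by less than \<epsilon> times this number.\<close>
  define M where "M = (\<lambda>(V, i). 1 + (\<Sum>j\<in>V. \<bar>\<alpha> V j \<bullet> u i\<bar>))"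
  define p where "p = (\<lambda>(V, i). ell i (vert V) / M (V, i))"
  define \<epsilon> where "\<epsilon> = Min (insert 1 (p ` Z))"
  have M: "M z > 0" for z by (cases z) (simp add: M_def add_pos_nonneg sum_nonneg)
  have "\<epsilon> > 0" unfolding \<epsilon>_def using finZ M ell_vert_pos by (auto simp: p_def Z_def)
  moreover have "vertex_system I u VV \<alpha> (\<lambda>i. c i + h i)" if h: "\<And>i. i \<in> I \<Longrightarrow> \<bar>h i\<bar> < \<epsilon>" for h
  proof
    show "0 < - (\<Sum>j\<in>V. (c j + h j) *\<^sub>R \<alpha> V j) \<bullet> u i + (c i + h i)" if V: "V \<in> VV" "i \<in> I - V" for V i
    proof -
      have eq: "- (\<Sum>j\<in>V. (c j + h j) *\<^sub>R \<alpha> V j) \<bullet> u i + (c i + h i) =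
          ell i (vert V) + (h i - (\<Sum>j\<in>V. h j * (\<alpha> V j \<bullet> u i)))"
        by (simp add: ell_def vert_def inner_sum_left scaleR_add_left inner_add_left inner_diff_left sum.distrib)
      have "\<epsilon> \<le> p (V, i)" unfolding \<epsilon>_def using finZ V by (intro Min_le) (auto simp: Z_def)
      then have "\<epsilon> * M (V, i) \<le> ell i (vert V)" using M[of "(V, i)"] by (simp add: p_def field_simps)
      moreover have "\<bar>h i - (\<Sum>j\<in>V. h j * (\<alpha> V j \<bullet> u i))\<bar> < \<epsilon> * M (V, i)"
      proof -
        have "\<bar>\<Sum>j\<in>V. h j * (\<alpha> V j \<bullet> u i)\<bar> \<le> (\<Sum>j\<in>V. \<epsilon> * \<bar>\<alpha> V j \<bullet> u i\<bar>)"
        proof (rule order_trans[OF sum_abs sum_mono])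
          fix j assume "j \<in> V"
          then have "\<bar>h j\<bar> \<le> \<epsilon>" using h V VV_sub by (meson less_imp_le subsetD)
          then show "\<bar>h j * (\<alpha> V j \<bullet> u i)\<bar> \<le> \<epsilon> * \<bar>\<alpha> V j \<bullet> u i\<bar>"
            by (simp add: abs_mult mult_right_mono)
        qed
        also have "\<dots> = \<epsilon> * (M (V, i) - 1)" by (simp add: M_def sum_distrib_left)
        finally show ?thesis using h[of i] V by (simp add: algebra_simps)
      qed
      ultimately show ?thesis unfolding eq by linarith
    qed
  qed (use finite_I VV_ne VV_sub VV_card dual expand nbr in auto)
  ultimately show ?thesis using that by blast
qed

end

context lattice_vertex_system
begin

text \<open>The coefficient of t^(k + n) in \<open>lattice_sum_expansion\<close>, times k!. It is
  arranged so that the second factor on the left is the derivative of order \<beta> at h = 0 of the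
  vertex term in \<open>power_integral\<close>: each derivative in h i brings down -(\<xi> \<bullet>
  \<alpha> V i) and lowers the exponent.\<close>

lemma lattice_sum_coeff:
  assumes gen: "generic \<xi>" and lattice: "\<And>V. V \<in> VV \<Longrightarrow> vert V \<in> range lat" and q: "q \<noteq> 0"
    and D: "k + CARD('n) \<le> D"
  shows "(\<Sum>V\<in>VV. \<Sum>\<beta>\<in>PiE V (\<lambda>_. {..D}).
      (\<Sum>g\<in>vchars V. \<Prod>i\<in>V. fps_nth (op_factor q (w i) (g i)) (\<beta> i)) *
      (fact k / fact (k + CARD('n)) * vcoeff \<xi> V * ffact (k + CARD('n)) (sum \<beta> V) *
        (\<Prod>i\<in>V. (- complex_of_real (\<xi> \<bullet> \<alpha> V i)) ^ \<beta> i) * complex_of_real (\<xi> \<bullet> vert V) ^ (k + CARD('n) - sum \<beta> V))) =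
    (\<Sum>m | \<forall>i\<in>I. ell i (lat m) \<ge> 0. weight q w m * complex_of_real ((\<xi> \<bullet> lat m) ^ k))"
proof -
  let ?n = "CARD('n)"
  let ?d = "k + ?n"
  let ?M = "{m. \<forall>i\<in>I. ell i (lat m) \<ge> 0}"
  let ?b = "\<lambda>V i. complex_of_real (\<xi> \<bullet> \<alpha> V i)"
  let ?a = "\<lambda>V. complex_of_real (\<xi> \<bullet> vert V)"
  let ?op = "\<lambda>g i. op_factor q (w i) (g i)"
  let ?E = "\<lambda>V \<beta>. if sum \<beta> V \<le> ?d then fps_nth (fps_exp (?a V)) (?d - sum \<beta> V) else 0"
  have "fps_nth (fps_X ^ ?n * (\<Sum>m\<in>?M. fps_const (weight q w m) * fps_exp (complex_of_real (\<xi> \<bullet> lat m)))) ?d =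
    (\<Sum>V\<in>VV. \<Sum>g\<in>vchars V. 1 / index V * fps_nth (fps_exp (?a V) * (\<Prod>i\<in>V. scaled_factor q (w i) (g i) (?b V i))) ?d)"
  proof -
    have "fps_exp (?a V) * (fps_const (1 / index V) * (\<Sum>g\<in>vchars V. \<Prod>i\<in>V. scaled_factor q (w i) (g i) (?b V i))) =
      (\<Sum>g\<in>vchars V. fps_const (1 / index V) * (fps_exp (?a V) * (\<Prod>i\<in>V. scaled_factor q (w i) (g i) (?b V i))))" for V
      by (simp only: sum_distrib_left mult_ac)
    then have "(\<Sum>V\<in>VV. fps_exp (?a V) * (fps_const (1 / index V) * (\<Sum>g\<in>vchars V. \<Prod>i\<in>V. scaled_factor q (w i) (g i) (?b V i)))) =
      (\<Sum>V\<in>VV. \<Sum>g\<in>vchars V. fps_const (1 / index V) * (fps_exp (?a V) * (\<Prod>i\<in>V. scaled_factor q (w i) (g i) (?b V i))))"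
      by (intro sum.cong refl)
    then have "fps_X ^ ?n * (\<Sum>m\<in>?M. fps_const (weight q w m) * fps_exp (complex_of_real (\<xi> \<bullet> lat m))) =
      (\<Sum>V\<in>VV. \<Sum>g\<in>vchars V. fps_const (1 / index V) * (fps_exp (?a V) * (\<Prod>i\<in>V. scaled_factor q (w i) (g i) (?b V i))))"
      by (rule trans[OF lattice_sum_expansion[OF gen lattice q], rotated])
    then show ?thesis by (simp only: fps_sum_nth fps_mult_left_const_nth)
  qed
  also have "fps_nth (fps_X ^ ?n * (\<Sum>m\<in>?M. fps_const (weight q w m) * fps_exp (complex_of_real (\<xi> \<bullet> lat m)))) ?d =
     (\<Sum>m\<in>?M. weight q w m * complex_of_real ((\<xi> \<bullet> lat m) ^ k)) / fact k"
    by (simp add: fps_X_power_mult_nth fps_sum_nth sum_divide_distrib)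
  finally have main: "(\<Sum>m\<in>?M. weight q w m * complex_of_real ((\<xi> \<bullet> lat m) ^ k)) =
    (\<Sum>V\<in>VV. fact k * (\<Sum>g\<in>vchars V. 1 / index V * fps_nth (fps_exp (?a V) * (\<Prod>i\<in>V. scaled_factor q (w i) (g i) (?b V i))) ?d))"
    by (simp add: field_simps sum_distrib_left)
  show ?thesis unfolding main
  proof (rule sum.cong[OF refl])
    fix V assume V: "V \<in> VV"
    have "1 / index V * fps_nth (fps_exp (?a V) * (\<Prod>i\<in>V. scaled_factor q (w i) (g i) (?b V i))) ?d =
      (\<Sum>\<beta>\<in>PiE V (\<lambda>_. {..D}). (\<Prod>i\<in>V. fps_nth (?op g i) (\<beta> i)) *
        (vcoeff \<xi> V * ?E V \<beta> * (\<Prod>i\<in>V. (- ?b V i) ^ \<beta> i)))" for g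
    proof -
      have pr: "(\<Prod>i\<in>V. fps_nth (scaled_factor q (w i) (g i) (?b V i)) (\<beta> i)) =
          (\<Prod>i\<in>V. complex_of_real (- 1 / (\<xi> \<bullet> \<alpha> V i))) * (\<Prod>i\<in>V. (- ?b V i) ^ \<beta> i) * (\<Prod>i\<in>V. fps_nth (?op g i) (\<beta> i))" for \<beta>
        by (simp add: scaled_factor_def prod.distrib[symmetric])
      show ?thesis
        unfolding fps_prod_coeff[OF finite_V[OF V] D] pr vcoeff_def sum_distrib_left
        by (intro sum.cong refl) (simp add: mult_ac)
    qed
    then have "fact k * (\<Sum>g\<in>vchars V. 1 / index V * fps_nth (fps_exp (?a V) * (\<Prod>i\<in>V. scaled_factor q (w i) (g i) (?b V i))) ?d) =
      (\<Sum>\<beta>\<in>PiE V (\<lambda>_. {..D}). fact k * (\<Sum>g\<in>vchars V. (\<Prod>i\<in>V. fps_nth (?op g i) (\<beta> i)) *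
        (vcoeff \<xi> V * ?E V \<beta> * (\<Prod>i\<in>V. (- ?b V i) ^ \<beta> i))))"
      by (simp only: sum_distrib_left[of "fact k"] sum.swap[of _ "vchars V"])
    also have "\<dots> = (\<Sum>\<beta>\<in>PiE V (\<lambda>_. {..D}). (\<Sum>g\<in>vchars V. \<Prod>i\<in>V. fps_nth (?op g i) (\<beta> i)) *
      (fact k / fact ?d * vcoeff \<xi> V * ffact ?d (sum \<beta> V) *
        (\<Prod>i\<in>V. (- ?b V i) ^ \<beta> i) * ?a V ^ (?d - sum \<beta> V)))"
    proof (rule sum.cong[OF refl])
      fix \<beta>
      have E: "?E V \<beta> = ffact ?d (sum \<beta> V) / fact ?d * ?a V ^ (?d - sum \<beta> V)"
        by (simp add: ffact_eq)
      show "fact k * (\<Sum>g\<in>vchars V. (\<Prod>i\<in>V. fps_nth (?op g i) (\<beta> i)) *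
        (vcoeff \<xi> V * ?E V \<beta> * (\<Prod>i\<in>V. (- ?b V i) ^ \<beta> i))) =
        (\<Sum>g\<in>vchars V. \<Prod>i\<in>V. fps_nth (?op g i) (\<beta> i)) *
      (fact k / fact ?d * vcoeff \<xi> V * ffact ?d (sum \<beta> V) *
        (\<Prod>i\<in>V. (- ?b V i) ^ \<beta> i) * ?a V ^ (?d - sum \<beta> V))"
        unfolding E sum_distrib_right[symmetric] by (simp only: divide_inverse mult_ac)
    qed
    finally show "(\<Sum>\<beta>\<in>PiE V (\<lambda>_. {..D}). (\<Sum>g\<in>vchars V. \<Prod>i\<in>V. fps_nth (?op g i) (\<beta> i)) *
      (fact k / fact ?d * vcoeff \<xi> V * ffact ?d (sum \<beta> V) *
        (\<Prod>i\<in>V. (- ?b V i) ^ \<beta> i) * ?a V ^ (?d - sum \<beta> V))) =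
      fact k * (\<Sum>g\<in>vchars V. 1 / index V * fps_nth (fps_exp (?a V) * (\<Prod>i\<in>V. scaled_factor q (w i) (g i) (?b V i))) ?d)" ..
  qed
qed

end

lemma set_integrable_power:
  fixes A :: "'a::euclidean_space set"
  assumes A: "A \<in> sets borel" "bounded A"
  shows "set_integrable lborel A (\<lambda>x. complex_of_real ((\<xi> \<bullet> x) ^ k))"
proof -
  obtain B0 where B0: "\<And>x. x \<in> A \<Longrightarrow> norm x \<le> B0" using A(2) by (auto simp: bounded_iff)
  have "norm (complex_of_real ((\<xi> \<bullet> x) ^ k)) \<le> (norm \<xi> * \<bar>B0\<bar>) ^ k" if "x \<in> A" for x
  proof -
    have "\<bar>\<xi> \<bullet> x\<bar> \<le> norm \<xi> * norm x" by (rule Cauchy_Schwarz_ineq2)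
    also have "\<dots> \<le> norm \<xi> * \<bar>B0\<bar>" using B0[OF that] by (intro mult_left_mono) auto
    finally show ?thesis by (simp add: norm_power power_mono)
  qed
  then show ?thesis unfolding set_integrable_def
    using A emeasure_bounded_finite[OF A(2)]
    by (intro integrableI_bounded_set_indicator[where B="(norm \<xi> * \<bar>B0\<bar>) ^ k"]) auto
qed

text \<open>Multi-indices on V are extended by 0 on the rest of I and by \<open>undefined\<close>
  beyond, as extensionality demands.\<close>

lemma sum_PiE_support:
  fixes F :: "(nat \<Rightarrow> nat) \<Rightarrow> 'a::comm_monoid_add"
  assumes "finite I" "V \<subseteq> I"
    and "\<And>\<beta>. \<beta> \<in> PiE I (\<lambda>_. {..D}) \<Longrightarrow> \<exists>i\<in>I-V. \<beta> i \<noteq> 0 \<Longrightarrow> F \<beta> = 0"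
  shows "(\<Sum>\<beta>\<in>PiE I (\<lambda>_. {..D}). F \<beta>) = (\<Sum>\<beta>\<in>PiE V (\<lambda>_. {..D}). F (\<lambda>i. if i \<in> V then \<beta> i else if i \<in> I then 0 else undefined))"
proof -
  let ?e = "\<lambda>\<beta> i. if i \<in> V then \<beta> i else if i \<in> I then 0 else undefined"
  let ?S = "{\<beta>\<in>PiE I (\<lambda>_. {..D}). \<forall>i\<in>I-V. \<beta> i = 0}"
  have "(\<Sum>\<beta>\<in>PiE I (\<lambda>_. {..D}). F \<beta>) = (\<Sum>\<beta>\<in>?S. F \<beta>)"
    using assms by (intro sum.mono_neutral_right) (auto simp: finite_PiE)
  also have "\<dots> = (\<Sum>\<beta>\<in>PiE V (\<lambda>_. {..D}). F (?e \<beta>))"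
  proof (rule sum.reindex_bij_witness[of _ ?e "\<lambda>\<beta>. restrict \<beta> V"])
    fix \<beta> assume b: "\<beta> \<in> ?S"
    show "?e (restrict \<beta> V) = \<beta>"
      using b assms(2) by (auto simp: fun_eq_iff PiE_iff extensional_def)
    then show "F (?e (restrict \<beta> V)) = F \<beta>" by simp
    show "restrict \<beta> V \<in> PiE V (\<lambda>_. {..D})" using b assms(2) by (auto simp: PiE_iff)
  next
    fix \<beta> assume b: "\<beta> \<in> PiE V (\<lambda>_. {..D})"
    then show "restrict (?e \<beta>) V = \<beta>" by (auto simp: fun_eq_iff PiE_iff extensional_def)
    show "?e \<beta> \<in> ?S" using b assms(2) by (auto simp: PiE_iff extensional_def)
  qed
  finally show ?thesis .
qed

section \<open>The formula for a vertex system with lattice vertices\<close>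

context lattice_vertex_system
begin

text \<open>For points of the polytope this is \<open>weight\<close> at q = 1 + y as a polynomial in
  y, so that it also makes sense at y = -1. The exponent is the dimension of the face whose relative
  interior contains x.\<close>

definition weight_poly :: "nat set \<Rightarrow> real ^ 'n \<Rightarrow> complex poly" where
  "weight_poly K x = (if {i\<in>I. ell i x = 0} \<inter> K = {} then [:1, 1:] ^ (CARD('n) - card {i\<in>I. ell i x = 0}) else 0)"

lemma poly_weight_poly:
  assumes x: "\<And>i. i \<in> I \<Longrightarrow> ell i (lat m) \<ge> 0" and y: "y \<noteq> - 1"
  shows "poly (weight_poly K (lat m)) y = weight (1 + y) (\<lambda>i. if i \<in> K then 0 else 1) m"
proof -
  let ?J = "{i\<in>I. ell i (lat m) = 0}"
  let ?w = "\<lambda>i. if i \<in> K then 0 else 1 :: complex"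
  have q: "1 + y \<noteq> 0" using y by (metis add_eq_0_iff)
  obtain V where V: "V \<in> VV" "?J \<subseteq> V" using tight_subset_vertex[OF x] .
  have cV: "card V = CARD('n)" using VV_card[OF V(1)] by simp
  have "card ?J \<le> CARD('n)" using card_mono[OF finite_V[OF V(1)] V(2)] cV by simp
  moreover have "CARD('n) \<le> card I" using card_mono[OF finite_I VV_sub[OF V(1)]] cV by simp
  \<comment> \<open>The tight facets number at most n, and n is at most the number of all facets; so
    the truncated differences are genuine and the powers of 1 + y can be split off.\<close>
  ultimately have cards: "card (I - ?J) = (CARD('n) - card ?J) + (card I - CARD('n))"
    using finite_I by (subst card_Diff_subset) auto
  have "(\<Prod>i\<in>I. step_weight (1 + y) (?w i) (ell i (lat m))) =
      (\<Prod>i\<in>I-?J. step_weight (1 + y) (?w i) (ell i (lat m))) * (\<Prod>i\<in>?J. step_weight (1 + y) (?w i) (ell i (lat m)))"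
    using finite_I by (intro prod.subset_diff) auto
  also have "(\<Prod>i\<in>I-?J. step_weight (1 + y) (?w i) (ell i (lat m))) = (\<Prod>i\<in>I-?J. 1 + y)"
  proof (rule prod.cong)
    fix i assume "i \<in> I - ?J"
    then have "ell i (lat m) > 0" using x[of i] by auto
    then show "step_weight (1 + y) (?w i) (ell i (lat m)) = 1 + y" by (simp add: step_weight_def)
  qed simp
  also have "(\<Prod>i\<in>?J. step_weight (1 + y) (?w i) (ell i (lat m))) = (\<Prod>i\<in>?J. ?w i)"
    by (intro prod.cong) (auto simp: step_weight_def)
  also have "(\<Prod>i\<in>?J. ?w i) = (if ?J \<inter> K = {} then 1 else 0)"
    using finite_I by (auto intro!: prod.neutral)
  finally have "weight (1 + y) ?w m = (if ?J \<inter> K = {} then (1 + y) ^ (CARD('n) - card ?J) else 0)"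
    unfolding weight_def using q cards by (simp add: power_add)
  then show ?thesis by (simp add: weight_poly_def poly_power)
qed

text \<open>The operator is applied to each power and each vertex separately. The condition on
  \<open>GG\<close> identifies the terms surviving at V with its character group, after which
  \<open>lattice_sum_coeff\<close> sums the vertices into lattice points.\<close>

theorem euler_maclaurin_vertex_system:
  assumes I: "I = {1..r}" and K: "K \<subseteq> {1..r}"
    and lattice: "\<And>V. V \<in> VV \<Longrightarrow> vert V \<in> range lat"
    and GG: "finite GG" "\<And>V. V \<in> VV \<Longrightarrow> {g \<in> GG. \<forall>i\<in>{1..r}-V. g i = 1} = vchars V"
    and L: "finite L" "\<And>l. l \<in> L \<Longrightarrow> generic (\<xi> l)"
    and f: "\<And>x. f x = (\<Sum>l\<in>L. lam l * complex_of_real ((\<xi> l \<bullet> x) ^ k l))"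
  shows "apply_at_zero r (T_op CARD('n) r K GG) (\<lambda>h. LINT x:{x. \<forall>i\<in>I. x \<bullet> lat (U i) + c i + h i \<ge> 0}|lborel. f x) =
    (\<Sum>m | \<forall>i\<in>I. ell i (lat m) \<ge> 0. to_fract (weight_poly K (lat m)) * scal (f (lat m)))"
proof -
  let ?n = "CARD('n)"
  let ?w = "\<lambda>i. if i \<in> K then 0 else 1 :: complex"
  let ?M = "{m. \<forall>i\<in>I. ell i (lat m) \<ge> 0}"
  \<comment> \<open>A common bound for all exponents k l + n, so that every term uses the same box
    of multi-indices.\<close>
  define D where "D = (\<Sum>l\<in>L. k l) + ?n"
  have D: "k l + ?n \<le> D" if "l \<in> L" for l
    using member_le_sum[OF that, of k] L(1) by (simp add: D_def)
  obtain \<epsilon> where \<epsilon>: "\<epsilon> > 0"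
    "\<And>h. (\<And>i. i \<in> I \<Longrightarrow> \<bar>h i\<bar> < \<epsilon>) \<Longrightarrow> vertex_system I (\<lambda>i. lat (U i)) VV \<alpha> (\<lambda>i. c i + h i)"
    using vertex_system_perturb by blast
  \<comment> \<open>The summands are indexed by pairs of a power l and a vertex V. The coefficients
    \<open>B\<close> vanish for i outside V, since a vertex moves only with its own facets.\<close>
  define C where "C = (\<lambda>(l, V). lam l * (fact (k l) / fact (k l + ?n) * vcoeff (\<xi> l) V))"
  define A where "A = (\<lambda>(l, V). complex_of_real (\<xi> l \<bullet> vert V))"
  define B where "B = (\<lambda>(l, V) i. if i \<in> V then - complex_of_real (\<xi> l \<bullet> \<alpha> V i) else 0)"
  define d where "d = (\<lambda>(l, V :: nat set). k l + ?n)"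
  define S where "S = L \<times> VV"
  let ?J = "\<lambda>h. LINT x:{x. \<forall>i\<in>I. x \<bullet> lat (U i) + c i + h i \<ge> 0}|lborel. f x"
  have J: "?J h = aff_pow r C A B d S h" if h: "h \<in> near0 r \<epsilon>" for h
  proof -
    interpret hs: lattice_vertex_system I U VV \<alpha> "\<lambda>i. c i + h i" e
      unfolding lattice_vertex_system_def using h by (intro \<epsilon>(2)) (auto simp: near0_def I)
    have hell: "hs.ell i x = x \<bullet> lat (U i) + c i + h i" for i x by (simp add: hs.ell_def)
    have hvert: "\<xi> l \<bullet> hs.vert V = \<xi> l \<bullet> vert V - (\<Sum>i\<in>V. h i * (\<xi> l \<bullet> \<alpha> V i))" for l V
      by (simp add: hs.vert_def vert_def scaleR_add_left sum.distrib inner_diff_right inner_sum_right)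
    let ?A = "{x. \<forall>i\<in>I. hs.ell i x \<ge> 0}"
    have int: "set_integrable lborel ?A (\<lambda>x. complex_of_real ((\<xi> l \<bullet> x) ^ k l))" for l
      by (intro set_integrable_power hs.polytope_borel hs.bounded_polytope)
    have "?J h = (LINT x:?A|lborel. (\<Sum>l\<in>L. lam l * complex_of_real ((\<xi> l \<bullet> x) ^ k l)))"
      by (simp add: hell f)
    also have "\<dots> = (\<Sum>l\<in>L. LINT x:?A|lborel. lam l * complex_of_real ((\<xi> l \<bullet> x) ^ k l))"
      unfolding set_lebesgue_integral_def scaleR_sum_right
      using set_integrable_mult_right[OF int] by (intro Bochner_Integration.integral_sum) (simp add: set_integrable_def)
    also have "\<dots> = (\<Sum>l\<in>L. lam l * (LINT x:?A|lborel. complex_of_real ((\<xi> l \<bullet> x) ^ k l)))"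
      by simp
    also have "\<dots> = (\<Sum>l\<in>L. lam l * (fact (k l) / fact (k l + ?n) *
       (\<Sum>V\<in>VV. vcoeff (\<xi> l) V * complex_of_real (\<xi> l \<bullet> hs.vert V) ^ (k l + ?n))))"
      using L(2) by (intro sum.cong refl) (simp only: hs.power_integral)
    also have "\<dots> = (\<Sum>l\<in>L. \<Sum>V\<in>VV. C (l, V) * complex_of_real (\<xi> l \<bullet> hs.vert V) ^ d (l, V))"
      by (simp add: C_def d_def sum_distrib_left mult.assoc)
    also have "\<dots> = aff_pow r C A B d S h"
      unfolding aff_pow_def S_def sum.cartesian_product
    proof (intro sum.cong refl, clarify)
      fix l V assume V: "V \<in> VV"
      have "(\<Sum>i\<in>{1..r}. B (l, V) i * complex_of_real (h i)) = (\<Sum>i\<in>V. - complex_of_real (\<xi> l \<bullet> \<alpha> V i) * complex_of_real (h i))"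
        using VV_sub[OF V] I by (intro sum.mono_neutral_cong_right) (auto simp: B_def)
      then have "complex_of_real (\<xi> l \<bullet> hs.vert V) = A (l, V) + (\<Sum>i\<in>{1..r}. B (l, V) i * complex_of_real (h i))"
        by (simp add: A_def hvert sum_negf mult.commute)
      then show "C (l, V) * complex_of_real (\<xi> l \<bullet> hs.vert V) ^ d (l, V) =
        C (l, V) * (A (l, V) + (\<Sum>i\<in>{1..r}. B (l, V) i * complex_of_real (h i))) ^ d (l, V)" by simp
    qed
    finally show ?thesis .
  qed
  define val where "val l V \<beta> = fact (k l) / fact (k l + ?n) * vcoeff (\<xi> l) V * ffact (k l + ?n) (sum \<beta> V) *
        (\<Prod>i\<in>V. (- complex_of_real (\<xi> l \<bullet> \<alpha> V i)) ^ \<beta> i) * complex_of_real (\<xi> l \<bullet> vert V) ^ (k l + ?n - sum \<beta> V)"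
    for l V \<beta>
  define TV where "TV V \<beta> = (\<Sum>g\<in>vchars V. \<Prod>i\<in>V. factor_poly (?w i) (g i) (\<beta> i))" for V \<beta>
  have "apply_at_zero r (T_op ?n r K GG) ?J = (\<Sum>s\<in>S. \<Sum>\<beta>\<in>PiE {1..r} (\<lambda>_. {..D}). T_op ?n r K GG \<beta> *
    scal (C s * ffact (d s) (sum \<beta> {1..r}) * (\<Prod>i\<in>{1..r}. B s i ^ \<beta> i) * A s ^ (d s - sum \<beta> {1..r})))"
    by (rule apply_at_zero_aff_pow[OF J \<epsilon>(1)]) (auto simp: S_def d_def D)
  also have "\<dots> = (\<Sum>(l, V)\<in>S. \<Sum>\<beta>\<in>PiE V (\<lambda>_. {..D}). to_fract (TV V \<beta>) * scal (lam l * val l V \<beta>))"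
  proof (rule sum.cong[OF refl], clarify)
    fix l V assume "(l, V) \<in> S"
    then have V: "V \<in> VV" by (simp add: S_def)
    have VI: "V \<subseteq> {1..r}" using VV_sub[OF V] I by simp
    let ?e = "\<lambda>\<beta> i. if i \<in> V then \<beta> i else if i \<in> {1..r} then 0 else undefined"
    have "(\<Sum>\<beta>\<in>PiE {1..r} (\<lambda>_. {..D}). T_op ?n r K GG \<beta> *
      scal (C (l, V) * ffact (d (l, V)) (sum \<beta> {1..r}) * (\<Prod>i\<in>{1..r}. B (l, V) i ^ \<beta> i) * A (l, V) ^ (d (l, V) - sum \<beta> {1..r}))) =
      (\<Sum>\<beta>\<in>PiE V (\<lambda>_. {..D}). T_op ?n r K GG (?e \<beta>) *
      scal (C (l, V) * ffact (d (l, V)) (sum (?e \<beta>) {1..r}) * (\<Prod>i\<in>{1..r}. B (l, V) i ^ (?e \<beta>) i) * A (l, V) ^ (d (l, V) - sum (?e \<beta>) {1..r})))"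
    \<comment> \<open>A derivative in a variable outside V produces a positive power of a vanishing
      coefficient.\<close>
    proof (rule sum_PiE_support)
      fix \<beta> :: "nat \<Rightarrow> nat" assume "\<exists>i\<in>{1..r}-V. \<beta> i \<noteq> 0"
      then obtain i where "i \<in> {1..r}" "i \<notin> V" "\<beta> i \<noteq> 0" by auto
      then have "(\<Prod>i\<in>{1..r}. B (l, V) i ^ \<beta> i) = 0"
        by (intro prod_zero) (auto simp: B_def intro!: bexI[of _ i])
      then show "T_op ?n r K GG \<beta> *
      scal (C (l, V) * ffact (d (l, V)) (sum \<beta> {1..r}) * (\<Prod>i\<in>{1..r}. B (l, V) i ^ \<beta> i) * A (l, V) ^ (d (l, V) - sum \<beta> {1..r})) = 0"
        by (simp only: mult_zero_left mult_zero_right scal_0)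
    qed (use VI in auto)
    also have "\<dots> = (\<Sum>\<beta>\<in>PiE V (\<lambda>_. {..D}). to_fract (TV V \<beta>) * scal (lam l * val l V \<beta>))"
    proof (rule sum.cong[OF refl])
      fix \<beta> :: "nat \<Rightarrow> nat"
      have T: "T_op ?n r K GG (?e \<beta>) = to_fract (TV V \<beta>)"
      proof -
        have "T_op ?n r K GG (?e \<beta>) = to_fract (\<Sum>g | g \<in> GG \<and> (\<forall>i\<in>{1..r}-V. g i = 1). \<Prod>i\<in>V. factor_poly (?w i) (g i) (?e \<beta> i))"
          using VV_card[OF V] by (intro T_op_vertex[OF K GG(1) VI]) auto
        then show ?thesis unfolding GG(2)[OF V] TV_def by simp
      qed
      have s: "sum (?e \<beta>) {1..r} = sum \<beta> V"
        using VI by (intro sum.mono_neutral_cong_right) auto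
      have p: "(\<Prod>i\<in>{1..r}. B (l, V) i ^ (?e \<beta>) i) = (\<Prod>i\<in>V. (- complex_of_real (\<xi> l \<bullet> \<alpha> V i)) ^ \<beta> i)"
        using VI by (intro prod.mono_neutral_cong_right) (auto simp: B_def)
      show "T_op ?n r K GG (?e \<beta>) *
      scal (C (l, V) * ffact (d (l, V)) (sum (?e \<beta>) {1..r}) * (\<Prod>i\<in>{1..r}. B (l, V) i ^ (?e \<beta>) i) * A (l, V) ^ (d (l, V) - sum (?e \<beta>) {1..r})) =
        to_fract (TV V \<beta>) * scal (lam l * val l V \<beta>)"
        unfolding T s p by (simp add: C_def d_def A_def val_def mult.assoc)
    qed
    finally show "(\<Sum>\<beta>\<in>PiE {1..r} (\<lambda>_. {..D}). T_op ?n r K GG \<beta> *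
      scal (C (l, V) * ffact (d (l, V)) (sum \<beta> {1..r}) * (\<Prod>i\<in>{1..r}. B (l, V) i ^ \<beta> i) * A (l, V) ^ (d (l, V) - sum \<beta> {1..r}))) =
      (\<Sum>\<beta>\<in>PiE V (\<lambda>_. {..D}). to_fract (TV V \<beta>) * scal (lam l * val l V \<beta>))" .
  qed
  also have "\<dots> = to_fract (\<Sum>(l, V)\<in>S. \<Sum>\<beta>\<in>PiE V (\<lambda>_. {..D}). TV V \<beta> * [:lam l * val l V \<beta>:])"
    by (simp only: to_fract_sum to_fract_mult scal_def case_prod_unfold)
  also have "(\<Sum>(l, V)\<in>S. \<Sum>\<beta>\<in>PiE V (\<lambda>_. {..D}). TV V \<beta> * [:lam l * val l V \<beta>:]) =
      (\<Sum>m\<in>?M. weight_poly K (lat m) * [:f (lat m):])" (is "?p = ?q")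
  proof (rule ccontr)
    assume "?p \<noteq> ?q"
    then have "finite {y. poly (?p - ?q) y = 0}" by (intro poly_roots_finite) simp
    \<comment> \<open>Two polynomials in y that agree at all y \<noteq> -1 are equal. The excluded
      value is where q = 0 and \<open>weight\<close> cannot be formed.\<close>
    moreover have "UNIV - {- 1} \<subseteq> {y. poly (?p - ?q) y = 0}"
    proof
      fix y :: complex assume "y \<in> UNIV - {- 1}"
      then have y: "y \<noteq> - 1" "1 + y \<noteq> 0" by (auto simp: add_eq_0_iff)
      have "poly ?p y = (\<Sum>l\<in>L. lam l * (\<Sum>V\<in>VV. \<Sum>\<beta>\<in>PiE V (\<lambda>_. {..D}).
          (\<Sum>g\<in>vchars V. \<Prod>i\<in>V. fps_nth (op_factor (1 + y) (?w i) (g i)) (\<beta> i)) * val l V \<beta>))"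
        unfolding S_def sum.cartesian_product[symmetric]
        by (simp add: poly_sum poly_prod TV_def poly_factor_poly sum_distrib_left mult_ac)
      also have "\<dots> = (\<Sum>l\<in>L. lam l * (\<Sum>m\<in>?M. weight (1 + y) ?w m * complex_of_real ((\<xi> l \<bullet> lat m) ^ k l)))"
        unfolding val_def using L(2) D y lattice
        by (intro sum.cong refl arg_cong2[where f="(*)"] lattice_sum_coeff) auto
      also have "\<dots> = (\<Sum>m\<in>?M. weight (1 + y) ?w m * f (lat m))"
        unfolding f sum_distrib_left by (subst sum.swap) (simp add: mult_ac)
      also have "\<dots> = (\<Sum>m\<in>?M. poly (weight_poly K (lat m)) y * f (lat m))"
        using y by (intro sum.cong refl) (simp add: poly_weight_poly)
      also have "\<dots> = poly ?q y" by (simp add: poly_sum mult.commute)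
      finally show "y \<in> {y. poly (?p - ?q) y = 0}" by simp
    qed
    ultimately have "finite (UNIV - {- 1 :: complex})" by (rule rev_finite_subset)
    then show False using infinite_UNIV_char_0 by (metis finite_Diff2 finite.emptyI finite_insert)
  qed
  finally show ?thesis by (simp only: to_fract_sum to_fract_mult scal_def)
qed

end


section \<open>Polynomials as combinations of powers of linear forms\<close>

text \<open>The linear span of the powers of linear forms from X. Lists of terms allow repetitions,
  so addition is concatenation.\<close>

definition power_span :: "'a::euclidean_space set \<Rightarrow> ('a \<Rightarrow> complex) \<Rightarrow> bool" where
  "power_span X f \<longleftrightarrow> (\<exists>ts. (\<forall>(a, \<xi>, k)\<in>set ts. \<xi> \<in> X) \<and>
     (\<forall>x. f x = (\<Sum>(a, \<xi>, k)\<leftarrow>ts. a * complex_of_real ((\<xi> \<bullet> x) ^ k))))"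

lemma power_span_power: "\<xi> \<in> X \<Longrightarrow> power_span X (\<lambda>x. complex_of_real ((\<xi> \<bullet> x) ^ k))"
  unfolding power_span_def by (intro exI[of _ "[(1, \<xi>, k)]"]) simp

lemma power_span_0: "power_span X (\<lambda>x. 0)"
  unfolding power_span_def by (intro exI[of _ "[]"]) simp

lemma power_span_add:
  assumes "power_span X f" "power_span X g"
  shows "power_span X (\<lambda>x. f x + g x)"
proof -
  obtain ts us where "\<forall>(a, \<xi>, k)\<in>set ts. \<xi> \<in> X" "\<forall>x. f x = (\<Sum>(a, \<xi>, k)\<leftarrow>ts. a * complex_of_real ((\<xi> \<bullet> x) ^ k))"
    "\<forall>(a, \<xi>, k)\<in>set us. \<xi> \<in> X" "\<forall>x. g x = (\<Sum>(a, \<xi>, k)\<leftarrow>us. a * complex_of_real ((\<xi> \<bullet> x) ^ k))"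
    using assms unfolding power_span_def by blast
  then show ?thesis unfolding power_span_def by (intro exI[of _ "ts @ us"]) auto
qed

lemma power_span_scale:
  assumes "power_span X f"
  shows "power_span X (\<lambda>x. c * f x)"
proof -
  obtain ts where ts: "\<forall>(a, \<xi>, k)\<in>set ts. \<xi> \<in> X" "\<And>x. f x = (\<Sum>(a, \<xi>, k)\<leftarrow>ts. a * complex_of_real ((\<xi> \<bullet> x) ^ k))"
    using assms unfolding power_span_def by blast
  let ?us = "map (\<lambda>(a, \<xi>, k). (c * a, \<xi>, k)) ts"
  have "c * f x = (\<Sum>(a, \<xi>, k)\<leftarrow>?us. a * complex_of_real ((\<xi> \<bullet> x) ^ k))" for x
    unfolding ts(2) by (simp add: sum_list_const_mult[symmetric] o_def case_prod_unfold mult.assoc)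
  moreover have "\<forall>(a, \<xi>, k)\<in>set ?us. \<xi> \<in> X" using ts(1) by auto
  ultimately show ?thesis unfolding power_span_def by blast
qed

lemma power_span_sum:
  assumes "\<And>i. i \<in> S \<Longrightarrow> power_span X (f i)"
  shows "power_span X (\<lambda>x. \<Sum>i\<in>S. f i x)"
  using assms by (induction S rule: infinite_finite_induct) (auto intro: power_span_add power_span_0)

lemma power_span_list_induct:
  assumes "power_span X f"
    and pow: "\<And>\<xi> k. \<xi> \<in> X \<Longrightarrow> Q (\<lambda>x. complex_of_real ((\<xi> \<bullet> x) ^ k))"
    and zero: "Q (\<lambda>x. 0)" and add: "\<And>f g. Q f \<Longrightarrow> Q g \<Longrightarrow> Q (\<lambda>x. f x + g x)"
    and scale: "\<And>c f. Q f \<Longrightarrow> Q (\<lambda>x. c * f x)"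
  shows "Q f"
proof -
  obtain ts where ts: "\<forall>(a, \<xi>, k)\<in>set ts. \<xi> \<in> X" "\<And>x. f x = (\<Sum>(a, \<xi>, k)\<leftarrow>ts. a * complex_of_real ((\<xi> \<bullet> x) ^ k))"
    using assms(1) unfolding power_span_def by blast
  have "Q (\<lambda>x. \<Sum>(a, \<xi>, k)\<leftarrow>ts. a * complex_of_real ((\<xi> \<bullet> x) ^ k))"
    using ts(1)
  proof (induction ts)
    case Nil
    then show ?case using zero by simp
  next
    case (Cons t ts)
    obtain a \<xi> k where t: "t = (a, \<xi>, k)" by (cases t)
    have "Q (\<lambda>x. a * complex_of_real ((\<xi> \<bullet> x) ^ k))" using Cons.prems t by (intro scale pow) auto
    moreover have "Q (\<lambda>x. \<Sum>(a, \<xi>, k)\<leftarrow>ts. a * complex_of_real ((\<xi> \<bullet> x) ^ k))" using Cons by auto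
    ultimately show ?case unfolding t using add by fastforce
  qed
  moreover have "f = (\<lambda>x. \<Sum>(a, \<xi>, k)\<leftarrow>ts. a * complex_of_real ((\<xi> \<bullet> x) ^ k))"
    by (rule ext) (rule ts(2))
  ultimately show ?thesis by (simp only:)
qed

text \<open>Lagrange interpolation: the coefficients of a polynomial are fixed linear combinations
  of its values at sufficiently many points.\<close>

lemma power_span_coeff:
  assumes inf: "infinite (T :: complex set)"
    and sp: "\<And>s. s \<in> T \<Longrightarrow> power_span X (\<lambda>x. \<Sum>j\<le>k. s ^ j * g j x)" and "j \<le> k"
  shows "power_span X (g j)"
proof -
  obtain A where A: "finite A" "card A = Suc k" "A \<subseteq> T" using infinite_arbitrarily_large[OF inf] by blast
  \<comment> \<open>The Lagrange basis polynomials for the nodes A.\<close>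
  define l where "l s = (\<Prod>t\<in>A-{s}. smult (1 / (s - t)) [:- t, 1:])" for s
  have l: "poly (l s) t = (if s = t then 1 else 0)" if "s \<in> A" "t \<in> A" for s t
  proof (cases "s = t")
    case True
    have "poly (l s) s = (\<Prod>t\<in>A-{s}. 1)" unfolding l_def poly_prod by (intro prod.cong) (auto simp: divide_simps)
    then show ?thesis using True by simp
  next
    case False
    then show ?thesis using that A(1) by (auto simp: l_def poly_prod intro!: prod_zero bexI[of _ t])
  qed
  have dl: "degree (l s) \<le> k" if "s \<in> A" for s
  proof -
    have "degree (l s) \<le> (\<Sum>t\<in>A-{s}. degree (smult (1 / (s - t)) [:- t, 1:]))"
      unfolding l_def using degree_prod_sum_le[of "A - {s}" "\<lambda>t. smult (1 / (s - t)) [:- t, 1:]"] A(1) by (simp add: o_def)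
    also have "\<dots> \<le> (\<Sum>t\<in>A-{s}. 1)" by (intro sum_mono) simp
    also have "\<dots> = k" using A that by simp
    finally show ?thesis .
  qed
  have "g j x = (\<Sum>s\<in>A. coeff (l s) j * (\<Sum>i\<le>k. s ^ i * g i x))" for x
  proof -
    define p where "p = (\<Sum>i\<le>k. monom (g i x) i)"
    have dp: "degree p \<le> k" unfolding p_def by (intro degree_sum_le) (auto intro: order_trans[OF degree_monom_le])
    have val: "poly p s = (\<Sum>i\<le>k. s ^ i * g i x)" for s
      by (simp add: p_def poly_sum poly_monom mult.commute)
    have "p = (\<Sum>s\<in>A. smult (poly p s) (l s))"
    proof (rule poly_eqI_degree[of A])
      fix t assume t: "t \<in> A"
      have "poly (\<Sum>s\<in>A. smult (poly p s) (l s)) t = (\<Sum>s\<in>A. if s = t then poly p t else 0)"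
        unfolding poly_sum by (intro sum.cong) (auto simp: l t)
      then show "poly p t = poly (\<Sum>s\<in>A. smult (poly p s) (l s)) t" using t A(1) by simp
    next
      have "degree (\<Sum>s\<in>A. smult (poly p s) (l s)) \<le> k"
        using A(1) dl by (intro degree_sum_le) (auto intro: order_trans[OF degree_smult_le])
      then show "degree (\<Sum>s\<in>A. smult (poly p s) (l s)) < card A" using A by simp
    qed (use dp A in auto)
    then have "coeff p j = (\<Sum>s\<in>A. poly p s * coeff (l s) j)" by (metis (no_types, lifting) coeff_smult coeff_sum sum.cong)
    moreover have "coeff p j = g j x" using \<open>j \<le> k\<close> by (simp add: p_def coeff_sum)
    ultimately show ?thesis by (simp add: val mult.commute)
  qed
  then have "g j = (\<lambda>x. \<Sum>s\<in>A. coeff (l s) j * (\<Sum>i\<le>k. s ^ i * g i x))" by (rule ext)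
  moreover have "power_span X (\<lambda>x. \<Sum>s\<in>A. coeff (l s) j * (\<Sum>i\<le>k. s ^ i * g i x))"
  proof (rule power_span_sum, rule power_span_scale)
    fix s assume "s \<in> A"
    then show "power_span X (\<lambda>x. \<Sum>i\<le>k. s ^ i * g i x)" using A(3) by (intro sp) auto
  qed
  ultimately show ?thesis by simp
qed

text \<open>By the binomial theorem the k-th power of \<xi> + s \<eta> is a polynomial in s whose
  coefficients are, up to binomial factors, the required products. Infinitely many admissible s
  suffice to extract them.\<close>

lemma power_span_two:
  fixes \<xi> \<eta> :: "'a::euclidean_space"
  assumes inf: "infinite {s::real. \<xi> + s *\<^sub>R \<eta> \<in> X}" and "j \<le> k"
  shows "power_span X (\<lambda>x. complex_of_real ((\<xi> \<bullet> x) ^ (k - j) * (\<eta> \<bullet> x) ^ j))"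
proof -
  let ?g = "\<lambda>j x. of_nat (k choose j) * complex_of_real ((\<xi> \<bullet> x) ^ (k - j) * (\<eta> \<bullet> x) ^ j)"
  have "power_span X (?g j)"
  proof (rule power_span_coeff[OF _ _ \<open>j \<le> k\<close>])
    show "infinite (complex_of_real ` {s::real. \<xi> + s *\<^sub>R \<eta> \<in> X})"
      using inf by (subst finite_image_iff) (auto simp: inj_on_def)
    fix s assume "s \<in> complex_of_real ` {s::real. \<xi> + s *\<^sub>R \<eta> \<in> X}"
    then obtain t where t: "s = complex_of_real t" "\<xi> + t *\<^sub>R \<eta> \<in> X" by auto
    have "complex_of_real (((\<xi> + t *\<^sub>R \<eta>) \<bullet> x) ^ k) = (\<Sum>j\<le>k. s ^ j * ?g j x)" for x
    proof -
      have "((\<xi> + t *\<^sub>R \<eta>) \<bullet> x) ^ k = (t * (\<eta> \<bullet> x) + \<xi> \<bullet> x) ^ k" by (simp add: inner_add_left add.commute)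
      also have "\<dots> = (\<Sum>j\<le>k. of_nat (k choose j) * (t * (\<eta> \<bullet> x)) ^ j * (\<xi> \<bullet> x) ^ (k - j))"
        by (rule binomial_ring)
      finally show ?thesis by (simp add: t(1) power_mult_distrib mult_ac)
    qed
    then show "power_span X (\<lambda>x. \<Sum>j\<le>k. s ^ j * ?g j x)"
      using power_span_power[OF t(2), of k] by simp
  qed
  from power_span_scale[OF this, of "1 / of_nat (k choose j)"]
  show ?thesis using \<open>j \<le> k\<close> by (simp add: binomial_eq_0_iff)
qed

text \<open>With all vectors admissible, \<open>power_span_two\<close> covers products of two
  powers; bilinearity does the rest.\<close>

lemma power_span_mult:
  assumes "power_span UNIV f" "power_span UNIV g"
  shows "power_span UNIV (\<lambda>x. f x * g x)"
proof -
  have pp: "power_span UNIV (\<lambda>x. complex_of_real ((\<xi> \<bullet> x) ^ a) * complex_of_real ((\<eta> \<bullet> x) ^ b))" for \<xi> \<eta> :: 'a and a b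
    using power_span_two[of \<xi> \<eta> UNIV b "a + b"] by (simp add: infinite_UNIV_char_0)
  have "power_span UNIV (\<lambda>x. complex_of_real ((\<xi> \<bullet> x) ^ a) * g x)" for \<xi> a
    using assms(2)
  proof (induction rule: power_span_list_induct[where Q="\<lambda>g. power_span UNIV (\<lambda>x. complex_of_real ((\<xi> \<bullet> x) ^ a) * g x)", consumes 1])
    case (4 c f)
    then show ?case using power_span_scale[OF 4, of c] by (simp add: mult.left_commute)
  qed (use pp power_span_0 power_span_add in \<open>auto simp: distrib_left simp del: of_real_power\<close>)
  note pg = this
  show ?thesis using assms(1)
  proof (induction rule: power_span_list_induct[where Q="\<lambda>f. power_span UNIV (\<lambda>x. f x * g x)", consumes 1])
    case (4 c f)
    then show ?case using power_span_scale[OF 4, of c] by (simp add: mult.assoc)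
  qed (use pg power_span_0 power_span_add in \<open>auto simp: distrib_right simp del: of_real_power\<close>)
qed

lemma power_span_const: "power_span UNIV (\<lambda>x. c)"
  using power_span_scale[OF power_span_power[of 0 UNIV 0], of c] by simp

lemma power_span_real_polynomial:
  fixes p :: "'a::euclidean_space \<Rightarrow> real"
  assumes "real_polynomial_function p"
  shows "power_span UNIV (\<lambda>x. complex_of_real (p x))"
  using assms
proof induction
  case (linear f)
  then interpret bounded_linear f .
  define \<xi> where "\<xi> = (\<Sum>b\<in>Basis. f b *\<^sub>R b)"
  have "f x = \<xi> \<bullet> x" for x
  proof -
    have "f x = f (\<Sum>b\<in>Basis. (x \<bullet> b) *\<^sub>R b)" by (simp add: euclidean_representation)
    also have "\<dots> = (\<Sum>b\<in>Basis. (x \<bullet> b) * f b)" by (simp add: sum scaleR)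
    also have "\<dots> = \<xi> \<bullet> x" by (simp add: \<xi>_def inner_sum_left inner_commute[of x] mult.commute)
    finally show ?thesis .
  qed
  then show ?case using power_span_power[of \<xi> UNIV 1] by simp
next
  case (add f g)
  then show ?case using power_span_add by fastforce
next
  case (mult f g)
  then show ?case using power_span_mult by fastforce
qed (rule power_span_const)

lemma power_span_polynomial:
  fixes f :: "'a::euclidean_space \<Rightarrow> complex"
  assumes "polynomial_function f"
  shows "power_span UNIV f"
proof -
  have "real_polynomial_function (Re \<circ> f)" "real_polynomial_function (Im \<circ> f)"
    using assms bounded_linear_Re bounded_linear_Im unfolding polynomial_function_def by auto
  then have "power_span UNIV (\<lambda>x. complex_of_real ((Re \<circ> f) x) + \<i> * complex_of_real ((Im \<circ> f) x))"
    by (intro power_span_add power_span_scale power_span_real_polynomial)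
  moreover have "(\<lambda>x. complex_of_real ((Re \<circ> f) x) + \<i> * complex_of_real ((Im \<circ> f) x)) = f"
    by (auto simp: fun_eq_iff complex_eq_iff)
  ultimately show ?thesis by simp
qed

text \<open>Perturb \<xi> along a vector \<eta> that avoids all hyperplanes: all but finitely many
  \<xi> + s \<eta> avoid them too. The coefficient of s^0 extracted by \<open>power_span_two\<close>
  is the original power.\<close>

lemma power_span_generic:
  fixes f :: "'a::euclidean_space \<Rightarrow> complex"
  assumes D: "finite D" "0 \<notin> D" and f: "power_span UNIV f"
  shows "power_span {\<xi>. \<forall>d\<in>D. \<xi> \<bullet> d \<noteq> 0} f"
  using f
proof (induction rule: power_span_list_induct[consumes 1])
  case (1 \<xi> k)
  obtain \<eta> where \<eta>: "\<And>d. d \<in> D \<Longrightarrow> \<eta> \<bullet> d \<noteq> 0"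
    using open_avoid_hyperplanes[OF D, of UNIV] by auto
  have "infinite {s::real. \<xi> + s *\<^sub>R \<eta> \<in> {\<xi>. \<forall>d\<in>D. \<xi> \<bullet> d \<noteq> 0}}"
  proof
    assume "finite {s::real. \<xi> + s *\<^sub>R \<eta> \<in> {\<xi>. \<forall>d\<in>D. \<xi> \<bullet> d \<noteq> 0}}"
    moreover have "UNIV \<subseteq> {s::real. \<xi> + s *\<^sub>R \<eta> \<in> {\<xi>. \<forall>d\<in>D. \<xi> \<bullet> d \<noteq> 0}} \<union> (\<lambda>d. - (\<xi> \<bullet> d) / (\<eta> \<bullet> d)) ` D"
    proof
      fix s :: real
      show "s \<in> {s::real. \<xi> + s *\<^sub>R \<eta> \<in> {\<xi>. \<forall>d\<in>D. \<xi> \<bullet> d \<noteq> 0}} \<union> (\<lambda>d. - (\<xi> \<bullet> d) / (\<eta> \<bullet> d)) ` D"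
      proof (cases "\<exists>d\<in>D. (\<xi> + s *\<^sub>R \<eta>) \<bullet> d = 0")
        case True
        then obtain d where d: "d \<in> D" "\<xi> \<bullet> d + s * (\<eta> \<bullet> d) = 0" by (auto simp: inner_add_left)
        then have "s = - (\<xi> \<bullet> d) / (\<eta> \<bullet> d)" using \<eta>[OF d(1)] by (simp add: field_simps add_eq_0_iff)
        then show ?thesis using d(1) by blast
      qed auto
    qed
    ultimately have "finite (UNIV :: real set)" using D(1) by (meson finite_UnI finite_imageI finite_subset)
    then show False by (simp add: infinite_UNIV_char_0)
  qed
  from power_span_two[OF this, of 0 k] show ?case by simp
qed (auto intro: power_span_0 power_span_add power_span_scale)

lemma polynomial_generic_powers:
  fixes f :: "'a::euclidean_space \<Rightarrow> complex"
  assumes D: "finite D" "0 \<notin> D" and f: "polynomial_function f"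
  obtains N :: nat and \<xi> k lam where "\<And>l d. l < N \<Longrightarrow> d \<in> D \<Longrightarrow> \<xi> l \<bullet> d \<noteq> 0"
    "\<And>x. f x = (\<Sum>l<N. lam l * complex_of_real ((\<xi> l \<bullet> x) ^ k l))"
proof -
  obtain ts where ts: "\<forall>(a, \<xi>, k)\<in>set ts. \<forall>d\<in>D. \<xi> \<bullet> d \<noteq> 0"
    "\<And>x. f x = (\<Sum>(a, \<xi>, k)\<leftarrow>ts. a * complex_of_real ((\<xi> \<bullet> x) ^ k))"
    using power_span_generic[OF D power_span_polynomial[OF f]] unfolding power_span_def by auto
  show ?thesis
  proof (rule that[of "length ts" "\<lambda>l. fst (snd (ts ! l))" "\<lambda>l. fst (ts ! l)" "\<lambda>l. snd (snd (ts ! l))"])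
    show "fst (snd (ts ! l)) \<bullet> d \<noteq> 0" if "l < length ts" "d \<in> D" for l d
      using ts(1) nth_mem[OF that(1)] that(2) by (auto simp: case_prod_unfold)
    show "f x = (\<Sum>l<length ts. fst (ts ! l) * complex_of_real ((fst (snd (ts ! l)) \<bullet> x) ^ snd (snd (ts ! l))))" for x
      unfolding ts(2) sum_list_sum_nth by (simp add: case_prod_unfold atLeast0LessThan)
  qed
qed


section \<open>Vertices, edges and faces of a simple lattice polytope\<close>

locale simple_lattice_polytope =
  fixes P :: "(real ^ 'n) set" and r :: nat and F :: "nat \<Rightarrow> (real ^ 'n) set"
    and u :: "nat \<Rightarrow> int ^ 'n" and c :: "nat \<Rightarrow> int"
  assumes lattice: "lattice_polytope P"
    and full: "aff_dim P = int CARD('n)"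
    and simple: "simple_polytope P"
    and bij: "bij_betw F {1..r} {E. E facet_of P}"
    and ray: "\<And>i. i \<in> {1..r} \<Longrightarrow> is_ray_generator (inner_normal_cone P (F i)) (u i)"
    and hrep: "P = shifted_polytope r u c (\<lambda>_. 0)"
begin

definition el :: "nat \<Rightarrow> real ^ 'n \<Rightarrow> real" where
  "el i x = x \<bullet> lat (u i) + of_int (c i)"

lemma P_iff: "x \<in> P \<longleftrightarrow> (\<forall>i\<in>{1..r}. el i x \<ge> 0)"
  by (subst hrep) (simp add: shifted_polytope_def el_def)

lemma el_nonneg: "x \<in> P \<Longrightarrow> i \<in> {1..r} \<Longrightarrow> el i x \<ge> 0"
  using P_iff by blast

lemma polytope: "polytope P"
  using lattice unfolding lattice_polytope_def polytope_def by blast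

lemma convex_P: "convex P" by (rule polytope_imp_convex[OF polytope])
lemma compact_P: "compact P" by (rule polytope_imp_compact[OF polytope])
lemma P_ne: "P \<noteq> {}" using full by auto

lemma el_comb: "el i ((1 - t) *\<^sub>R x + t *\<^sub>R y) = (1 - t) * el i x + t * el i y"
  by (simp add: el_def inner_add_left algebra_simps)

lemma el_add: "el i (x + y) = el i x + y \<bullet> lat (u i)"
  by (simp add: el_def inner_add_left)

lemma face_el: "i \<in> {1..r} \<Longrightarrow> P \<inter> {x. el i x = 0} face_of P"
proof -
  assume i: "i \<in> {1..r}"
  have "P \<inter> {x. lat (u i) \<bullet> x = - of_int (c i)} face_of P"
    using el_nonneg[OF _ i] by (intro face_of_Int_supporting_hyperplane_ge convex_P) (force simp: el_def inner_commute)
  moreover have "{x. lat (u i) \<bullet> x = - of_int (c i)} = {x. el i x = 0}"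
    by (auto simp: el_def inner_commute)
  ultimately show ?thesis by simp
qed

lemma F_facet: "i \<in> {1..r} \<Longrightarrow> F i facet_of P"
  using bij_betw_imp_surj_on[OF bij] by blast

lemma u_in_cone:
  assumes "i \<in> {1..r}"
  shows "lat (u i) \<in> inner_normal_cone P (F i)"
proof -
  have "real 1 *\<^sub>R lat (u i) \<in> range (\<lambda>k::nat. real k *\<^sub>R lat (u i))" by (rule rangeI)
  then show ?thesis using ray[OF assms] unfolding is_ray_generator_def by auto
qed

text \<open>Aff-dimension strictly increases along proper inclusions of faces, and between a facet
  and P there is no integer left.\<close>

lemma facet_of_maximal:
  assumes "E facet_of P" "E \<subseteq> E'" "E' face_of P" "E' \<noteq> P"
  shows "E = E'"
proof (rule ccontr)
  assume "E \<noteq> E'"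
  have "E face_of E'" using assms by (meson face_of_subset facet_of_imp_face_of face_of_imp_subset)
  then have "aff_dim E < aff_dim E'"
    using \<open>E \<noteq> E'\<close> assms(3) convex_P face_of_imp_convex by (intro face_of_aff_dim_lt) auto
  moreover have "aff_dim E' < aff_dim P" using assms convex_P by (intro face_of_aff_dim_lt) auto
  moreover have "aff_dim E = aff_dim P - 1" using assms(1) by (simp add: facet_of_def)
  ultimately show False by linarith
qed

text \<open>The inequalities must first be matched with the facets. A relative interior point of F k
  is not interior to P, so some constraint j with nonzero normal is tight there; its face contains F
  k and hence equals it. As u j lies in the normal cone of F j, that face also contains F j, so F j
  = F k and j = k.\<close>

lemma u_nonzero_and_F_eq:
  assumes k: "k \<in> {1..r}"
  shows "lat (u k) \<noteq> 0" and "F k = P \<inter> {x. el k x = 0}"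
proof -
  have Fk: "F k face_of P" "F k \<noteq> {}" "F k \<noteq> P"
    using F_facet[OF k] by (auto simp: facet_of_def)
  then have "rel_interior (F k) \<noteq> {}"
    using convex_P face_of_imp_convex rel_interior_eq_empty by metis
  then obtain q where q: "q \<in> rel_interior (F k)" by blast
  then have qP: "q \<in> P" using rel_interior_subset Fk(1) face_of_imp_subset by blast
  have "\<exists>j\<in>{1..r}. lat (u j) \<noteq> 0 \<and> el j q = 0"
  proof (rule ccontr)
    assume "\<not> ?thesis"
    then have pos: "el j q > 0" if "j \<in> {1..r}" "lat (u j) \<noteq> 0" for j
      using that el_nonneg[OF qP that(1)] by force
    define T where "T = (\<Inter>j\<in>{j\<in>{1..r}. lat (u j) \<noteq> 0}. {x. el j x > 0})"
    have "open T" unfolding T_def el_def by (intro open_INT) (auto intro!: open_Collect_less continuous_intros)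
    moreover have "T \<subseteq> P"
    proof
      fix x assume "x \<in> T"
      have "el j x \<ge> 0" if "j \<in> {1..r}" for j
      proof (cases "lat (u j) = 0")
        case True
        then show ?thesis using el_nonneg[OF qP that] by (simp add: el_def)
      next
        case False
        then show ?thesis using \<open>x \<in> T\<close> that by (force simp: T_def)
      qed
      then show "x \<in> P" by (simp add: P_iff)
    qed
    moreover have "q \<in> T" using pos by (auto simp: T_def)
    ultimately have "q \<in> interior P" by (meson interiorI)
    then show False using face_of_disjoint_interior[OF Fk(1,3)] q rel_interior_subset by blast
  qed
  then obtain j where j: "j \<in> {1..r}" "lat (u j) \<noteq> 0" "el j q = 0" by blast
  let ?E = "P \<inter> {x. el j x = 0}"
  have "F k \<subseteq> ?E"
    using q qP j(3) Fk(1) by (intro subset_of_face_of[OF face_el[OF j(1)]]) (auto simp: face_of_imp_subset)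
  moreover have "?E \<noteq> P"
  proof
    assume "?E = P"
    have "P \<subseteq> {x. lat (u j) \<bullet> x = - of_int (c j)}"
    proof
      fix x assume "x \<in> P"
      then have "el j x = 0" using \<open>?E = P\<close> by blast
      then show "x \<in> {x. lat (u j) \<bullet> x = - of_int (c j)}" by (simp add: el_def inner_commute eq_neg_iff_add_eq_0)
    qed
    then have "aff_dim P \<le> aff_dim {x. lat (u j) \<bullet> x = - of_int (c j)}" by (rule aff_dim_subset)
    then show False using j(2) full by (simp add: aff_dim_hyperplane)
  qed
  ultimately have Fkj: "F k = ?E" using facet_of_maximal F_facet[OF k] face_el[OF j(1)] by blast
  have "F j \<subseteq> F k"
  proof
    fix x assume x: "x \<in> F j"
    have xP: "x \<in> P" using x F_facet[OF j(1)] by (meson facet_of_imp_subset subsetD)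
    obtain z where z: "z \<in> F k" using Fk(2) by blast
    then have "z \<in> P" "el j z = 0" using Fkj by auto
    moreover have "x \<bullet> lat (u j) \<le> z \<bullet> lat (u j)"
      using u_in_cone[OF j(1)] x \<open>z \<in> P\<close> by (auto simp: inner_normal_cone_def)
    ultimately have "el j x \<le> 0" by (simp add: el_def)
    then show "x \<in> F k" using el_nonneg[OF xP j(1)] xP Fkj by auto
  qed
  then have "F j = F k" using facet_of_maximal[OF F_facet[OF j(1)] _ Fk(1,3)] by blast
  then have "j = k" using inj_onD[OF bij_betw_imp_inj_on[OF bij]] j(1) k by blast
  then show "lat (u k) \<noteq> 0" "F k = P \<inter> {x. el k x = 0}" using j Fkj by auto
qed

section \<open>Vertices, their tight constraints and their edges\<close>

definition tight :: "real ^ 'n \<Rightarrow> nat set" where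
  "tight x = {i\<in>{1..r}. el i x = 0}"

lemma finite_tight [simp]: "finite (tight x)" by (simp add: tight_def)

lemma card_tight:
  assumes "p extreme_point_of P"
  shows "card (tight p) = CARD('n)"
proof -
  have pP: "p \<in> P" using assms by (simp add: extreme_point_of_def)
  have "{E. E facet_of P \<and> p \<in> E} = F ` tight p"
  proof (intro set_eqI iffI)
    fix E assume "E \<in> {E. E facet_of P \<and> p \<in> E}"
    then have E: "E facet_of P" "p \<in> E" by auto
    then obtain i where i: "i \<in> {1..r}" "E = F i" using bij unfolding bij_betw_def by blast
    then have "i \<in> tight p" using E u_nonzero_and_F_eq(2)[OF i(1)] by (auto simp: tight_def)
    then show "E \<in> F ` tight p" using i by blast
  next
    fix E assume "E \<in> F ` tight p"
    then obtain i where i: "i \<in> {1..r}" "el i p = 0" "E = F i" by (auto simp: tight_def)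
    then have "p \<in> F i" using pP u_nonzero_and_F_eq(2)[OF i(1)] by simp
    then show "E \<in> {E. E facet_of P \<and> p \<in> E}" using F_facet[OF i(1)] i(3) by simp
  qed
  moreover have "inj_on F (tight p)"
    by (rule inj_on_subset[OF bij_betw_imp_inj_on[OF bij]]) (auto simp: tight_def)
  ultimately have "card (tight p) = card {E. E facet_of P \<and> p \<in> E}" by (simp only: card_image)
  then show ?thesis using simple assms by (simp add: simple_polytope_def)
qed

text \<open>Along a vector killed by the tight normals one could move from p in both directions:
  tight constraints stay at 0, and the others stay positive for small steps.\<close>

lemma extreme_kernel:
  assumes p: "p extreme_point_of P" and x: "\<And>i. i \<in> tight p \<Longrightarrow> x \<bullet> lat (u i) = 0"
  shows "x = 0"
proof (rule ccontr)
  assume "x \<noteq> 0"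
  have pP: "p \<in> P" using p by (simp add: extreme_point_of_def)
  let ?R = "{1..r} - tight p"
  define T where "T = (\<Inter>i\<in>?R. {t::real. el i (p + t *\<^sub>R x) > 0} \<inter> {t. el i (p + (- t) *\<^sub>R x) > 0})"
  have "open T" unfolding T_def el_def by (intro open_INT open_Int) (auto intro!: open_Collect_less continuous_intros)
  moreover have "0 \<in> T"
  proof -
    have "el i p > 0" if "i \<in> ?R" for i
      using el_nonneg[OF pP, of i] that by (auto simp: tight_def)
    then show ?thesis by (simp add: T_def)
  qed
  ultimately obtain \<epsilon> where \<epsilon>: "\<epsilon> > 0" "ball 0 \<epsilon> \<subseteq> T" using open_contains_ball by blast
  define t where "t = \<epsilon> / 2"
  have t: "t > 0" "t \<in> T" using \<epsilon> by (auto simp: t_def subset_iff)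
  have inP: "p + s *\<^sub>R x \<in> P" if "s = t \<or> s = - t" for s
    unfolding P_iff
  proof
    fix i assume i: "i \<in> {1..r}"
    show "0 \<le> el i (p + s *\<^sub>R x)"
    proof (cases "i \<in> tight p")
      case True
      then show ?thesis using x[OF True] by (simp add: el_add tight_def)
    next
      case False
      then have "i \<in> ?R" using i by simp
      then have "el i (p + t *\<^sub>R x) > 0 \<and> el i (p + (- t) *\<^sub>R x) > 0"
        using t(2) unfolding T_def by blast
      then show ?thesis using that by auto
    qed
  qed
  have "p \<in> open_segment (p + t *\<^sub>R x) (p + (- t) *\<^sub>R x)"
    unfolding in_segment
  proof (intro conjI exI[of _ "1/2"])
    show "p + t *\<^sub>R x \<noteq> p + (- t) *\<^sub>R x"
    proof
      assume "p + t *\<^sub>R x = p + (- t) *\<^sub>R x"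
      then have "(2 * t) *\<^sub>R x = 0" by (simp add: algebra_simps scaleR_2[symmetric])
      then show False using t(1) \<open>x \<noteq> 0\<close> by simp
    qed
    show "p = (1 - 1/2) *\<^sub>R (p + t *\<^sub>R x) + (1/2) *\<^sub>R (p + (- t) *\<^sub>R x)"
      by (simp add: algebra_simps flip: scaleR_add_left)
  qed auto
  then show False using p inP unfolding extreme_point_of_def by blast
qed

lemma kernel_extreme:
  assumes p: "p \<in> P" and ker: "\<And>x. (\<And>i. i \<in> tight p \<Longrightarrow> x \<bullet> lat (u i) = 0) \<Longrightarrow> x = 0"
  shows "p extreme_point_of P"
  unfolding extreme_point_of_def
proof (intro conjI ballI p notI)
  fix a b assume a: "a \<in> P" and b: "b \<in> P" and "p \<in> open_segment a b"
  then obtain t where t: "a \<noteq> b" "0 < t" "t < 1" "p = (1 - t) *\<^sub>R a + t *\<^sub>R b" by (auto simp: in_segment)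
  have "(a - b) \<bullet> lat (u i) = 0" if i: "i \<in> tight p" for i
  proof -
    have ir: "i \<in> {1..r}" "el i p = 0" using i by (auto simp: tight_def)
    have "(1 - t) * el i a + t * el i b = 0" using ir(2) unfolding t(4) el_comb .
    moreover have "(1 - t) * el i a \<ge> 0" "t * el i b \<ge> 0"
      using t el_nonneg[OF a ir(1)] el_nonneg[OF b ir(1)] by auto
    ultimately have "(1 - t) * el i a = 0" "t * el i b = 0" by linarith+
    then have "el i a = 0" "el i b = 0" using t by auto
    then show ?thesis by (simp add: el_def inner_diff_left)
  qed
  then have "a - b = 0" by (rule ker)
  then show False using t(1) by simp
qed

text \<open>The other n - 1 tight normals span a proper subspace. A nonzero vector orthogonal to
  them pairs nontrivially with u i by \<open>extreme_kernel\<close> and can be rescaled.\<close>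

lemma dual_exists:
  assumes p: "p extreme_point_of P" and i: "i \<in> tight p"
  shows "\<exists>a. \<forall>j\<in>tight p. a \<bullet> lat (u j) = (if i = j then 1 else 0)"
proof -
  let ?B = "(\<lambda>j. lat (u j)) ` (tight p - {i})"
  have "dim (span ?B) \<le> card ?B" by (subst dim_span, rule dim_le_card') simp
  also have "card ?B \<le> card (tight p - {i})" by (intro card_image_le) simp
  also have "\<dots> < CARD('n)" using card_tight[OF p] i by (metis card_Diff1_less finite_tight)
  finally have "span ?B \<noteq> UNIV" by (metis DIM_cart DIM_real dim_UNIV less_irrefl mult.right_neutral)
  then obtain a where a: "a \<noteq> 0" "span ?B \<subseteq> {x. a \<bullet> x = 0}" using span_not_univ_subset_hyperplane by blast
  have a0: "a \<bullet> lat (u j) = 0" if "j \<in> tight p" "j \<noteq> i" for j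
    using a(2) that span_base[of "lat (u j)" ?B] by auto
  have "a \<bullet> lat (u i) \<noteq> 0"
  proof
    assume "a \<bullet> lat (u i) = 0"
    then have "a = 0" using a0 by (intro extreme_kernel[OF p]) metis
    then show False using a(1) by simp
  qed
  then have "\<forall>j\<in>tight p. ((1 / (a \<bullet> lat (u i))) *\<^sub>R a) \<bullet> lat (u j) = (if i = j then 1 else 0)"
    using a0 by auto
  then show ?thesis by blast
qed

definition \<alpha> :: "nat set \<Rightarrow> nat \<Rightarrow> real ^ 'n" where
  "\<alpha> V i = (SOME a. \<forall>j\<in>V. a \<bullet> lat (u j) = (if i = j then 1 else 0))"

definition VV :: "nat set set" where
  "VV = tight ` {p. p extreme_point_of P}"

lemma \<alpha>_dual:
  assumes "p extreme_point_of P" "i \<in> tight p" "j \<in> tight p"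
  shows "\<alpha> (tight p) i \<bullet> lat (u j) = (if i = j then 1 else 0)"
  using someI_ex[OF dual_exists[OF assms(1,2)]] assms(3) unfolding \<alpha>_def by blast

lemma \<alpha>_expand:
  assumes "p extreme_point_of P"
  shows "(\<Sum>i\<in>tight p. (x \<bullet> lat (u i)) *\<^sub>R \<alpha> (tight p) i) = x"
proof -
  have "x - (\<Sum>i\<in>tight p. (x \<bullet> lat (u i)) *\<^sub>R \<alpha> (tight p) i) = 0"
  proof (rule extreme_kernel[OF assms])
    fix j assume j: "j \<in> tight p"
    have "(\<Sum>i\<in>tight p. (x \<bullet> lat (u i)) *\<^sub>R \<alpha> (tight p) i) \<bullet> lat (u j) =
        (\<Sum>i\<in>tight p. if i = j then x \<bullet> lat (u i) else 0)"
      unfolding inner_sum_left using j by (intro sum.cong) (auto simp: \<alpha>_dual[OF assms])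
    then show "(x - (\<Sum>i\<in>tight p. (x \<bullet> lat (u i)) *\<^sub>R \<alpha> (tight p) i)) \<bullet> lat (u j) = 0"
      using j by (simp add: inner_diff_left)
  qed
  then show ?thesis by simp
qed

lemma vertex_diff:
  assumes "p extreme_point_of P"
  shows "x - p = (\<Sum>i\<in>tight p. el i x *\<^sub>R \<alpha> (tight p) i)"
proof -
  have "x - p = (\<Sum>i\<in>tight p. ((x - p) \<bullet> lat (u i)) *\<^sub>R \<alpha> (tight p) i)" by (rule \<alpha>_expand[OF assms, symmetric])
  also have "\<dots> = (\<Sum>i\<in>tight p. el i x *\<^sub>R \<alpha> (tight p) i)"
  proof (intro sum.cong refl)
    fix i assume "i \<in> tight p"
    then have "el i p = 0" by (simp add: tight_def)
    then have "(x - p) \<bullet> lat (u i) = el i x" by (simp add: el_def inner_diff_left)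
    then show "((x - p) \<bullet> lat (u i)) *\<^sub>R \<alpha> (tight p) i = el i x *\<^sub>R \<alpha> (tight p) i" by simp
  qed
  finally show ?thesis .
qed

lemma edge_point:
  assumes p: "p extreme_point_of P" and p': "p' extreme_point_of P"
    and i: "i \<in> tight p" and sub: "tight p - {i} \<subseteq> tight p'"
  shows "p' = p + el i p' *\<^sub>R \<alpha> (tight p) i"
proof -
  have "p' - p = el i p' *\<^sub>R \<alpha> (tight p) i + (\<Sum>j\<in>tight p - {i}. el j p' *\<^sub>R \<alpha> (tight p) j)"
    using i unfolding vertex_diff[OF p] by (simp add: sum.remove)
  also have "(\<Sum>j\<in>tight p - {i}. el j p' *\<^sub>R \<alpha> (tight p) j) = 0"
    using sub by (intro sum.neutral) (auto simp: tight_def)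
  finally show ?thesis by (simp add: algebra_simps)
qed

lemma tight_eq_of_subset:
  assumes "p extreme_point_of P" "p' extreme_point_of P" "tight p \<subseteq> tight p'"
  shows "tight p = tight p'"
  using assms card_tight by (intro card_subset_eq) auto

text \<open>The ratio test of the simplex method: follow the edge from p until the first further
  constraint becomes tight. Any other candidate vertex lies on the same ray, and feasibility
  together with its own new tight constraint forces the same parameter.\<close>

lemma neighbour:
  assumes p: "p extreme_point_of P" and i: "i \<in> tight p"
  shows "\<exists>!V'. V' \<in> VV \<and> V' \<noteq> tight p \<and> tight p - {i} \<subseteq> V'"
proof -
  define a where "a = \<alpha> (tight p) i"
  have pP: "p \<in> P" using p by (simp add: extreme_point_of_def)
  have a_dot: "a \<bullet> lat (u j) = (if i = j then 1 else 0)" if "j \<in> tight p" for j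
    using \<alpha>_dual[OF p i that] by (simp add: a_def)
  have el_ray: "el j (p + s *\<^sub>R a) = el j p + s * (a \<bullet> lat (u j))" for j s by (simp add: el_add)
  define N where "N = {j\<in>{1..r}. a \<bullet> lat (u j) < 0}"
  have N_not: "j \<notin> tight p" if "j \<in> N" for j using that a_dot[of j] by (auto simp: N_def split: if_splits)
  have el_pos: "el j p > 0" if "j \<in> {1..r}" "j \<notin> tight p" for j
    using that el_nonneg[OF pP that(1)] by (auto simp: tight_def)
  \<comment> \<open>If no constraint decreased along a, the whole ray would lie in the bounded set
    P.\<close>
  have "N \<noteq> {}"
  proof
    assume "N = {}"
    then have nn: "a \<bullet> lat (u j) \<ge> 0" if "j \<in> {1..r}" for j using that by (force simp: N_def)
    have "p + s *\<^sub>R a \<in> P" if "s \<ge> 0" for s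
      unfolding P_iff el_ray using el_nonneg[OF pP] nn that by auto
    moreover obtain B where B: "\<And>x. x \<in> P \<Longrightarrow> norm x \<le> B"
      using compact_imp_bounded[OF compact_P] by (auto simp: bounded_iff)
    ultimately have bd: "norm (p + s *\<^sub>R a) \<le> B" if "s \<ge> 0" for s using that by blast
    have "a \<noteq> 0" using a_dot[OF i] by auto
    define s where "s = (B + norm p + 1) / norm a"
    have "B \<ge> 0" using B[OF pP] norm_ge_zero order_trans by blast
    then have "s \<ge> 0" by (simp add: s_def)
    have "norm (s *\<^sub>R a) \<le> norm (p + s *\<^sub>R a) + norm p" by (metis add_diff_cancel_left' norm_triangle_ineq4)
    also have "norm (s *\<^sub>R a) = B + norm p + 1" using \<open>a \<noteq> 0\<close> \<open>B \<ge> 0\<close> by (simp add: s_def)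
    finally show False using bd[OF \<open>s \<ge> 0\<close>] by linarith
  qed
  define R where "R j = el j p / (- (a \<bullet> lat (u j)))" for j
  have finN: "finite N" by (simp add: N_def)
  obtain m where m: "m \<in> N" "\<And>j. j \<in> N \<Longrightarrow> R m \<le> R j"
  proof -
    have "Min (R ` N) \<in> R ` N" using finN \<open>N \<noteq> {}\<close> by (intro Min_in) auto
    then obtain m where "m \<in> N" "Min (R ` N) = R m" by auto
    moreover have "Min (R ` N) \<le> R j" if "j \<in> N" for j using finN that by simp
    ultimately show ?thesis using that by auto
  qed
  have mN: "a \<bullet> lat (u m) < 0" "m \<in> {1..r}" "m \<notin> tight p" using m(1) N_not by (auto simp: N_def)
  \<comment> \<open>The smallest parameter at which a decreasing constraint reaches 0; it is
    positive since such constraints are not tight at p.\<close>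
  define t where "t = R m"
  have "t > 0" unfolding t_def R_def using el_pos[OF mN(2,3)] mN(1) by (intro divide_pos_pos) auto
  define p' where "p' = p + t *\<^sub>R a"
  have el_m: "el m p' = 0" unfolding p'_def el_ray t_def R_def using mN(1) by (simp add: field_simps)
  have el_i: "el i p' = t" unfolding p'_def el_ray using a_dot[OF i] i by (simp add: tight_def)
  have el_J: "el j p' = 0" if "j \<in> tight p - {i}" for j
    unfolding p'_def el_ray using a_dot that by (auto simp: tight_def)
  have p'P: "p' \<in> P"
    unfolding P_iff
  proof
    fix j assume j: "j \<in> {1..r}"
    show "0 \<le> el j p'"
    proof (cases "j \<in> N")
      case True
      then have neg: "a \<bullet> lat (u j) < 0" by (simp add: N_def)
      have "t \<le> el j p / (- (a \<bullet> lat (u j)))" using m(2)[OF True] by (simp add: t_def R_def)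
      then have "t * (- (a \<bullet> lat (u j))) \<le> el j p" using neg by (subst (asm) pos_le_divide_eq) auto
      then show ?thesis unfolding p'_def el_ray by simp
    next
      case False
      then have "a \<bullet> lat (u j) \<ge> 0" using j by (simp add: N_def)
      then show ?thesis unfolding p'_def el_ray using \<open>t > 0\<close> el_nonneg[OF pP j] by simp
    qed
  qed
  \<comment> \<open>A vector killed by the constraints of \<open>tight p - {i}\<close> is a multiple
    of a, and the blocking constraint m is not constant along a.\<close>
  have p': "p' extreme_point_of P"
  proof (rule kernel_extreme[OF p'P])
    fix x assume x: "\<And>j. j \<in> tight p' \<Longrightarrow> x \<bullet> lat (u j) = 0"
    have xJ: "x \<bullet> lat (u j) = 0" if "j \<in> tight p - {i}" for j
      using that el_J by (intro x) (auto simp: tight_def)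
    have "x = (x \<bullet> lat (u i)) *\<^sub>R a + (\<Sum>j\<in>tight p - {i}. (x \<bullet> lat (u j)) *\<^sub>R \<alpha> (tight p) j)"
      using \<alpha>_expand[OF p, of x] i by (simp add: sum.remove a_def)
    then have xa: "x = (x \<bullet> lat (u i)) *\<^sub>R a" using xJ by simp
    have "x \<bullet> lat (u m) = 0" using el_m mN by (intro x) (auto simp: tight_def)
    then have "(x \<bullet> lat (u i)) * (a \<bullet> lat (u m)) = 0" by (metis xa inner_scaleR_left)
    then have "x \<bullet> lat (u i) = 0" using mN(1) by simp
    then show "x = 0" using xa by simp
  qed
  show ?thesis
  proof (rule ex1I[of _ "tight p'"])
    have "i \<notin> tight p'" using el_i \<open>t > 0\<close> by (simp add: tight_def)
    then show "tight p' \<in> VV \<and> tight p' \<noteq> tight p \<and> tight p - {i} \<subseteq> tight p'"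
      using p' i el_J by (auto simp: VV_def tight_def)
  next
    fix W assume W: "W \<in> VV \<and> W \<noteq> tight p \<and> tight p - {i} \<subseteq> W"
    then obtain p2 where p2: "p2 extreme_point_of P" "W = tight p2" by (auto simp: VV_def)
    have p2P: "p2 \<in> P" using p2 by (simp add: extreme_point_of_def)
    have "i \<notin> W"
    proof
      assume "i \<in> W"
      then have "tight p \<subseteq> tight p2" using W p2 by auto
      then show False using tight_eq_of_subset[OF p p2(1)] W p2 by simp
    qed
    define s where "s = el i p2"
    have "s > 0" using \<open>i \<notin> W\<close> i el_nonneg[OF p2P] p2(2) by (force simp: s_def tight_def)
    have p2eq: "p2 = p + s *\<^sub>R a" using edge_point[OF p p2(1) i] W p2 by (simp add: s_def a_def)
    \<comment> \<open>W contains a constraint j that is not tight at p. It decreases to 0 at the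
      parameter s, hence s is one of the ratios and at least the minimal one; feasibility of
      constraint m at p2 gives the reverse inequality.\<close>
    have "\<not> W \<subseteq> tight p" using W p2 tight_eq_of_subset[OF p2(1) p] by auto
    then obtain j where j: "j \<in> W" "j \<notin> tight p" by auto
    then have jr: "j \<in> {1..r}" "el j p2 = 0" using p2 by (auto simp: tight_def)
    have "el j p + s * (a \<bullet> lat (u j)) = 0" using jr(2) unfolding p2eq el_ray .
    then have sj: "s * (- (a \<bullet> lat (u j))) = el j p" by simp
    then have "a \<bullet> lat (u j) < 0" using el_pos[OF jr(1) j(2)] \<open>s > 0\<close>
      by (smt (verit) mult_nonneg_nonneg mult_minus_right)
    then have "s = R j" "j \<in> N" using sj jr(1) by (auto simp: R_def N_def field_simps)
    then have "t \<le> s" using m(2) by (simp add: t_def)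
    moreover have "el m p + s * (a \<bullet> lat (u m)) \<ge> 0" using el_nonneg[OF p2P mN(2)] unfolding p2eq el_ray .
    then have "s \<le> t" unfolding t_def R_def using mN(1) by (subst pos_le_divide_eq) auto
    ultimately show "W = tight p'" using p2 p2eq by (simp add: p'_def)
  qed
qed

lemma VV_nonempty: "VV \<noteq> {}"
  using extreme_point_exists_convex[OF compact_P convex_P P_ne] by (auto simp: VV_def)

lemma vert_formula:
  assumes p: "p extreme_point_of P"
  shows "- (\<Sum>i\<in>tight p. of_int (c i) *\<^sub>R \<alpha> (tight p) i) = p"
proof -
  have "p = (\<Sum>i\<in>tight p. (p \<bullet> lat (u i)) *\<^sub>R \<alpha> (tight p) i)" by (rule \<alpha>_expand[OF p, symmetric])
  also have "\<dots> = (\<Sum>i\<in>tight p. (- of_int (c i)) *\<^sub>R \<alpha> (tight p) i)"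
  proof (intro sum.cong refl)
    fix i assume "i \<in> tight p"
    then have "p \<bullet> lat (u i) = - of_int (c i)" by (simp add: tight_def el_def eq_neg_iff_add_eq_0)
    then show "(p \<bullet> lat (u i)) *\<^sub>R \<alpha> (tight p) i = (- of_int (c i)) *\<^sub>R \<alpha> (tight p) i" by simp
  qed
  finally show ?thesis by (simp add: sum_negf)
qed

text \<open>The prescribed values are 1 at the indices in {1..r} outside a vertex and
  \<open>undefined\<close> elsewhere. With this choice the character groups of the vertices consist
  of elements of \<open>Ggrp r u\<close> themselves, with no transfer between function
  types.\<close>

sublocale vs: lattice_vertex_system "{1..r}" u VV \<alpha> "\<lambda>i. of_int (c i)" "\<lambda>i. if i \<in> {1..r} then 1 else undefined"
proof
  show "VV \<noteq> {}" by (rule VV_nonempty)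
  fix V assume "V \<in> VV"
  then obtain p where p: "p extreme_point_of P" "V = tight p" by (auto simp: VV_def)
  have pP: "p \<in> P" using p by (simp add: extreme_point_of_def)
  show "V \<subseteq> {1..r}" using p by (auto simp: tight_def)
  show "card V = DIM(real ^ 'n)" using card_tight[OF p(1)] p(2) by simp
  show "\<alpha> V i \<bullet> lat (u j) = (if i = j then 1 else 0)" if "i \<in> V" "j \<in> V" for i j
    using \<alpha>_dual p that by simp
  show "(\<Sum>i\<in>V. (x \<bullet> lat (u i)) *\<^sub>R \<alpha> V i) = x" for x using \<alpha>_expand p by simp
  show "\<exists>!V'. V' \<in> VV \<and> V' \<noteq> V \<and> V - {i} \<subseteq> V'" if "i \<in> V" for i using neighbour p that by simp
  show "0 < - (\<Sum>j\<in>V. of_int (c j) *\<^sub>R \<alpha> V j) \<bullet> lat (u i) + of_int (c i)" if "i \<in> {1..r} - V" for i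
  proof -
    have "el i p \<ge> 0" "el i p \<noteq> 0" using that pP el_nonneg p(2) by (auto simp: tight_def)
    then show ?thesis using vert_formula[OF p(1)] p(2) by (simp add: el_def)
  qed
qed simp

lemma vs_ell: "vs.ell = el"
  by (intro ext) (simp add: vs.ell_def el_def)

lemma vs_vert: "p extreme_point_of P \<Longrightarrow> vs.vert (tight p) = p"
  using vert_formula by (simp add: vs.vert_def)

lemma extreme_lattice:
  assumes "p extreme_point_of P"
  shows "p \<in> range lat"
proof -
  obtain S where S: "finite S" "S \<subseteq> range lat" "P = convex hull S"
    using lattice unfolding lattice_polytope_def by blast
  then show ?thesis using assms extreme_point_of_convex_hull by blast
qed

lemma vs_vert_lattice: "V \<in> VV \<Longrightarrow> vs.vert V \<in> range lat"
  using vs_vert extreme_lattice by (auto simp: VV_def)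

end

section \<open>The normal fan and its finite set of group elements\<close>

lemma vec_prod_nth: "(\<Prod>i\<in>A. f i :: complex ^ 'n) $ j = (\<Prod>i\<in>A. f i $ j)"
  by (induction A rule: infinite_finite_induct) auto

context simple_lattice_polytope
begin

lemma vchars_iff:
  assumes V: "V \<in> VV"
  shows "g \<in> vs.vchars V \<longleftrightarrow> g \<in> Ggrp r u \<and> (\<forall>i\<in>{1..r}-V. g i = 1)"
proof -
  have VI: "V \<subseteq> {1..r}" using vs.VV_sub[OF V] .
  have prodV: "(\<Prod>i\<in>{1..r}. g i powi (u i $ j)) = (\<Prod>i\<in>V. g i powi (u i $ j))" if "\<forall>i\<in>{1..r}-V. g i = 1" for j
    using VI that by (intro prod.mono_neutral_right) auto
  have G: "g \<in> Ggrp r u \<longleftrightarrow> g \<in> {1..r} \<rightarrow>\<^sub>E (UNIV - {0}) \<and> (\<forall>j. (\<Prod>i\<in>{1..r}. g i powi (u i $ j)) = 1)"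
    by (simp add: Ggrp_def vec_eq_iff vec_prod_nth one_param_def)
  show ?thesis
    unfolding lattice_basis.chars_def[OF vs.lattice_basis_vertex[OF V]] mem_Collect_eq
  proof (intro iffI conjI)
    assume h: "(\<forall>i\<in>V. g i \<noteq> 0) \<and> (\<forall>i. i \<notin> V \<longrightarrow> g i = (if i \<in> {1..r} then 1 else undefined)) \<and>
      (\<forall>j. (\<Prod>i\<in>V. g i powi (u i $ j)) = 1)"
    show one: "\<forall>i\<in>{1..r}-V. g i = 1" using conjunct1[OF conjunct2[OF h]] by simp
    have "g i \<noteq> 0" if "i \<in> {1..r}" for i using h one that by (cases "i \<in> V") auto
    moreover have "g i = undefined" if "i \<notin> {1..r}" for i
    proof -
      have "i \<notin> V" using that VI by blast
      then show ?thesis using h that by presburger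
    qed
    ultimately have "g \<in> {1..r} \<rightarrow>\<^sub>E (UNIV - {0})" unfolding PiE_iff extensional_def by blast
    then show "g \<in> Ggrp r u" unfolding G using h prodV[OF one] by simp
  next
    assume h: "g \<in> Ggrp r u \<and> (\<forall>i\<in>{1..r}-V. g i = 1)"
    show "\<forall>i\<in>V. g i \<noteq> 0" using h VI unfolding G by (auto simp: PiE_iff)
    show "\<forall>i. i \<notin> V \<longrightarrow> g i = (if i \<in> {1..r} then 1 else undefined)"
      using h unfolding G by (auto simp: PiE_iff extensional_def)
    show "\<forall>j. (\<Prod>i\<in>V. g i powi (u i $ j)) = 1" using h prodV unfolding G by metis
  qed
qed

lemma edge_exists:
  assumes p: "p extreme_point_of P" and j: "j \<in> tight p"
  obtains t where "t > 0" "p + t *\<^sub>R \<alpha> (tight p) j \<in> P"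
    "\<And>i. i \<in> tight p \<Longrightarrow> i \<noteq> j \<Longrightarrow> el i (p + t *\<^sub>R \<alpha> (tight p) j) = 0"
proof -
  have V: "tight p \<in> VV" using p by (auto simp: VV_def)
  obtain V' i' where V': "V' \<in> VV" "i' \<notin> tight p" "i' \<noteq> j" "V' = insert i' (tight p - {j})"
    using vs.nbrE[OF V j] .
  obtain p' where p': "p' extreme_point_of P" "V' = tight p'" using V'(1) by (auto simp: VV_def)
  have eq: "p' = p + el j p' *\<^sub>R \<alpha> (tight p) j" using V' p' by (intro edge_point[OF p p'(1) j]) auto
  have "j \<in> {1..r}" using j by (simp add: tight_def)
  moreover have "p' \<in> P" using p' by (simp add: extreme_point_of_def)
  moreover have "j \<notin> tight p'" using V' p' by auto
  ultimately have "el j p' > 0" using el_nonneg[of p' j] by (auto simp: tight_def)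
  moreover have "el i p' = 0" if "i \<in> tight p" "i \<noteq> j" for i
  proof -
    have "i \<in> tight p'" using that V'(4) p'(2) by auto
    then show ?thesis by (simp add: tight_def)
  qed
  ultimately show ?thesis using that[of "el j p'"] eq \<open>p' \<in> P\<close> by simp
qed

text \<open>The difference of the two sides is orthogonal to all edge directions, and these span the
  space by \<open>\<alpha>_expand\<close>; so it is orthogonal to itself.\<close>

lemma coexpand:
  assumes p: "p extreme_point_of P"
  shows "w = (\<Sum>j\<in>tight p. (w \<bullet> \<alpha> (tight p) j) *\<^sub>R lat (u j))"
proof -
  let ?s = "\<Sum>j\<in>tight p. (w \<bullet> \<alpha> (tight p) j) *\<^sub>R lat (u j)"
  let ?x = "w - ?s"
  have orth: "?x \<bullet> \<alpha> (tight p) k = 0" if k: "k \<in> tight p" for k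
  proof -
    have "?s \<bullet> \<alpha> (tight p) k = (\<Sum>j\<in>tight p. if j = k then w \<bullet> \<alpha> (tight p) j else 0)"
      unfolding inner_sum_left
    proof (intro sum.cong refl)
      fix j assume "j \<in> tight p"
      then have "lat (u j) \<bullet> \<alpha> (tight p) k = (if k = j then 1 else 0)"
        using \<alpha>_dual[OF p k] by (simp add: inner_commute)
      then show "(w \<bullet> \<alpha> (tight p) j) *\<^sub>R lat (u j) \<bullet> \<alpha> (tight p) k = (if j = k then w \<bullet> \<alpha> (tight p) j else 0)"
        by auto
    qed
    then show ?thesis using k by (simp add: inner_diff_left)
  qed
  have "?x \<bullet> ?x = ?x \<bullet> (\<Sum>i\<in>tight p. (?x \<bullet> lat (u i)) *\<^sub>R \<alpha> (tight p) i)" by (simp only: \<alpha>_expand[OF p])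
  also have "\<dots> = 0" unfolding inner_sum_right using orth by (intro sum.neutral) auto
  finally show ?thesis by simp
qed

text \<open>A functional that is minimal on the whole facet vanishes along the edges at p that stay
  in the facet, so in the expansion by the tight normals only u i remains. Its coefficient is
  nonnegative because the remaining edge leads into P.\<close>

lemma facet_cone_eq:
  assumes p: "p extreme_point_of P" and i: "i \<in> tight p"
  shows "inner_normal_cone P (F i) = (\<lambda>s. s *\<^sub>R lat (u i)) ` {0..}"
proof (intro set_eqI iffI)
  have ir: "i \<in> {1..r}" using i by (simp add: tight_def)
  have pP: "p \<in> P" using p by (simp add: extreme_point_of_def)
  note Fi = u_nonzero_and_F_eq(2)[OF ir]
  have pF: "p \<in> F i" using i pP unfolding Fi by (simp add: tight_def)
  fix w
  {
    assume "w \<in> (\<lambda>s. s *\<^sub>R lat (u i)) ` {0..}"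
    then obtain s where s: "s \<ge> 0" "w = s *\<^sub>R lat (u i)" by auto
    have "q \<bullet> lat (u i) \<le> x \<bullet> lat (u i)" if "q \<in> F i" "x \<in> P" for q x
      using that el_nonneg[OF that(2) ir] unfolding Fi by (simp add: el_def)
    then show "w \<in> inner_normal_cone P (F i)" using s by (auto simp: inner_normal_cone_def mult_left_mono)
  next
    assume w: "w \<in> inner_normal_cone P (F i)"
    then have min: "p \<bullet> w \<le> x \<bullet> w" if "x \<in> P" for x using that pF by (auto simp: inner_normal_cone_def)
    have "w \<bullet> \<alpha> (tight p) j = 0" if j: "j \<in> tight p" "j \<noteq> i" for j
    proof -
      obtain t where t: "t > 0" "p + t *\<^sub>R \<alpha> (tight p) j \<in> P"
        "\<And>i. i \<in> tight p \<Longrightarrow> i \<noteq> j \<Longrightarrow> el i (p + t *\<^sub>R \<alpha> (tight p) j) = 0"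
        by (rule edge_exists[OF p j(1)], rule that)
      have "p + t *\<^sub>R \<alpha> (tight p) j \<in> F i" unfolding Fi using t i j by auto
      then have "(p + t *\<^sub>R \<alpha> (tight p) j) \<bullet> w \<le> p \<bullet> w" using w pP by (auto simp: inner_normal_cone_def)
      moreover have "p \<bullet> w \<le> (p + t *\<^sub>R \<alpha> (tight p) j) \<bullet> w" using min t(2) by blast
      ultimately have "t * (\<alpha> (tight p) j \<bullet> w) = 0" by (simp add: inner_add_left)
      then show ?thesis using t(1) by (simp add: inner_commute)
    qed
    then have "w = (w \<bullet> \<alpha> (tight p) i) *\<^sub>R lat (u i)"
      using coexpand[OF p, of w] i by (simp add: sum.remove)
    moreover have "w \<bullet> \<alpha> (tight p) i \<ge> 0"
    proof -
      obtain t where t: "t > 0" "p + t *\<^sub>R \<alpha> (tight p) i \<in> P" using edge_exists[OF p i] by metis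
      then have "0 \<le> t * (\<alpha> (tight p) i \<bullet> w)" using min[OF t(2)] by (simp add: inner_add_left)
      then show ?thesis using t(1) by (simp add: inner_commute zero_le_mult_iff)
    qed
    ultimately show "w \<in> (\<lambda>s. s *\<^sub>R lat (u i)) ` {0..}" by auto
  }
qed

text \<open>If a convex combination of two functionals minimal at p is minimal on F i, then both
  are: for each q in F i two nonnegative differences have a weighted sum that is at most 0. The
  dimension is 1 as the cone is spanned by the nonzero vector u i.\<close>

lemma facet_cone_in_rays:
  assumes p: "p extreme_point_of P" and i: "i \<in> tight p"
  shows "inner_normal_cone P (F i) \<in> cone_rays (inner_normal_cone P {p})"
proof -
  have ir: "i \<in> {1..r}" using i by (simp add: tight_def)
  have pP: "p \<in> P" using p by (simp add: extreme_point_of_def)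
  have pF: "p \<in> F i" using i pP unfolding u_nonzero_and_F_eq(2)[OF ir] by (simp add: tight_def)
  let ?\<rho> = "inner_normal_cone P (F i)" and ?\<tau> = "inner_normal_cone P {p}"
  have FP: "F i \<subseteq> P" using F_facet[OF ir] by (rule facet_of_imp_subset)
  have "?\<rho> face_of ?\<tau>"
    unfolding face_of_def
  proof (intro conjI ballI impI)
    show "?\<rho> \<subseteq> ?\<tau>" using pF by (auto simp: inner_normal_cone_def)
    show "convex ?\<rho>"
      unfolding facet_cone_eq[OF p i] by (intro convex_linear_image) (auto intro!: linearI simp: scaleR_add_left)
    fix a b w assume a: "a \<in> ?\<tau>" and b: "b \<in> ?\<tau>" and w: "w \<in> ?\<rho>" and "w \<in> open_segment a b"
    then obtain t where t: "0 < t" "t < 1" "w = (1 - t) *\<^sub>R a + t *\<^sub>R b" by (auto simp: in_segment)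
    have eq: "q \<bullet> a = p \<bullet> a \<and> q \<bullet> b = p \<bullet> b" if q: "q \<in> F i" for q
    proof -
      have "q \<in> P" using q FP by blast
      then have ge: "p \<bullet> a \<le> q \<bullet> a" "p \<bullet> b \<le> q \<bullet> b" using a b by (auto simp: inner_normal_cone_def)
      have "q \<bullet> w \<le> p \<bullet> w" using w q pP by (auto simp: inner_normal_cone_def)
      then have "(1 - t) * (q \<bullet> a - p \<bullet> a) + t * (q \<bullet> b - p \<bullet> b) \<le> 0"
        unfolding t(3) by (simp add: inner_add_right algebra_simps)
      moreover have "(1 - t) * (q \<bullet> a - p \<bullet> a) \<ge> 0" "t * (q \<bullet> b - p \<bullet> b) \<ge> 0" using t ge by auto
      ultimately have "(1 - t) * (q \<bullet> a - p \<bullet> a) = 0" "t * (q \<bullet> b - p \<bullet> b) = 0" by linarith+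
      then show ?thesis using t by auto
    qed
    show "a \<in> ?\<rho>" using eq a by (auto simp: inner_normal_cone_def)
    show "b \<in> ?\<rho>" using eq b by (auto simp: inner_normal_cone_def)
  qed
  moreover have "aff_dim ?\<rho> = 1"
  proof -
    have "(0::real^'n) \<in> ?\<rho>" unfolding facet_cone_eq[OF p i] by (auto intro!: image_eqI[of _ _ 0])
    then have "aff_dim ?\<rho> = int (dim ?\<rho>)" by (intro aff_dim_zero hull_inc)
    moreover have "dim ?\<rho> = 1"
    proof (rule antisym)
      have "?\<rho> \<subseteq> span {lat (u i)}" unfolding facet_cone_eq[OF p i] by (auto simp: span_singleton)
      then have "dim ?\<rho> \<le> dim (span {lat (u i)})" by (rule dim_subset)
      also have "\<dots> \<le> 1" by (simp add: dim_singleton)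
      finally show "dim ?\<rho> \<le> 1" .
      have "{lat (u i)} \<subseteq> ?\<rho>" using u_in_cone[OF ir] by simp
      then have "dim {lat (u i)} \<le> dim ?\<rho>" by (rule dim_subset)
      then show "1 \<le> dim ?\<rho>" using u_nonzero_and_F_eq(1)[OF ir] by (simp add: dim_singleton)
    qed
    ultimately show ?thesis by simp
  qed
  ultimately show ?thesis by (simp add: cone_rays_def)
qed

abbreviation G_fan :: "(nat \<Rightarrow> complex) set" where
  "G_fan \<equiv> Gfan r u (\<lambda>i. inner_normal_cone P (F i)) (inner_normal_fan P)"

text \<open>Only the maximal cones matter. A face Q has a vertex p, and a ray of the cone of Q comes
  from a facet through p, because its generator is minimal on Q. So the group of Q is contained in
  that of p.\<close>

lemma G_fan_eq: "G_fan = (\<Union>V\<in>VV. vs.vchars V)"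
proof (intro set_eqI iffI)
  fix g assume "g \<in> G_fan"
  then obtain Q where Q: "Q face_of P" "Q \<noteq> {}"
    and g: "g \<in> Gcone r u (\<lambda>i. inner_normal_cone P (F i)) (inner_normal_cone P Q)"
    unfolding Gfan_def inner_normal_fan_def by blast
  have "compact Q" "convex Q"
    using face_of_imp_compact[OF convex_P compact_P Q(1)] face_of_imp_convex[OF Q(1)] by auto
  then obtain p where "p extreme_point_of Q" using extreme_point_exists_convex Q(2) by blast
  then have pQ: "p \<in> Q" and p: "p extreme_point_of P"
    using extreme_point_of_face[OF Q(1)] by auto
  have V: "tight p \<in> VV" using p by (auto simp: VV_def)
  have "g i = 1" if i: "i \<in> {1..r} - tight p" for i
  proof -
    have ir: "i \<in> {1..r}" "el i p \<noteq> 0" using i by (auto simp: tight_def)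
    have "inner_normal_cone P (F i) \<notin> cone_rays (inner_normal_cone P Q)"
    proof
      assume "inner_normal_cone P (F i) \<in> cone_rays (inner_normal_cone P Q)"
      then have "inner_normal_cone P (F i) \<subseteq> inner_normal_cone P Q"
        by (auto simp: cone_rays_def dest: face_of_imp_subset)
      then have "lat (u i) \<in> inner_normal_cone P Q" using u_in_cone[OF ir(1)] by blast
      then have min: "p \<bullet> lat (u i) \<le> x \<bullet> lat (u i)" if "x \<in> P" for x
        using pQ that by (auto simp: inner_normal_cone_def)
      obtain x where "x \<in> F i" using F_facet[OF ir(1)] by (auto simp: facet_of_def)
      then have "x \<in> P" "el i x = 0" unfolding u_nonzero_and_F_eq(2)[OF ir(1)] by auto
      then have "el i p \<le> 0" using min[of x] by (simp add: el_def)
      moreover have "p \<in> P" using p by (simp add: extreme_point_of_def)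
      ultimately show False using el_nonneg[of p i] ir by simp
    qed
    then show ?thesis using g ir(1) by (auto simp: Gcone_def)
  qed
  then have "g \<in> vs.vchars (tight p)" unfolding vchars_iff[OF V] using g by (auto simp: Gcone_def)
  then show "g \<in> (\<Union>V\<in>VV. vs.vchars V)" using V by blast
next
  fix g assume "g \<in> (\<Union>V\<in>VV. vs.vchars V)"
  then obtain p where p: "p extreme_point_of P" and g: "g \<in> vs.vchars (tight p)" by (auto simp: VV_def)
  have V: "tight p \<in> VV" using p by (auto simp: VV_def)
  have "g \<in> Gcone r u (\<lambda>i. inner_normal_cone P (F i)) (inner_normal_cone P {p})"
    using g facet_cone_in_rays[OF p] unfolding vchars_iff[OF V] by (auto simp: Gcone_def)
  moreover have "inner_normal_cone P {p} \<in> inner_normal_fan P"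
    unfolding inner_normal_fan_def using p face_of_singleton by blast
  ultimately show "g \<in> G_fan" unfolding Gfan_def by blast
qed

lemma finite_G_fan: "finite G_fan"
  unfolding G_fan_eq using vs.finite_VV lattice_basis.finite_chars[OF vs.lattice_basis_vertex] by blast

lemma G_fan_vertex:
  assumes V: "V \<in> VV"
  shows "{g \<in> G_fan. \<forall>i\<in>{1..r}-V. g i = 1} = vs.vchars V"
proof (intro set_eqI iffI)
  fix g assume "g \<in> {g \<in> G_fan. \<forall>i\<in>{1..r}-V. g i = 1}"
  then show "g \<in> vs.vchars V" unfolding vchars_iff[OF V] G_fan_eq using vchars_iff by blast
next
  fix g assume "g \<in> vs.vchars V"
  then show "g \<in> {g \<in> G_fan. \<forall>i\<in>{1..r}-V. g i = 1}" using V vchars_iff[OF V] unfolding G_fan_eq by blast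
qed

section \<open>Faces, relative interiors and lattice points\<close>

definition face_at :: "real ^ 'n \<Rightarrow> (real ^ 'n) set" where
  "face_at x = {z\<in>P. \<forall>i\<in>tight x. el i z = 0}"

text \<open>A single supporting hyperplane suffices: the sum of the tight constraints is nonnegative
  on P and vanishes exactly where each of them does.\<close>

lemma face_at_face: "face_at x face_of P"
proof -
  have "P \<inter> {z. (\<Sum>i\<in>tight x. lat (u i)) \<bullet> z = - (\<Sum>i\<in>tight x. of_int (c i))} face_of P"
  proof (rule face_of_Int_supporting_hyperplane_ge[OF convex_P])
    fix z assume z: "z \<in> P"
    have "0 \<le> (\<Sum>i\<in>tight x. el i z)" using el_nonneg[OF z] by (intro sum_nonneg) (auto simp: tight_def)
    then show "(\<Sum>i\<in>tight x. lat (u i)) \<bullet> z \<ge> - (\<Sum>i\<in>tight x. of_int (c i))"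
      by (simp add: el_def sum.distrib inner_sum_left inner_sum_right inner_commute[of _ z])
  qed
  moreover have "P \<inter> {z. (\<Sum>i\<in>tight x. lat (u i)) \<bullet> z = - (\<Sum>i\<in>tight x. of_int (c i))} = face_at x"
  proof -
    have "(\<Sum>i\<in>tight x. lat (u i)) \<bullet> z = - (\<Sum>i\<in>tight x. of_int (c i)) \<longleftrightarrow> (\<forall>i\<in>tight x. el i z = 0)" if z: "z \<in> P" for z
    proof -
      have "(\<Sum>i\<in>tight x. lat (u i)) \<bullet> z = - (\<Sum>i\<in>tight x. of_int (c i)) \<longleftrightarrow> (\<Sum>i\<in>tight x. el i z) = 0"
        by (simp add: el_def sum.distrib inner_sum_left inner_sum_right inner_commute[of _ z] eq_neg_iff_add_eq_0)
      also have "\<dots> \<longleftrightarrow> (\<forall>i\<in>tight x. el i z = 0)"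
        using el_nonneg[OF z] by (intro sum_nonneg_eq_0_iff) (auto simp: tight_def)
      finally show ?thesis .
    qed
    then show ?thesis by (auto simp: face_at_def)
  qed
  ultimately show ?thesis by simp
qed

text \<open>Where the other constraints are strictly positive, the affine subspace cut out by the
  tight ones already lies in P. This yields both the relative interior and the dimension of the
  face.\<close>

lemma face_at_open:
  obtains T where "open T" "x \<in> P \<Longrightarrow> x \<in> T" "T \<inter> {z. \<forall>i\<in>tight x. el i z = 0} \<subseteq> face_at x"
proof -
  define T where "T = (\<Inter>i\<in>{1..r} - tight x. {z. el i z > 0})"
  have "open T" unfolding T_def el_def by (intro open_INT) (auto intro!: open_Collect_less continuous_intros)
  moreover have "x \<in> T" if "x \<in> P"
  proof -
    have "el i x > 0" if "i \<in> {1..r} - tight x" for i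
      using el_nonneg[OF \<open>x \<in> P\<close>, of i] that by (auto simp: tight_def)
    then show ?thesis by (simp add: T_def)
  qed
  moreover have "T \<inter> {z. \<forall>i\<in>tight x. el i z = 0} \<subseteq> face_at x"
  proof
    fix z assume z: "z \<in> T \<inter> {z. \<forall>i\<in>tight x. el i z = 0}"
    have "el i z \<ge> 0" if "i \<in> {1..r}" for i
      using z that by (cases "i \<in> tight x") (auto simp: T_def intro: less_imp_le)
    then show "z \<in> face_at x" using z by (simp add: face_at_def P_iff)
  qed
  ultimately show ?thesis using that by blast
qed

lemma affine_tight: "affine {z. \<forall>i\<in>J. el i z = 0}"
  unfolding affine_alt by (simp add: el_comb)

lemma rel_interior_face_at:
  assumes x: "x \<in> P"
  shows "x \<in> rel_interior (face_at x)"
proof -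
  obtain T where T: "open T" "x \<in> T" "T \<inter> {z. \<forall>i\<in>tight x. el i z = 0} \<subseteq> face_at x"
    using face_at_open x by blast
  have aff: "affine hull (face_at x) \<subseteq> {z. \<forall>i\<in>tight x. el i z = 0}"
    by (intro hull_minimal affine_tight) (auto simp: face_at_def)
  have xf: "x \<in> face_at x" using x by (auto simp: face_at_def tight_def)
  show ?thesis unfolding mem_rel_interior
  proof (intro exI[of _ T] conjI)
    show "x \<in> T \<inter> face_at x" using T(2) xf by (rule IntI)
    show "T \<inter> affine hull (face_at x) \<subseteq> face_at x"
      by (rule order_trans[OF Int_mono[OF order_refl aff] T(3)])
  qed (rule T(1))
qed

text \<open>Here simplicity enters: the tight set of x is part of the tight set V of a vertex. The
  edge directions of V for the remaining indices are independent and span the direction space of the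
  face.\<close>

lemma aff_dim_face_at:
  assumes x: "x \<in> P"
  shows "aff_dim (face_at x) = int (CARD('n) - card (tight x))"
proof -
  let ?H = "{z. \<forall>i\<in>tight x. el i z = 0}"
  obtain T where T: "open T" "x \<in> T" "T \<inter> ?H \<subseteq> face_at x" using face_at_open x by blast
  have xH: "x \<in> ?H" by (auto simp: tight_def)
  have "aff_dim ?H = aff_dim (?H \<inter> T)"
    using T(2) xH by (intro aff_dim_convex_Int_open[OF affine_imp_convex[OF affine_tight] T(1), symmetric]) blast
  also have "\<dots> \<le> aff_dim (face_at x)" using T by (intro aff_dim_subset) blast
  finally have ge: "aff_dim ?H \<le> aff_dim (face_at x)" .
  have "aff_dim (face_at x) \<le> aff_dim ?H" by (rule aff_dim_subset) (auto simp: face_at_def)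
  with ge have "aff_dim (face_at x) = aff_dim ?H" by simp
  also have "aff_dim ?H = int (CARD('n) - card (tight x))"
  proof -
    have "\<And>i. i \<in> {1..r} \<Longrightarrow> vs.ell i x \<ge> 0" using el_nonneg[OF x] by (simp add: vs_ell)
    then obtain V where V: "V \<in> VV" "{i\<in>{1..r}. vs.ell i x = 0} \<subseteq> V" using vs.tight_subset_vertex by blast
    have JV: "tight x \<subseteq> V" using V(2) by (simp add: vs_ell tight_def)
    have finV: "finite V" using vs.finite_V[OF V(1)] .
    let ?B = "\<alpha> V ` (V - tight x)"
    have inj: "inj_on (\<alpha> V) (V - tight x)"
    proof (rule inj_onI)
      fix i j assume ij: "i \<in> V - tight x" "j \<in> V - tight x" "\<alpha> V i = \<alpha> V j"
      show "i = j"
      proof (rule ccontr)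
        assume "i \<noteq> j"
        then have "\<alpha> V j \<bullet> lat (u i) = 0" using ij vs.dual[OF V(1), of j i] by simp
        moreover have "\<alpha> V i \<bullet> lat (u i) = 1" using ij vs.dual[OF V(1), of i i] by simp
        ultimately show False using ij(3) by simp
      qed
    qed
    have "independent ?B"
    proof (rule independent_if_scalars_zero)
      show "finite ?B" using finV by simp
      fix f a assume s0: "(\<Sum>a\<in>?B. f a *\<^sub>R a) = 0" and "a \<in> ?B"
      then obtain k where k: "k \<in> V - tight x" "a = \<alpha> V k" by blast
      have "(\<Sum>i\<in>V - tight x. f (\<alpha> V i) *\<^sub>R \<alpha> V i) = 0" using s0 by (simp add: sum.reindex[OF inj])
      then have "(\<Sum>i\<in>V - tight x. f (\<alpha> V i) *\<^sub>R \<alpha> V i) \<bullet> lat (u k) = 0" by simp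
      also have "(\<Sum>i\<in>V - tight x. f (\<alpha> V i) *\<^sub>R \<alpha> V i) \<bullet> lat (u k) = (\<Sum>i\<in>V - tight x. if i = k then f (\<alpha> V i) else 0)"
        unfolding inner_sum_left using k vs.dual[OF V(1)] by (intro sum.cong refl) auto
      finally show "f a = 0" using k finV by simp
    qed
    then have dimB: "dim ?B = CARD('n) - card (tight x)"
      using vs.VV_card[OF V(1)] JV by (simp add: dim_eq_card_independent card_image[OF inj] card_Diff_subset)
    \<comment> \<open>In the expansion of z - x at V the terms with tight index vanish; conversely
      the remaining edge directions are orthogonal to all tight normals.\<close>
    have "?H = (+) x ` span ?B"
    proof (intro set_eqI iffI)
      fix z assume z: "z \<in> ?H"
      have "z - x = (\<Sum>i\<in>V. ((z - x) \<bullet> lat (u i)) *\<^sub>R \<alpha> V i)" using vs.expand[OF V(1), of "z - x"] by simp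
      also have "\<dots> = (\<Sum>i\<in>V - tight x. ((z - x) \<bullet> lat (u i)) *\<^sub>R \<alpha> V i)"
      proof (intro sum.mono_neutral_right ballI)
        fix i assume "i \<in> V - (V - tight x)"
        then have "el i z = 0" "el i x = 0" using z by (auto simp: tight_def)
        then show "((z - x) \<bullet> lat (u i)) *\<^sub>R \<alpha> V i = 0" by (simp add: el_def inner_diff_left)
      qed (use finV in auto)
      also have "\<dots> \<in> span ?B" by (intro span_sum span_scale span_base) auto
      finally show "z \<in> (+) x ` span ?B" by (auto intro!: image_eqI[of _ _ "z - x"])
    next
      fix z assume "z \<in> (+) x ` span ?B"
      then obtain y where y: "y \<in> span ?B" "z = x + y" by auto
      have "y \<bullet> lat (u i) = 0" if i: "i \<in> tight x" for i
      proof -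
        have "span ?B \<subseteq> {y. lat (u i) \<bullet> y = 0}"
          using i JV vs.dual[OF V(1)] by (intro span_minimal subspace_hyperplane) (auto simp: inner_commute)
        then show ?thesis using y(1) by (auto simp: inner_commute)
      qed
      then show "z \<in> ?H" using xH by (auto simp: y(2) el_add)
    qed
    then have "aff_dim ?H = aff_dim (span ?B)" by (simp add: aff_dim_translation_eq)
    also have "\<dots> = int (dim ?B)" by (simp add: aff_dim_subspace)
    finally show ?thesis by (simp add: dimB)
  qed
  finally show ?thesis .
qed

text \<open>Faces whose relative interiors meet are equal, and x lies in the relative interior of
  \<open>face_at x\<close>.\<close>

lemma face_unique:
  assumes "E face_of P" "x \<in> rel_interior E"
  shows "E = face_at x"
proof -
  have "x \<in> E" using assms(2) rel_interior_subset by blast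
  then have "x \<in> P" using assms(1) face_of_imp_subset by blast
  then have "x \<in> rel_interior (face_at x)" by (rule rel_interior_face_at)
  then show ?thesis using face_of_eq[OF assms(1) face_at_face] assms(2) by blast
qed

text \<open>Two points in the relative interior of the same face have the same tight constraints, so
  membership in the facets of K can be tested at x.\<close>

lemma face_at_avoids_iff:
  assumes x: "x \<in> P" and K: "K \<subseteq> {1..r}"
  shows "rel_interior (face_at x) \<subseteq> P - (\<Union>i\<in>K. F i) \<longleftrightarrow> tight x \<inter> K = {}"
proof
  assume "rel_interior (face_at x) \<subseteq> P - (\<Union>i\<in>K. F i)"
  then have nF: "x \<notin> F i" if "i \<in> K" for i using rel_interior_face_at[OF x] that by blast
  show "tight x \<inter> K = {}"
  proof (rule ccontr)
    assume "tight x \<inter> K \<noteq> {}"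
    then obtain i where i: "i \<in> K" "i \<in> {1..r}" "el i x = 0" by (auto simp: tight_def)
    then have "x \<in> F i" using x u_nonzero_and_F_eq(2)[OF i(2)] by simp
    then show False using nF i(1) by blast
  qed
next
  assume disj: "tight x \<inter> K = {}"
  show "rel_interior (face_at x) \<subseteq> P - (\<Union>i\<in>K. F i)"
  proof
    fix z assume z: "z \<in> rel_interior (face_at x)"
    have zP: "z \<in> P" using z rel_interior_subset face_of_imp_subset[OF face_at_face] by blast
    have eq: "face_at x = face_at z" using face_unique[OF face_at_face z] .
    have "z \<notin> F i" if i: "i \<in> K" for i
    proof
      assume "z \<in> F i"
      have ir: "i \<in> {1..r}" using i K by blast
      then have "i \<in> tight z" using \<open>z \<in> F i\<close> u_nonzero_and_F_eq(2)[OF ir] by (simp add: tight_def)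
      moreover have "x \<in> face_at z" unfolding eq[symmetric] using x by (auto simp: face_at_def tight_def)
      ultimately have "el i x = 0" by (simp add: face_at_def)
      then show False using disj i ir by (auto simp: tight_def)
    qed
    then show "z \<in> P - (\<Union>i\<in>K. F i)" using zP by blast
  qed
qed

text \<open>Exchange the order of summation: the relative interiors of the faces partition P, so
  each lattice point meets exactly one face, whose dimension is n minus the number of its tight
  constraints.\<close>

lemma face_sum:
  assumes K: "K \<subseteq> {1..r}"
  shows "(\<Sum>E | E face_of P \<and> E \<noteq> {} \<and> rel_interior E \<subseteq> P - (\<Union>i\<in>K. F i).
            (1 + yvar) ^ nat (aff_dim E) * scal (\<Sum>m\<in>rel_interior E \<inter> range lat. f m)) =
    (\<Sum>m | \<forall>i\<in>{1..r}. vs.ell i (lat m) \<ge> 0. to_fract (vs.weight_poly K (lat m)) * scal (f (lat m)))"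
proof -
  let ?EE = "{E. E face_of P \<and> E \<noteq> {} \<and> rel_interior E \<subseteq> P - (\<Union>i\<in>K. F i)}"
  let ?M = "{m. \<forall>i\<in>{1..r}. vs.ell i (lat m) \<ge> 0}"
  define X where "X = P \<inter> range lat"
  have XM: "X = lat ` ?M" unfolding X_def vs_ell by (auto simp: P_iff)
  have finX: "finite X" unfolding XM using vs.finite_lattice_points by simp
  have finE: "finite ?EE" by (rule finite_subset[OF _ finite_polytope_faces[OF polytope]]) auto
  have "(\<Sum>E\<in>?EE. (1 + yvar) ^ nat (aff_dim E) * scal (\<Sum>m\<in>rel_interior E \<inter> range lat. f m)) =
    (\<Sum>E\<in>?EE. \<Sum>x\<in>X. if x \<in> rel_interior E then (1 + yvar) ^ nat (aff_dim E) * scal (f x) else 0)"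
  proof (rule sum.cong[OF refl])
    fix E assume E: "E \<in> ?EE"
    have "rel_interior E \<inter> range lat = {x\<in>X. x \<in> rel_interior E}"
      using E rel_interior_subset face_of_imp_subset unfolding X_def by blast
    then show "(1 + yvar) ^ nat (aff_dim E) * scal (\<Sum>m\<in>rel_interior E \<inter> range lat. f m) =
      (\<Sum>x\<in>X. if x \<in> rel_interior E then (1 + yvar) ^ nat (aff_dim E) * scal (f x) else 0)"
      using finX by (simp add: scal_sum sum_distrib_left flip: sum.inter_filter)
  qed
  also have "\<dots> = (\<Sum>x\<in>X. \<Sum>E\<in>?EE. if x \<in> rel_interior E then (1 + yvar) ^ nat (aff_dim E) * scal (f x) else 0)"
    by (rule sum.swap)
  also have "\<dots> = (\<Sum>x\<in>X. to_fract (vs.weight_poly K x) * scal (f x))"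
  proof (rule sum.cong[OF refl])
    fix x assume "x \<in> X"
    then have x: "x \<in> P" by (simp add: X_def)
    have wp: "vs.weight_poly K x = (if tight x \<inter> K = {} then [:1, 1:] ^ (CARD('n) - card (tight x)) else 0)"
      unfolding vs.weight_poly_def vs_ell tight_def ..
    have iff: "E \<in> ?EE \<and> x \<in> rel_interior E \<longleftrightarrow> E = face_at x \<and> tight x \<inter> K = {}" for E
    proof (intro iffI conjI)
      assume E: "E \<in> ?EE \<and> x \<in> rel_interior E"
      then show eq: "E = face_at x" by (intro face_unique) simp_all
      show "tight x \<inter> K = {}"
        using E unfolding face_at_avoids_iff[OF x K, symmetric] eq[symmetric] by simp
    next
      assume E: "E = face_at x \<and> tight x \<inter> K = {}"
      then show "x \<in> rel_interior E" using rel_interior_face_at[OF x] by simp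
      then have "E \<noteq> {}" by auto
      then show "E \<in> ?EE"
        using E face_at_face[of x] face_at_avoids_iff[OF x K] by simp
    qed
    have "(\<Sum>E\<in>?EE. if x \<in> rel_interior E then (1 + yvar) ^ nat (aff_dim E) * scal (f x) else 0) =
      (\<Sum>E\<in>{E\<in>?EE. x \<in> rel_interior E}. (1 + yvar) ^ nat (aff_dim E) * scal (f x))"
      by (rule sum.inter_filter[OF finE, symmetric])
    also have "{E\<in>?EE. x \<in> rel_interior E} = (if tight x \<inter> K = {} then {face_at x} else {})"
      using iff by auto
    also have "(\<Sum>E\<in>\<dots>. (1 + yvar) ^ nat (aff_dim E) * scal (f x)) = to_fract (vs.weight_poly K x) * scal (f x)"
      unfolding wp by (simp add: aff_dim_face_at[OF x] one_plus_yvar to_fract_power)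
    finally show "(\<Sum>E\<in>?EE. if x \<in> rel_interior E then (1 + yvar) ^ nat (aff_dim E) * scal (f x) else 0) =
      to_fract (vs.weight_poly K x) * scal (f x)" .
  qed
  also have "\<dots> = (\<Sum>m\<in>?M. to_fract (vs.weight_poly K (lat m)) * scal (f (lat m)))"
    unfolding XM by (subst sum.reindex) (auto simp: inj_on_def)
  finally show ?thesis .
qed

theorem euler_maclaurin:
  assumes K: "K \<subseteq> {1..r}" and f: "polynomial_function f"
  shows "apply_at_zero r (T_op CARD('n) r K G_fan) (\<lambda>h. LINT m:shifted_polytope r u c h|lborel. f m)
       = (\<Sum>E | E face_of P \<and> E \<noteq> {} \<and> rel_interior E \<subseteq> P - (\<Union>i\<in>K. F i).
            (1 + yvar) ^ nat (aff_dim E) * scal (\<Sum>m\<in>rel_interior E \<inter> range lat. f m))"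
proof -
  \<comment> \<open>All edge directions of P. Powers of forms that avoid these finitely many nonzero
    vectors are powers of generic forms in the sense of the vertex system.\<close>
  define D where "D = (\<Union>V\<in>VV. \<alpha> V ` V)"
  have finD: "finite D" unfolding D_def using vs.finite_VV vs.finite_V by blast
  have D0: "0 \<notin> D"
  proof
    assume "0 \<in> D"
    then obtain V i where "V \<in> VV" "i \<in> V" "\<alpha> V i = 0" unfolding D_def by fastforce
    then show False using vs.\<alpha>_ne0 by blast
  qed
  obtain N :: nat and \<xi> k lam where l: "\<And>l d. l < N \<Longrightarrow> d \<in> D \<Longrightarrow> \<xi> l \<bullet> d \<noteq> 0"
    and fl: "\<And>x. f x = (\<Sum>l<N. lam l * complex_of_real ((\<xi> l \<bullet> x) ^ k l))"
    by (rule polynomial_generic_powers[OF finD D0 f], rule that)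
  have gen: "vs.generic (\<xi> l)" if "l \<in> {..<N}" for l
    using l that by (auto simp: vs.generic_def D_def)
  show ?thesis
    unfolding face_sum[OF K] shifted_polytope_def
    by (rule vs.euler_maclaurin_vertex_system[OF refl K vs_vert_lattice finite_G_fan G_fan_vertex finite_lessThan gen fl])
qed

end

theorem theorem6p4:
  fixes P :: "(real ^ 'n) set"
    and r :: nat
    and F :: "nat \<Rightarrow> (real ^ 'n) set"
    and u :: "nat \<Rightarrow> int ^ 'n"
    and c :: "nat \<Rightarrow> int"
    and K :: "nat set"
    and f :: "real ^ 'n \<Rightarrow> complex"
  defines "\<rho> \<equiv> (\<lambda>i. inner_normal_cone P (F i))"
  assumes "lattice_polytope P"
    and "aff_dim P = int CARD('n)"
    and "simple_polytope P"
    and "bij_betw F {1..r} {E. E facet_of P}"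
    and "\<And>i. i \<in> {1..r} \<Longrightarrow> is_ray_generator (\<rho> i) (u i)"
    and "P = shifted_polytope r u c (\<lambda>_. 0)"
    and "K \<subseteq> {1..r}"
    and "polynomial_function f"
  shows "apply_at_zero r (T_op CARD('n) r K (Gfan r u \<rho> (inner_normal_fan P)))
           (\<lambda>h. LINT m:shifted_polytope r u c h|lborel. f m)
       = (\<Sum>E | E face_of P \<and> E \<noteq> {} \<and> rel_interior E \<subseteq> P - (\<Union>i\<in>K. F i).
            (1 + yvar) ^ nat (aff_dim E) * scal (\<Sum>m\<in>rel_interior E \<inter> range lat. f m))"
proof -
  interpret simple_lattice_polytope P r F u c
    using assms by unfold_locales auto
  show ?thesis
    unfolding \<rho>_def by (rule euler_maclaurin) fact+
qed

end
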